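(* Let $N$ be a manifold of dimension $n$. Let $f$ be an injection of $N$ into an open subset $U$ of $\mathbb{R}^m$. Let $F:U\to\mathbb{R}^\ell$ be a mapping. Then there exists a subset $\Sigma$ of $\mathcal{L}(\mathbb{R}^m,\mathbb{R}^\ell)$ with Lebesgue measure zero such that for any $\pi\in\mathcal{L}(\mathbb{R}^m,\mathbb{R}^\ell)-\Sigma$, and for any $s$ with $2\le s\le s_f$, the mapping $(F_\pi\circ f)^{(s)}:N^{(s)}\to(\mathbb{R}^\ell)^s$ is transverse to the submanifold $\Delta_s$. Moreover, for any such $\pi$, if the mapping $F_\pi$ satisfies $|F_\pi^{-1}(y)|\le s_f$ for any $y\in\mathbb{R}^\ell$, then $F_\pi\circ f:N\to\mathbb{R}^\ell$ is a mapping with normal crossings.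
   Context: Conventions: $\ell,m,n$ are positive integers; all manifolds and mappings (in particular the injection $f$) are of class $C^\infty$ and all manifolds are without boundary. $\mathcal{L}(\mathbb{R}^m,\mathbb{R}^\ell)$ is the space of all linear mappings $\mathbb{R}^m\to\mathbb{R}^\ell$, identified with $(\mathbb{R}^m)^\ell$ (via matrices), which gives it Lebesgue measure. For $\pi\in\mathcal{L}(\mathbb{R}^m,\mathbb{R}^\ell)$ and $F:U\to\mathbb{R}^\ell$, $F_\pi=F+\pi|_U:U\to\mathbb{R}^\ell$. $|X|$ denotes the cardinality of a set $X$. Transversality: for a submanifold $W$ of a manifold $P$, a mapping $g:N\to P$ is transverse to $W$ if for every $q\in N$ either $g(q)\notin W$, or $g(q)\in W$ and $dg_q(T_qN)+T_{g(q)}W=T_{g(q)}P$. $N^{(s)}=\{(q_1,\ldots,q_s)\in N^s\mid q_i\ne q_j\ (i\ne j)\}$, an open submanifold of $N^s$. For $g:N\to P$, $g^{(s)}:N^{(s)}\to P^s$ is $g^{(s)}(q_1,\ldots,q_s)=(g(q_1),\ldots,g(q_s))$. $\Delta_s=\{(y,\ldots,y)\in P^s\mid y\in P\}$ (here $P=\mathbb{R}^\ell$). A mapping $g:N\to P$ is a mapping with normal crossings if for every integer $s\ge2$ the mapping $g^{(s)}:N^{(s)}\to P^s$ is transverse to $\Delta_s$. For an injection $f:N\to\mathbb{R}^m$, $s_f=\max\left\{s\ \middle|\ \forall(q_1,\ldots,q_s)\in N^{(s)},\ \dim\sum_{i=2}^s\mathbb{R}\,\overrightarrow{f(q_1)f(q_i)}=s-1\right\}$,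 where $\overrightarrow{f(q_1)f(q_i)}=f(q_i)-f(q_1)$; one has $2\le s_f\le m+1$. *)

theory Defs
  imports "HOL-Analysis.Analysis"
begin

text \<open>
  For a finite index set \<open>I\<close>, the space \<open>R^I\<close> is the carrier of \<^term>\<open>powertop_real I\<close>, i.e. the
  functions in \<^term>\<open>PiE I (\<lambda>i. UNIV::real set)\<close>. The dimension is a value rather than a type, since
  the \<open>s\<close>-fold products below have a dimension that varies with \<open>s\<close>.
\<close>

definition partial_deriv :: "'i \<Rightarrow> (('i \<Rightarrow> real) \<Rightarrow> real) \<Rightarrow> ('i \<Rightarrow> real) \<Rightarrow> real"
  where "partial_deriv i h x = deriv (\<lambda>t. h (x(i := t))) (x i)"

text \<open>\<open>C_k_on I V k h\<close>: all iterated partial derivatives of \<open>h\<close> up to order \<open>k\<close> exist and are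
  continuous on \<open>V\<close>, which is meant to be an open subset of \<open>R^I\<close>.\<close>

primrec C_k_on :: "'i set \<Rightarrow> ('i \<Rightarrow> real) set \<Rightarrow> nat \<Rightarrow> (('i \<Rightarrow> real) \<Rightarrow> real) \<Rightarrow> bool"
  where
    "C_k_on I V 0 h \<longleftrightarrow> continuous_map (subtopology (powertop_real I) V) euclideanreal h"
  | "C_k_on I V (Suc k) h \<longleftrightarrow>
       continuous_map (subtopology (powertop_real I) V) euclideanreal h \<and>
       (\<forall>i\<in>I. (\<forall>x\<in>V. (\<lambda>t. h (x(i := t))) field_differentiable at (x i)) \<and>
              C_k_on I V k (partial_deriv i h))"

definition C_infinity_on :: "'i set \<Rightarrow> ('i \<Rightarrow> real) set \<Rightarrow> (('i \<Rightarrow> real) \<Rightarrow> real) \<Rightarrow> bool"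
  where "C_infinity_on I V h \<longleftrightarrow> (\<forall>k. C_k_on I V k h)"

text \<open>The atlas consists of pairs of a chart domain and a chart with values in \<open>R^I\<close>, where \<open>I\<close> is
  the index set \<open>coords\<close>. Atlases are not required to be maximal.\<close>

record ('a, 'i) smooth_space =
  top_of :: "'a topology"
  coords :: "'i set"
  atlas :: "('a set \<times> ('a \<Rightarrow> 'i \<Rightarrow> real)) set"

definition smooth_manifold :: "('a, 'i) smooth_space \<Rightarrow> bool"
  where "smooth_manifold M \<longleftrightarrow>
    Hausdorff_space (top_of M) \<and> second_countable (top_of M) \<and> finite (coords M) \<and>
    topspace (top_of M) = (\<Union>(V, \<phi>)\<in>atlas M. V) \<and>
    (\<forall>(V, \<phi>)\<in>atlas M.
       openin (top_of M) V \<and> openin (powertop_real (coords M)) (\<phi> ` V) \<and>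
       homeomorphic_map (subtopology (top_of M) V)
         (subtopology (powertop_real (coords M)) (\<phi> ` V)) \<phi>) \<and>
    (\<forall>(V, \<phi>)\<in>atlas M. \<forall>(W, \<psi>)\<in>atlas M. \<forall>j\<in>coords M.
       C_infinity_on (coords M) (\<phi> ` (V \<inter> W)) (\<lambda>x. \<psi> (inv_into V \<phi> x) j))"

definition smooth_map :: "('a, 'i) smooth_space \<Rightarrow> ('b, 'j) smooth_space \<Rightarrow> ('a \<Rightarrow> 'b) \<Rightarrow> bool"
  where "smooth_map M P g \<longleftrightarrow>
    continuous_map (top_of M) (top_of P) g \<and>
    (\<forall>(V, \<phi>)\<in>atlas M. \<forall>(W, \<psi>)\<in>atlas P. \<forall>j\<in>coords P.
       C_infinity_on (coords M) (\<phi> ` (V \<inter> g -` W)) (\<lambda>x. \<psi> (g (inv_into V \<phi> x)) j))"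

definition real_line :: "(real, unit) smooth_space"
  where "real_line = \<lparr>top_of = euclideanreal, coords = UNIV, atlas = {(UNIV, \<lambda>t _. t)}\<rparr>"

definition Euclid :: "(real ^ 'k, 'k) smooth_space"
  where "Euclid = \<lparr>top_of = euclidean, coords = UNIV, atlas = {(UNIV, \<lambda>x i. x $ i)}\<rparr>"

definition open_submanifold :: "('a, 'i) smooth_space \<Rightarrow> 'a set \<Rightarrow> ('a, 'i) smooth_space"
  where "open_submanifold M U =
    \<lparr>top_of = subtopology (top_of M) U, coords = coords M,
     atlas = (\<lambda>(V, \<phi>). (V \<inter> U, \<phi>)) ` atlas M\<rparr>"

text \<open>\<open>M^s\<close>; an \<open>s\<close>-tuple is an extensional function on \<open>{1..s}\<close>.\<close>

definition power_manifold :: "('a, 'i) smooth_space \<Rightarrow> nat \<Rightarrow> (nat \<Rightarrow> 'a, nat \<times> 'i) smooth_space"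
  where "power_manifold M s =
    \<lparr>top_of = product_topology (\<lambda>_. top_of M) {1..s},
     coords = {1..s} \<times> coords M,
     atlas = {(PiE {1..s} (\<lambda>k. fst (c k)),
               \<lambda>q. restrict (\<lambda>(k, i). snd (c k) (q k) i) ({1..s} \<times> coords M)) | c.
              \<forall>k\<in>{1..s}. c k \<in> atlas M}\<rparr>"

definition curves_at :: "('a, 'i) smooth_space \<Rightarrow> 'a \<Rightarrow> (real \<Rightarrow> 'a) set"
  where "curves_at M p =
    {\<gamma>. \<gamma> 0 = p \<and> (\<exists>\<epsilon>>0. smooth_map (open_submanifold real_line {-\<epsilon><..<\<epsilon>}) M \<gamma>)}"

text \<open>The tangent vector at parameter \<open>0\<close> of a smooth curve, i.e. its class modulo having the same
  velocity, is represented by the family of coordinate vectors of the velocity in all charts around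
  the point. The default value \<open>0\<close> makes addition of tangent vectors pointwise.\<close>

definition velocity ::
  "('a, 'i) smooth_space \<Rightarrow> (real \<Rightarrow> 'a) \<Rightarrow> ('a set \<times> ('a \<Rightarrow> 'i \<Rightarrow> real)) \<Rightarrow> 'i \<Rightarrow> real"
  where "velocity M \<gamma> = (\<lambda>c i.
    if c \<in> atlas M \<and> \<gamma> 0 \<in> fst c \<and> i \<in> coords M then deriv (\<lambda>t. snd c (\<gamma> t) i) 0 else 0)"

definition tangent_space ::
  "('a, 'i) smooth_space \<Rightarrow> 'a \<Rightarrow> (('a set \<times> ('a \<Rightarrow> 'i \<Rightarrow> real)) \<Rightarrow> 'i \<Rightarrow> real) set"
  where "tangent_space M p = velocity M ` curves_at M p"

text \<open>For an embedded submanifold \<open>W\<close> of \<open>P\<close>, the tangent space \<open>T_y W\<close> as a subspace of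
  \<open>T_y P\<close>: the smooth curves in \<open>W\<close> are the smooth curves in \<open>P\<close> that stay in \<open>W\<close>.\<close>

definition tangent_subspace ::
  "('a, 'i) smooth_space \<Rightarrow> 'a set \<Rightarrow> 'a \<Rightarrow> (('a set \<times> ('a \<Rightarrow> 'i \<Rightarrow> real)) \<Rightarrow> 'i \<Rightarrow> real) set"
  where "tangent_subspace P W y =
    velocity P ` {\<gamma> \<in> curves_at P y. \<exists>\<epsilon>>0. \<forall>t\<in>{-\<epsilon><..<\<epsilon>}. \<gamma> t \<in> W}"

text \<open>The value does not depend on the representing curve chosen when \<open>g\<close> is smooth.\<close>

definition differential ::
  "('a, 'i) smooth_space \<Rightarrow> ('b, 'j) smooth_space \<Rightarrow> ('a \<Rightarrow> 'b) \<Rightarrow> 'a \<Rightarrow>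
   (('a set \<times> ('a \<Rightarrow> 'i \<Rightarrow> real)) \<Rightarrow> 'i \<Rightarrow> real) \<Rightarrow>
   (('b set \<times> ('b \<Rightarrow> 'j \<Rightarrow> real)) \<Rightarrow> 'j \<Rightarrow> real)"
  where "differential M P g q v =
    velocity P (g \<circ> (SOME \<gamma>. \<gamma> \<in> curves_at M q \<and> velocity M \<gamma> = v))"

definition transverse ::
  "('a, 'i) smooth_space \<Rightarrow> ('b, 'j) smooth_space \<Rightarrow> ('a \<Rightarrow> 'b) \<Rightarrow> 'b set \<Rightarrow> bool"
  where "transverse M P g W \<longleftrightarrow>
    (\<forall>q\<in>topspace (top_of M).
       g q \<notin> W \<or>
       (g q \<in> W \<and>
        {(\<lambda>c j. v c j + w c j) | v w.
           v \<in> differential M P g q ` tangent_space M q \<and> w \<in> tangent_subspace P W (g q)}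
        = tangent_space P (g q)))"

definition distinct_tuples :: "'a set \<Rightarrow> nat \<Rightarrow> (nat \<Rightarrow> 'a) set"
  where "distinct_tuples S s = {q \<in> PiE {1..s} (\<lambda>_. S). inj_on q {1..s}}"

definition distinct_power :: "('a, 'i) smooth_space \<Rightarrow> nat \<Rightarrow> (nat \<Rightarrow> 'a, nat \<times> 'i) smooth_space"
  where "distinct_power M s =
    open_submanifold (power_manifold M s) (distinct_tuples (topspace (top_of M)) s)"

definition tuple_map :: "nat \<Rightarrow> ('a \<Rightarrow> 'b) \<Rightarrow> (nat \<Rightarrow> 'a) \<Rightarrow> (nat \<Rightarrow> 'b)"
  where "tuple_map s g q = (\<lambda>k\<in>{1..s}. g (q k))"

definition diagonal :: "('b, 'j) smooth_space \<Rightarrow> nat \<Rightarrow> (nat \<Rightarrow> 'b) set"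
  where "diagonal P s = {(\<lambda>k\<in>{1..s}. y) | y. y \<in> topspace (top_of P)}"

definition normal_crossings ::
  "('a, 'i) smooth_space \<Rightarrow> ('b, 'j) smooth_space \<Rightarrow> ('a \<Rightarrow> 'b) \<Rightarrow> bool"
  where "normal_crossings M P g \<longleftrightarrow>
    (\<forall>s\<ge>2. transverse (distinct_power M s) (power_manifold P s) (tuple_map s g) (diagonal P s))"

text \<open>\<open>s_f\<close>. The set is bounded by \<open>m + 1\<close> as soon as \<open>S\<close> is infinite, which holds for every nonempty
  manifold \<open>S\<close> of positive dimension.\<close>

definition s_index :: "'a set \<Rightarrow> ('a \<Rightarrow> real ^ 'm) \<Rightarrow> nat"
  where "s_index S f = Max {s. 1 \<le> s \<and>
    (\<forall>q\<in>distinct_tuples S s. dim (span ((\<lambda>i. f (q i) - f (q 1)) ` {2..s})) = s - 1)}"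

end

theory Submission
  imports Defs
begin

text \<open>Put \<open>G = (F + \<pi>) \<circ> f\<close>. A tuple \<open>q\<close> of distinct points is sent to the diagonal iff \<open>G(q\<^sub>k) = G(q\<^sub>1)\<close> for
\<open>2 \<le> k \<le> s\<close>; read these as equations in the pair \<open>(q, \<pi>)\<close>. For \<open>s \<le> s_f\<close> the vectors
\<open>f(q\<^sub>k) - f(q\<^sub>1)\<close> are linearly independent (\<open>s_index_independent\<close>), so these equations have
independent differentials already with respect to \<open>\<pi>\<close>, and their solution set \<open>Z\<close> is smooth.
A covector that witnesses a failure of transversality at \<open>q\<close> is a linear combination of the
equations whose \<open>q\<close>-derivative vanishes; its \<open>\<pi>\<close>-part then shows that \<open>(q, \<pi>)\<close> is a critical point
of the projection of \<open>Z\<close> to the space of matrices. Hence the bad \<open>\<pi>\<close> are critical values, and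
Sard's theorem makes them a null set (\<open>generic_perturbation_in_coordinates\<close>). Countably many
tuples of charts and finitely many \<open>s\<close> suffice, because \<open>s_f \<le> m + 1\<close>.

The dimension of \<open>Z\<close> may exceed that of the target, so Sard's theorem is needed in its strong form
for smooth maps. It is proved here directly for a map \<open>g\<close> restricted to a set of constraints
(\<open>sard_on_constraint_set\<close>), by Milnor's induction on the dimension of the constraint set, arranged
so that the ambient space never changes. The state of the induction is a family \<open>\<Phi>\<close> of as many
functions as there are coordinates, with independent gradients, together with the set \<open>K\<close> of those
indices whose functions are constrained to vanish. The remaining \<open>\<Phi>\<^sub>c\<close> serve as coordinates of the
constraint set, and \<open>along \<Phi> c\<close> is differentiation with respect to the coordinate \<open>\<Phi>\<^sub>c\<close>. Fix one
component \<open>g\<^sub>0\<close> of \<open>g\<close>. If some first derivative of \<open>g\<^sub>0\<close> is nonzero, then \<open>g\<^sub>0 - t\<close> replaces \<open>\<Phi>\<^sub>c\<close>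
as a further constraint, and Fubini's theorem integrates over \<open>t\<close>. If a higher derivative is the
first one not to vanish, then its immediate predecessor, which vanishes, becomes a further
constraint. In both cases the constraint set loses a dimension. If all derivatives up to the order
of the ambient dimension vanish, then \<open>g\<^sub>0\<close> is so steeply Hoelder on the set of such points
(\<open>flat_points_Holder\<close>) that its image is null.

Transversality is finally reduced to a linear system in charts (\<open>transverse_if_solvable\<close>): a
straight line in a product chart has any prescribed velocity, and the velocity of the image of
any curve depends only on the velocity of the curve, by the chain rule. For \<open>s > s_f\<close> the condition on
the fibres leaves no \<open>s\<close> distinct points with the same value, as \<open>f\<close> is injective.\<close>

section \<open>Functions of class \<open>C^k\<close> on \<open>real^'i\<close>\<close>

definition partial :: "'i::finite \<Rightarrow> (real^'i \<Rightarrow> real) \<Rightarrow> real^'i \<Rightarrow> real"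
  where "partial i h x = frechet_derivative h (at x) (axis i 1)"

definition grad :: "(real^'i::finite \<Rightarrow> real) \<Rightarrow> real^'i \<Rightarrow> real^'i"
  where "grad h x = (\<chi> i. partial i h x)"

text \<open>The partial derivatives are total functions with arbitrary values off the points of
differentiability, so all identities between them hold on an open set only and are transferred by
\<open>cdiff_cong\<close>.\<close>

primrec cdiff :: "nat \<Rightarrow> (real^'i::finite) set \<Rightarrow> (real^'i \<Rightarrow> real) \<Rightarrow> bool"
  where
    "cdiff 0 V h \<longleftrightarrow> continuous_on V h"
  | "cdiff (Suc k) V h \<longleftrightarrow> (\<forall>x\<in>V. h differentiable (at x)) \<and> (\<forall>i. cdiff k V (partial i h))"

definition smooth :: "(real^'i::finite) set \<Rightarrow> (real^'i \<Rightarrow> real) \<Rightarrow> bool"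
  where "smooth V h \<longleftrightarrow> (\<forall>k. cdiff k V h)"

lemma partial_eq:
  assumes "(h has_derivative D) (at x)"
  shows "partial i h x = D (axis i 1)"
  using frechet_derivative_at[OF assms] by (simp add: partial_def)

lemma has_derivative_grad:
  fixes h :: "real^'i::finite \<Rightarrow> real"
  assumes "h differentiable (at x)"
  shows "(h has_derivative (\<lambda>v. grad h x \<bullet> v)) (at x)"
proof -
  let ?D = "frechet_derivative h (at x)"
  have h: "(h has_derivative ?D) (at x)"
    using assms by (simp add: frechet_derivative_works)
  have lin: "linear ?D"
    using assms by (rule linear_frechet_derivative)
  have "?D v = grad h x \<bullet> v" for v :: "real^'i"
  proof -
    have "?D v = ?D (\<Sum>i\<in>UNIV. (v $ i) *\<^sub>R axis i 1)"
      using basis_expansion[of v] by (simp add: scalar_mult_eq_scaleR)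
    also have "\<dots> = (\<Sum>i\<in>UNIV. v $ i * ?D (axis i 1))"
      by (simp add: linear_sum[OF lin] linear_scale[OF lin])
    finally show ?thesis
      by (simp add: grad_def partial_def inner_vec_def mult.commute)
  qed
  with h show ?thesis by (metis (no_types, lifting) ext)
qed

lemma partial_transform:
  assumes "open V" "x \<in> V" "\<And>y. y \<in> V \<Longrightarrow> f y = g y"
  shows "partial i f x = partial i g x"
proof -
  have "(f has_derivative D) (at x) \<longleftrightarrow> (g has_derivative D) (at x)" for D
    using assms has_derivative_transform_within_open by (metis (no_types, lifting))
  then show ?thesis by (simp add: partial_def frechet_derivative_def)
qed

lemma differentiable_transform_on_open:
  assumes "open V" "x \<in> V" "\<And>y. y \<in> V \<Longrightarrow> f y = g y"
  shows "f differentiable (at x) \<longleftrightarrow> g differentiable (at x)"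
  unfolding differentiable_def
  using assms has_derivative_transform_within_open by (metis (no_types, lifting))

lemma cdiff_cong:
  assumes "open V" "\<And>y. y \<in> V \<Longrightarrow> f y = g y"
  shows "cdiff k V f \<longleftrightarrow> cdiff k V g"
  using assms(2)
proof (induction k arbitrary: f g)
  case 0
  then show ?case by (simp cong: continuous_on_cong)
next
  case (Suc k)
  have "cdiff k V (partial i f) \<longleftrightarrow> cdiff k V (partial i g)" for i
    using partial_transform[OF assms(1)] Suc.prems by (intro Suc.IH) blast
  moreover have "f differentiable (at x) \<longleftrightarrow> g differentiable (at x)" if "x \<in> V" for x
    using differentiable_transform_on_open[OF assms(1) that] Suc.prems by blast
  ultimately show ?case by simp
qed

lemma cdiff_subset: "cdiff k V h \<Longrightarrow> W \<subseteq> V \<Longrightarrow> cdiff k W h"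
proof (induction k arbitrary: h)
  case 0
  then show ?case by (simp add: continuous_on_subset)
qed auto

lemma cdiff_continuous_on: "cdiff k V h \<Longrightarrow> continuous_on V h"
  by (cases k) (auto intro!: continuous_at_imp_continuous_on differentiable_imp_continuous_within)

lemma cdiff_SucD: "cdiff (Suc k) V h \<Longrightarrow> cdiff k V h"
proof (induction k arbitrary: h)
  case 0
  then show ?case using cdiff_continuous_on[of "Suc 0"] by simp
qed auto

lemma cdiff_SucI:
  assumes "open V" "\<And>x. x \<in> V \<Longrightarrow> (h has_derivative D x) (at x)"
    "\<And>i. cdiff k V (\<lambda>x. D x (axis i 1))"
  shows "cdiff (Suc k) V h"
proof -
  have "cdiff k V (partial i h)" for i
    using cdiff_cong[OF assms(1), of "partial i h" "\<lambda>x. D x (axis i 1)"] partial_eq assms(2,3)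
    by blast
  then show ?thesis
    using assms(2) by (auto simp: differentiable_def)
qed

lemma cdiff_SucE:
  assumes "cdiff (Suc k) V h"
  shows "x \<in> V \<Longrightarrow> (h has_derivative (\<lambda>v. grad h x \<bullet> v)) (at x)" and "cdiff k V (partial i h)"
  using assms by (auto intro: has_derivative_grad)

lemma grad_axis [simp]: "grad h x \<bullet> axis i 1 = partial i h x"
  by (simp add: grad_def inner_axis)

lemma grad_inner_vec: "grad h x \<bullet> (\<chi> j. c j) = (\<Sum>j\<in>UNIV. partial j h x * c j)"
  by (simp add: grad_def inner_vec_def)

lemma cdiff_const: "open V \<Longrightarrow> cdiff k V (\<lambda>x. c)"
proof (induction k arbitrary: c)
  case (Suc k)
  show ?case
    by (rule cdiff_SucI[where D = "\<lambda>x v. 0"]) (use Suc in auto)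
qed simp

lemma cdiff_linear:
  fixes L :: "real^'i::finite \<Rightarrow> real"
  assumes "open V" "bounded_linear L" shows "cdiff k V L"
proof (cases k)
  case 0
  then show ?thesis using assms by (simp add: linear_continuous_on)
next
  case (Suc k')
  show ?thesis unfolding Suc
    by (rule cdiff_SucI[where D = "\<lambda>x. L"])
      (use assms cdiff_const in \<open>auto intro: bounded_linear_imp_has_derivative\<close>)
qed

lemma cdiff_add:
  assumes "open V" "cdiff k V f" "cdiff k V g" shows "cdiff k V (\<lambda>x. f x + g x)"
  using assms(2,3)
proof (induction k arbitrary: f g)
  case (Suc k)
  note f = cdiff_SucE[OF Suc.prems(1)] and g = cdiff_SucE[OF Suc.prems(2)]
  show ?case
    by (rule cdiff_SucI[OF assms(1) has_derivative_add[OF f(1) g(1)]])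
      (use f g Suc.IH in auto)
qed (auto intro: continuous_intros)

lemma cdiff_mult:
  assumes "open V" "cdiff k V f" "cdiff k V g" shows "cdiff k V (\<lambda>x. f x * g x)"
  using assms(2,3)
proof (induction k arbitrary: f g)
  case (Suc k)
  note f = cdiff_SucE[OF Suc.prems(1)] and g = cdiff_SucE[OF Suc.prems(2)]
  note fg = Suc.prems[THEN cdiff_SucD]
  show ?case
    by (rule cdiff_SucI[OF assms(1) has_derivative_mult[OF f(1) g(1)]])
      (use f g fg Suc.IH in \<open>auto intro!: cdiff_add[OF assms(1)]\<close>)
qed (auto intro: continuous_intros)

lemma cdiff_sum:
  assumes "open V" "\<And>a. a \<in> A \<Longrightarrow> cdiff k V (f a)"
  shows "cdiff k V (\<lambda>x. \<Sum>a\<in>A. f a x)"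
  using assms(2)
  by (induction A rule: infinite_finite_induct) (auto intro: cdiff_const cdiff_add assms(1))

lemma cdiff_prod:
  assumes "open V" "\<And>a. a \<in> A \<Longrightarrow> cdiff k V (f a)"
  shows "cdiff k V (\<lambda>x. \<Prod>a\<in>A. f a x)"
  using assms(2)
  by (induction A rule: infinite_finite_induct) (auto intro: cdiff_const cdiff_mult assms(1))

lemma cdiff_inverse:
  assumes "open V" "cdiff k V f" "\<And>x. x \<in> V \<Longrightarrow> f x \<noteq> 0" shows "cdiff k V (\<lambda>x. inverse (f x))"
  using assms(2)
proof (induction k)
  case 0
  then show ?case using assms(3) by (auto intro!: continuous_intros)
next
  case (Suc k)
  note f = cdiff_SucE[OF Suc.prems]
  have i: "cdiff k V (\<lambda>x. inverse (f x))"
    using Suc.IH Suc.prems cdiff_SucD by blast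
  show ?case
  proof (rule cdiff_SucI[OF assms(1)])
    fix x assume x: "x \<in> V"
    show "((\<lambda>x. inverse (f x)) has_derivative
        (\<lambda>v. - (inverse (f x) * (grad f x \<bullet> v) * inverse (f x)))) (at x)"
      using Deriv.has_derivative_inverse[OF assms(3)[OF x] f(1)[OF x]] by simp
  next
    fix i
    have "cdiff k V (\<lambda>x. (- 1) * (inverse (f x) * partial i f x * inverse (f x)))"
      by (intro cdiff_mult cdiff_const assms(1) i f(2))
    then show "cdiff k V (\<lambda>x. - (inverse (f x) * (grad f x \<bullet> axis i 1) * inverse (f x)))"
      by simp
  qed
qed

lemma vec_has_derivative_grad:
  fixes \<phi> :: "real^'i::finite \<Rightarrow> real^'j::finite"
  assumes "\<And>j. (\<lambda>x. \<phi> x $ j) differentiable (at x)"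
  shows "(\<phi> has_derivative (\<lambda>v. \<chi> j. grad (\<lambda>x. \<phi> x $ j) x \<bullet> v)) (at x)"
proof -
  have "((\<lambda>x. \<phi> x \<bullet> b) has_derivative (\<lambda>v. (\<chi> j. grad (\<lambda>x. \<phi> x $ j) x \<bullet> v) \<bullet> b)) (at x)"
    if b: "b \<in> Basis" for b :: "real^'j"
  proof -
    obtain j where b: "b = axis j 1" using b by (auto simp: Basis_vec_def)
    show ?thesis unfolding b using has_derivative_grad[OF assms[of j]] by (simp add: inner_axis)
  qed
  then show ?thesis
    using has_derivative_componentwise_within[of \<phi> _ x UNIV] by blast
qed

lemma cdiff_compose:
  fixes \<phi> :: "real^'i::finite \<Rightarrow> real^'j::finite"
  assumes "open V" "open W" "\<And>x. x \<in> V \<Longrightarrow> \<phi> x \<in> W"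
    and "cdiff k W h" "\<And>j. cdiff k V (\<lambda>x. \<phi> x $ j)"
  shows "cdiff k V (\<lambda>x. h (\<phi> x))"
  using assms(4,5)
proof (induction k arbitrary: h)
  case 0
  have "continuous_on V \<phi>"
    using 0(2) continuous_on_vec_lambda[of V "\<lambda>j x. \<phi> x $ j"] by simp
  then show ?case
    using 0(1) assms(3) by (auto intro!: continuous_on_compose2[of W h V \<phi>])
next
  case (Suc k)
  note h = cdiff_SucE[OF Suc.prems(1)]
  have d: "(\<phi> has_derivative (\<lambda>v. \<chi> j. grad (\<lambda>x. \<phi> x $ j) x \<bullet> v)) (at x)" if "x \<in> V" for x
    using Suc.prems(2) that by (intro vec_has_derivative_grad) auto
  show ?case
  proof (rule cdiff_SucI[OF assms(1)])
    fix x assume x: "x \<in> V"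
    show "((\<lambda>x. h (\<phi> x)) has_derivative
        (\<lambda>v. grad h (\<phi> x) \<bullet> (\<chi> j. grad (\<lambda>x. \<phi> x $ j) x \<bullet> v))) (at x)"
      by (rule has_derivative_compose[OF d[OF x] h(1)[OF assms(3)[OF x]]])
  next
    fix i
    have "cdiff k V (\<lambda>x. partial j h (\<phi> x))" for j
      by (rule Suc.IH[OF h(2) cdiff_SucD[OF Suc.prems(2)]])
    then have "cdiff k V (\<lambda>x. \<Sum>j\<in>UNIV. partial j h (\<phi> x) * partial i (\<lambda>x. \<phi> x $ j) x)"
      by (intro cdiff_sum cdiff_mult assms(1)) (use cdiff_SucE(2)[OF Suc.prems(2)] in blast)+
    then show "cdiff k V (\<lambda>x. grad h (\<phi> x) \<bullet> (\<chi> j. grad (\<lambda>x. \<phi> x $ j) x \<bullet> axis i 1))"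
      by (simp only: grad_inner_vec grad_axis)
  qed
qed

lemma smoothD: "smooth V h \<Longrightarrow> x \<in> V \<Longrightarrow> (h has_derivative (\<lambda>v. grad h x \<bullet> v)) (at x)"
  by (rule cdiff_SucE(1)[of 0 V h]) (auto simp: smooth_def simp del: cdiff.simps)

lemma smooth_differentiable: "smooth V h \<Longrightarrow> x \<in> V \<Longrightarrow> h differentiable (at x)"
  using smoothD differentiableI by blast

lemma smooth_continuous_on: "smooth V h \<Longrightarrow> continuous_on V h"
  by (auto simp: smooth_def dest: cdiff_continuous_on)

lemma smooth_partial: "smooth V h \<Longrightarrow> smooth V (partial i h)"
  using cdiff_SucE(2) unfolding smooth_def by blast

lemma smooth_subset: "smooth V h \<Longrightarrow> W \<subseteq> V \<Longrightarrow> smooth W h"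
  unfolding smooth_def using cdiff_subset by blast

lemma smooth_cong: "open V \<Longrightarrow> (\<And>y. y \<in> V \<Longrightarrow> f y = g y) \<Longrightarrow> smooth V f \<longleftrightarrow> smooth V g"
  unfolding smooth_def using cdiff_cong by blast

lemma smooth_const: "open V \<Longrightarrow> smooth V (\<lambda>x. c)"
  and smooth_linear: "open V \<Longrightarrow> bounded_linear L \<Longrightarrow> smooth V L"
  and smooth_add: "open V \<Longrightarrow> smooth V f \<Longrightarrow> smooth V g \<Longrightarrow> smooth V (\<lambda>x. f x + g x)"
  and smooth_mult: "open V \<Longrightarrow> smooth V f \<Longrightarrow> smooth V g \<Longrightarrow> smooth V (\<lambda>x. f x * g x)"
  and smooth_sum: "open V \<Longrightarrow> (\<And>a. a \<in> A \<Longrightarrow> smooth V (F a)) \<Longrightarrow> smooth V (\<lambda>x. \<Sum>a\<in>A. F a x)"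
  and smooth_prod: "open V \<Longrightarrow> (\<And>a. a \<in> A \<Longrightarrow> smooth V (F a)) \<Longrightarrow> smooth V (\<lambda>x. \<Prod>a\<in>A. F a x)"
  and smooth_inverse: "open V \<Longrightarrow> smooth V f \<Longrightarrow> (\<And>x. x \<in> V \<Longrightarrow> f x \<noteq> 0) \<Longrightarrow>
    smooth V (\<lambda>x. inverse (f x))"
  unfolding smooth_def
  by (auto intro: cdiff_const cdiff_linear cdiff_add cdiff_mult cdiff_sum cdiff_prod cdiff_inverse)

lemma smooth_diff:
  assumes "open V" "smooth V f" "smooth V g" shows "smooth V (\<lambda>x. f x - g x)"
  using smooth_add[OF assms(1,2) smooth_mult[OF assms(1) smooth_const[OF assms(1), of "-1"] assms(3)]]
  by simp

lemma smooth_compose: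
  fixes \<phi> :: "real^'i::finite \<Rightarrow> real^'j::finite"
  assumes "open V" "open W" "\<And>x. x \<in> V \<Longrightarrow> \<phi> x \<in> W"
    and "smooth W h" "\<And>j. smooth V (\<lambda>x. \<phi> x $ j)"
  shows "smooth V (\<lambda>x. h (\<phi> x))"
  using assms(4,5) cdiff_compose[of V W \<phi>, OF assms(1,2,3)] unfolding smooth_def by blast

lemma smooth_nth: "open V \<Longrightarrow> smooth V (\<lambda>x. x $ i)"
  by (intro smooth_linear bounded_linear_vec_nth)

lemma grad_eqI:
  assumes "(h has_derivative (\<lambda>v. a \<bullet> v)) (at x)" shows "grad h x = a"
  by (simp add: grad_def vec_eq_iff partial_eq[OF assms] inner_axis)

lemma smooth_det:
  fixes M :: "real^'i::finite \<Rightarrow> real^'k::finite^'k"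
  assumes "open V" "\<And>i j. smooth V (\<lambda>x. M x $ i $ j)"
  shows "smooth V (\<lambda>x. det (M x))"
  unfolding det_def
  by (intro smooth_sum smooth_mult smooth_const smooth_prod assms)

section \<open>Null sets\<close>

text \<open>A locally closed set is a countable union of compact sets, and continuous images preserve this.
The critical values below are such an image, which is what makes Fubini's theorem applicable to
them.\<close>

lemma image_locally_closed_borel:
  fixes F :: "'c::euclidean_space \<Rightarrow> 'd::euclidean_space" and \<psi> :: "'c \<Rightarrow> real"
  assumes "open W" "continuous_on W \<psi>" "continuous_on W F"
  shows "F ` {z \<in> W. \<psi> z = 0} \<in> sets borel"
proof -
  obtain C :: "nat \<Rightarrow> 'c set" where C: "\<And>n. compact (C n)" "\<And>n. C n \<subseteq> W" "\<Union> (range C) = W"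
    by (rule open_Union_compact_subsets[OF assms(1)]) auto
  have "compact (F ` {z \<in> C n. \<psi> z = 0})" for n
  proof -
    have "closedin (top_of_set (C n)) {z \<in> C n. \<psi> z = 0}"
      by (rule continuous_closedin_preimage_constant[OF continuous_on_subset[OF assms(2) C(2)]])
    then have "compact {z \<in> C n. \<psi> z = 0}"
      by (rule closedin_compact[OF C(1)])
    moreover have "continuous_on {z \<in> C n. \<psi> z = 0} F"
      by (rule continuous_on_subset[OF assms(3)]) (use C(2) in blast)
    ultimately show ?thesis by (rule compact_continuous_image[rotated])
  qed
  then have "(\<Union>n. F ` {z \<in> C n. \<psi> z = 0}) \<in> sets borel"
    by (intro sets.countable_UN) (auto intro: borel_compact)
  moreover have "(\<Union>n. F ` {z \<in> C n. \<psi> z = 0}) = F ` {z \<in> W. \<psi> z = 0}"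
    using C(3) by blast
  ultimately show ?thesis by simp
qed

lemma nn_integral_lborel_translate:
  fixes f :: "'b::euclidean_space \<Rightarrow> ennreal"
  assumes [measurable]: "f \<in> borel_measurable borel"
  shows "(\<integral>\<^sup>+u. f (u + a) \<partial>lborel) = (\<integral>\<^sup>+u. f u \<partial>lborel)"
proof -
  have "(\<integral>\<^sup>+u. f u \<partial>lborel) = (\<integral>\<^sup>+u. f u \<partial>distr lborel borel (\<lambda>u. a + u))"
    by (simp add: lborel_distr_plus)
  also have "\<dots> = (\<integral>\<^sup>+u. f (a + u) \<partial>lborel)"
    by (subst nn_integral_distr) auto
  finally show ?thesis by (simp add: add.commute)
qed

text \<open>Integrating the measure of the translates \<open>A - t b\<close> over all \<open>t\<close> gives \<open>\<infinity>\<close> times the measure of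
\<open>A\<close>, by translation invariance. This form of Fubini's theorem avoids any splitting of the space
into a product.\<close>

lemma null_if_null_on_lines:
  fixes A :: "'b::euclidean_space set"
  assumes [measurable]: "A \<in> sets borel"
    and 0: "(\<integral>\<^sup>+u. (\<integral>\<^sup>+t. indicator A (u + t *\<^sub>R b) \<partial>lborel) \<partial>lborel) = 0"
  shows "A \<in> null_sets lborel"
proof -
  have "(\<integral>\<^sup>+u. (\<integral>\<^sup>+t. indicator A (u + t *\<^sub>R b) \<partial>lborel) \<partial>lborel)
      = (\<integral>\<^sup>+t. (\<integral>\<^sup>+u. indicator A (u + t *\<^sub>R b) \<partial>lborel) \<partial>lborel)"
    by (rule lborel_pair.Fubini'[symmetric]) measurable
  also have "\<dots> = (\<integral>\<^sup>+(t::real). emeasure lborel A \<partial>lborel)"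
    by (subst nn_integral_lborel_translate) auto
  also have "\<dots> = \<infinity> * emeasure lborel A"
    by (simp add: mult.commute)
  finally have "emeasure lborel A = 0" using 0 by simp
  then show ?thesis by auto
qed

lemma borel_null_iff_negligible:
  fixes A :: "'b::euclidean_space set"
  assumes "A \<in> sets borel"
  shows "negligible A \<longleftrightarrow> emeasure lborel A = 0"
  using assms by (simp add: negligible_iff_null_sets null_sets_def)

text \<open>Sliding \<open>u\<close> along \<open>b\<close> to the hyperplane \<open>u \<bullet> b = t\<close> turns the slices of \<open>A\<close> into cylinders
of the full space, so that slices and \<open>A\<close> are measured by the same measure.\<close>

lemma negligible_if_negligible_slices:
  fixes A :: "'b::euclidean_space set"
  assumes A[measurable]: "A \<in> sets borel"
    and sl: "\<And>t. negligible {u. u + (t - u \<bullet> b) *\<^sub>R b \<in> A}"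
  shows "negligible A"
proof -
  have 1: "(\<integral>\<^sup>+u. indicator A (u + (t - u \<bullet> b) *\<^sub>R b) \<partial>lborel) = 0" for t
  proof -
    have m: "{u. u + (t - u \<bullet> b) *\<^sub>R b \<in> A} \<in> sets borel"
      by measurable
    have "(\<integral>\<^sup>+u. indicator A (u + (t - u \<bullet> b) *\<^sub>R b) \<partial>lborel)
        = (\<integral>\<^sup>+u. indicator {u. u + (t - u \<bullet> b) *\<^sub>R b \<in> A} u \<partial>lborel)"
      by (intro nn_integral_cong) (auto simp: indicator_def)
    also have "\<dots> = 0"
      using sl[of t] m by (simp add: borel_null_iff_negligible)
    finally show ?thesis .
  qed
  have "(\<integral>\<^sup>+u. (\<integral>\<^sup>+t. indicator A (u + t *\<^sub>R b) \<partial>lborel) \<partial>lborel)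
      = (\<integral>\<^sup>+u. (\<integral>\<^sup>+t. indicator A (u + (t - u \<bullet> b) *\<^sub>R b) \<partial>lborel) \<partial>lborel)"
  proof (rule nn_integral_cong)
    fix u :: 'b
    have "(\<integral>\<^sup>+t. indicator A (u + (t + - (u \<bullet> b)) *\<^sub>R b) \<partial>lborel)
        = (\<integral>\<^sup>+t. (indicator A (u + t *\<^sub>R b) :: ennreal) \<partial>lborel)"
      by (rule nn_integral_lborel_translate[where f = "\<lambda>t. indicator A (u + t *\<^sub>R b)"]) measurable
    then show "(\<integral>\<^sup>+t. indicator A (u + t *\<^sub>R b) \<partial>lborel)
        = (\<integral>\<^sup>+t. (indicator A (u + (t - u \<bullet> b) *\<^sub>R b) :: ennreal) \<partial>lborel)"
      by simp
  qed
  also have "\<dots> = (\<integral>\<^sup>+t. (\<integral>\<^sup>+u. indicator A (u + (t - u \<bullet> b) *\<^sub>R b) \<partial>lborel) \<partial>lborel)"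
    by (rule lborel_pair.Fubini'[symmetric]) measurable
  also have "\<dots> = 0" by (simp add: 1)
  finally show ?thesis
    using null_if_null_on_lines[OF A] A by (auto simp: borel_null_iff_negligible)
qed

lemma negligible_coordinate_preimage:
  fixes b :: "'b::euclidean_space"
  assumes "negligible T" "b \<in> Basis"
  shows "negligible {u. u \<bullet> b \<in> T}"
proof -
  have "T \<in> null_sets (completion lborel)"
    using assms(1) by (simp add: negligible_iff_null_sets)
  then obtain N where N: "N \<in> null_sets lborel" "T \<subseteq> N"
    unfolding null_sets_completion_iff2 by blast
  have [measurable]: "N \<in> sets borel" using N(1) by auto
  have A: "{u :: 'b. u \<bullet> b \<in> N} \<in> sets borel" by measurable
  have "(\<integral>\<^sup>+t. indicator {u. u \<bullet> b \<in> N} (u + t *\<^sub>R b) \<partial>lborel) = 0" for u :: 'b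
  proof -
    have "(\<integral>\<^sup>+t. indicator {u. u \<bullet> b \<in> N} (u + t *\<^sub>R b) \<partial>lborel)
        = (\<integral>\<^sup>+t. indicator N (t + u \<bullet> b) \<partial>lborel)"
      using assms(2)
      by (intro nn_integral_cong) (auto simp: indicator_def algebra_simps inner_Basis)
    also have "\<dots> = (\<integral>\<^sup>+t. indicator N t \<partial>lborel)"
      by (rule nn_integral_lborel_translate) measurable
    also have "\<dots> = 0" using N(1) by auto
    finally show ?thesis .
  qed
  then have "{u. u \<bullet> b \<in> N} \<in> null_sets lborel"
    by (intro null_if_null_on_lines[OF A, of b]) simp
  then have "negligible {u. u \<bullet> b \<in> N}"
    using A by (auto simp: borel_null_iff_negligible)
  then show ?thesis
    by (rule negligible_subset) (use N(2) in auto)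
qed

text \<open>A grid of mesh \<open>1/n\<close> meets \<open>T\<close> in \<open>O(n\<^sup>a)\<close> cells, where \<open>a\<close> is the dimension, and the image of each
cell lies in an interval of length \<open>O(n\<^sup>-\<^sup>a\<^sup>-\<^sup>1)\<close>.\<close>

lemma negligible_image_of_steep_Holder:
  fixes T :: "(real^'i::finite) set" and G :: "real^'i \<Rightarrow> real"
  assumes "bounded T" "M \<ge> 0"
    and G: "\<And>y z. y \<in> T \<Longrightarrow> z \<in> T \<Longrightarrow> \<bar>G y - G z\<bar> \<le> M * norm (y - z) ^ Suc CARD('i)"
  shows "negligible (G ` T)"
proof (subst negligible_outer, intro allI impI)
  fix e :: real assume e: "e > 0"
  let ?a = "CARD('i)"
  obtain r where r: "\<And>z. z \<in> T \<Longrightarrow> norm z \<le> r"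
    using assms(1) by (auto simp: bounded_iff)
  obtain R :: nat where R: "r \<le> real R" "R \<ge> 1"
    by (metis linear order_trans real_arch_simple real_of_nat_ge_one_iff nat_le_linear)
  \<comment> \<open>The total length of the covering intervals comes out as \<open>C / n\<close>.\<close>
  define C where "C = (3 * real R) ^ ?a * (2 * M * real ?a ^ Suc ?a)"
  obtain n :: nat where n: "n \<ge> 1" "C / real n < e"
  proof -
    obtain n :: nat where "C / e < real n" using reals_Archimedean2 by blast
    then have "C / e < real (Suc n)" by simp
    then show ?thesis using e that[of "Suc n"] by (simp add: field_simps)
  qed
  define cell where "cell z = (\<lambda>i. \<lfloor>real n * z $ i\<rfloor>)" for z :: "real^'i"
  define cells where "cells = cell ` T"
  let ?box = "PiE (UNIV::'i set) (\<lambda>_. {- int (n * R)..int (n * R)})"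
  have zR: "\<bar>z $ i\<bar> \<le> real R" if "z \<in> T" for z i
    using component_le_norm_cart[of z i] r[OF that] R(1) by linarith
  have sub: "cells \<subseteq> ?box"
  proof -
    have "cell z i \<in> {- int (n * R)..int (n * R)}" if "z \<in> T" for z i
    proof -
      have "\<bar>real n * z $ i\<bar> \<le> real (n * R)"
        using zR[OF that, of i] by (simp add: abs_mult mult_left_mono)
      then show ?thesis unfolding cell_def by (simp add: le_floor_iff floor_le_iff abs_le_iff)
    qed
    then show ?thesis by (auto simp: cells_def)
  qed
  have fin: "finite cells"
    by (rule finite_subset[OF sub]) (intro finite_PiE; simp)
  have card: "real (card cells) \<le> (3 * real n * real R) ^ ?a"
  proof -
    have "card cells \<le> card ?box"
      by (rule card_mono[OF _ sub]) (intro finite_PiE; simp)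
    also have "\<dots> = (2 * n * R + 1) ^ ?a"
      by (simp add: card_PiE nat_add_distrib nat_mult_distrib mult_ac)
    finally have "real (card cells) \<le> real ((2 * n * R + 1) ^ ?a)"
      using of_nat_le_iff by blast
    also have "\<dots> \<le> (3 * real n * real R) ^ ?a"
    proof -
      have "1 \<le> real n * real R"
        using n(1) R(2) mult_mono[of 1 "real n" 1 "real R"] by simp
      then have "real (2 * n * R + 1) \<le> 3 * real n * real R" by (simp add: mult_ac)
      then show ?thesis unfolding of_nat_power by (intro power_mono) auto
    qed
    finally show ?thesis .
  qed
  define rep where "rep c = (SOME z. z \<in> T \<and> cell z = c)" for c
  have rep: "rep c \<in> T \<and> cell (rep c) = c" if "c \<in> cells" for c
  proof -
    have "\<exists>z. z \<in> T \<and> cell z = c" using that by (auto simp: cells_def)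
    then show ?thesis unfolding rep_def by (rule someI_ex)
  qed
  define \<delta> where "\<delta> = M * (real ?a / real n) ^ Suc ?a"
  have \<delta>0: "\<delta> \<ge> 0" using assms(2) by (simp add: \<delta>_def)
  have close: "\<bar>G z - G (rep (cell z))\<bar> \<le> \<delta>" if z: "z \<in> T" for z
  proof -
    let ?y = "rep (cell z)"
    have y: "?y \<in> T" "cell ?y = cell z" using rep z by (auto simp: cells_def)
    have "\<bar>(z - ?y) $ i\<bar> \<le> 1 / real n" for i
    proof -
      have "\<lfloor>real n * z $ i\<rfloor> = \<lfloor>real n * ?y $ i\<rfloor>"
        using fun_cong[OF y(2), of i] by (simp add: cell_def)
      then have "\<bar>real n * z $ i - real n * ?y $ i\<bar> \<le> 1"
        by linarith
      then have "real n * \<bar>z $ i - ?y $ i\<bar> \<le> 1"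
        by (metis abs_mult abs_of_nat right_diff_distrib')
      then show ?thesis using n(1) by (simp add: field_simps)
    qed
    then have "(\<Sum>i\<in>UNIV. \<bar>(z - ?y) $ i\<bar>) \<le> (\<Sum>i\<in>(UNIV::'i set). 1 / real n)"
      by (intro sum_mono) simp
    then have "norm (z - ?y) \<le> real ?a / real n"
      using norm_le_l1_cart[of "z - ?y"] by simp
    then have "M * norm (z - ?y) ^ Suc ?a \<le> \<delta>"
      unfolding \<delta>_def by (intro mult_left_mono power_mono assms(2)) auto
    then show ?thesis using G[OF z y(1)] by linarith
  qed
  show "\<exists>S. G ` T \<subseteq> S \<and> S \<in> lmeasurable \<and> measure lebesgue S < e"
  proof (intro exI conjI)
    let ?S = "\<Union>c\<in>cells. {G (rep c) - \<delta>..G (rep c) + \<delta>}"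
    show "G ` T \<subseteq> ?S"
    proof
      fix v assume "v \<in> G ` T"
      then obtain z where "z \<in> T" "v = G z" by blast
      then show "v \<in> ?S"
        using close[of z] by (auto simp: cells_def abs_le_iff intro!: bexI[of _ z])
    qed
    show "?S \<in> lmeasurable"
      by (intro fmeasurable.finite_UN fin) auto
    have "measure lebesgue ?S \<le> (\<Sum>c\<in>cells. measure lebesgue {G (rep c) - \<delta>..G (rep c) + \<delta>})"
      by (intro measure_UNION_le fin) auto
    also have "\<dots> = real (card cells) * (2 * \<delta>)"
      using \<delta>0 by simp
    also have "\<dots> \<le> (3 * real n * real R) ^ ?a * (2 * \<delta>)"
      using card \<delta>0 by (intro mult_right_mono) auto
    also have "\<dots> = C / real n"
      using n(1) by (simp add: C_def \<delta>_def power_mult_distrib power_divide field_simps)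
    finally show "measure lebesgue ?S < e" using n(2) by linarith
  qed
qed

section \<open>Frames of gradients\<close>

definition frame :: "('i \<Rightarrow> real^'i::finite \<Rightarrow> real) \<Rightarrow> real^'i \<Rightarrow> real^'i^'i"
  where "frame \<Phi> x = (\<chi> i j. partial i (\<Phi> j) x)"

text \<open>The coordinates of \<open>v\<close> in the basis of the gradients of \<open>\<Phi>\<close>, wherever these form a basis.\<close>

definition coef :: "('i \<Rightarrow> real^'i::finite \<Rightarrow> real) \<Rightarrow> real^'i \<Rightarrow> real^'i \<Rightarrow> real^'i"
  where "coef \<Phi> x v = matrix_inv (frame \<Phi> x) *v v"

text \<open>The partial derivative of \<open>h\<close> with respect to \<open>\<Phi> c\<close> in the local coordinate system \<open>\<Phi>\<close>: the gradient
of \<open>h\<close> is the combination of the gradients of \<open>\<Phi>\<close> with these coefficients. It is defined without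
inverting \<open>\<Phi>\<close>.\<close>

definition along :: "('i \<Rightarrow> real^'i::finite \<Rightarrow> real) \<Rightarrow> 'i \<Rightarrow> (real^'i \<Rightarrow> real) \<Rightarrow> real^'i \<Rightarrow> real"
  where "along \<Phi> c h x = coef \<Phi> x (grad h x) $ c"

lemma frame_mult_vec: "frame \<Phi> x *v e = (\<Sum>j\<in>UNIV. e $ j *\<^sub>R grad (\<Phi> j) x)"
  by (simp add: frame_def grad_def matrix_vector_mult_def vec_eq_iff mult.commute)

lemma coef_unique:
  assumes "det (frame \<Phi> x) \<noteq> 0"
  shows "frame \<Phi> x *v e = v \<longleftrightarrow> e = coef \<Phi> x v"
proof -
  have "invertible (frame \<Phi> x)" using assms by (simp add: invertible_det_nz)
  then have "frame \<Phi> x ** matrix_inv (frame \<Phi> x) = mat 1" "matrix_inv (frame \<Phi> x) ** frame \<Phi> x = mat 1"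
    unfolding invertible_def matrix_inv_def by (metis (mono_tags, lifting) someI_ex)+
  then show ?thesis
    by (auto simp: coef_def matrix_vector_mul_assoc)
qed

lemma coef_expansion:
  assumes "det (frame \<Phi> x) \<noteq> 0"
  shows "(\<Sum>c\<in>UNIV. coef \<Phi> x v $ c *\<^sub>R grad (\<Phi> c) x) = v"
  using coef_unique[OF assms, of "coef \<Phi> x v" v] by (simp add: frame_mult_vec)

lemma linear_coef: "linear (coef \<Phi> x)"
  unfolding coef_def by (rule matrix_vector_mul_linear)

lemma coef_grad:
  assumes "det (frame \<Phi> x) \<noteq> 0"
  shows "coef \<Phi> x (grad (\<Phi> k) x) = axis k 1"
proof -
  have "frame \<Phi> x *v axis k 1 = (\<Sum>j\<in>UNIV. if j = k then grad (\<Phi> j) x else 0)"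
    unfolding frame_mult_vec by (intro sum.cong) (auto simp: axis_def)
  then show ?thesis using coef_unique[OF assms, of "axis k 1"] by simp
qed

lemma in_span_frame_iff:
  assumes "det (frame \<Phi> x) \<noteq> 0"
  shows "v \<in> span ((\<lambda>k. grad (\<Phi> k) x) ` K) \<longleftrightarrow> (\<forall>c. c \<notin> K \<longrightarrow> coef \<Phi> x v $ c = 0)"
proof
  have sub: "subspace {v. \<forall>c. c \<notin> K \<longrightarrow> coef \<Phi> x v $ c = 0}"
    by (auto simp: subspace_def linear_0[OF linear_coef] linear_add[OF linear_coef]
        linear_scale[OF linear_coef])
  assume "v \<in> span ((\<lambda>k. grad (\<Phi> k) x) ` K)"
  moreover have "span ((\<lambda>k. grad (\<Phi> k) x) ` K) \<subseteq> {v. \<forall>c. c \<notin> K \<longrightarrow> coef \<Phi> x v $ c = 0}"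
    by (rule span_minimal[OF _ sub]) (auto simp: coef_grad[OF assms] axis_def)
  ultimately show "\<forall>c. c \<notin> K \<longrightarrow> coef \<Phi> x v $ c = 0" by blast
next
  assume 0: "\<forall>c. c \<notin> K \<longrightarrow> coef \<Phi> x v $ c = 0"
  have "coef \<Phi> x v $ c *\<^sub>R grad (\<Phi> c) x \<in> span ((\<lambda>k. grad (\<Phi> k) x) ` K)" for c
    using 0 by (cases "c \<in> K") (auto intro: span_scale span_base simp: span_zero)
  then have "(\<Sum>c\<in>UNIV. coef \<Phi> x v $ c *\<^sub>R grad (\<Phi> c) x) \<in> span ((\<lambda>k. grad (\<Phi> k) x) ` K)"
    by (intro span_sum)
  then show "v \<in> span ((\<lambda>k. grad (\<Phi> k) x) ` K)"
    by (simp add: coef_expansion[OF assms])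
qed

text \<open>Cramer's rule is what shows that \<open>along \<Phi> c h\<close> is smooth and when \<open>h\<close> may replace \<open>\<Phi> c\<close> in a frame.\<close>

lemma coef_cramer:
  assumes "det (frame \<Phi> x) \<noteq> 0"
  shows "coef \<Phi> x v $ c =
    det (\<chi> i j. if j = c then v $ i else frame \<Phi> x $ i $ j) * inverse (det (frame \<Phi> x))"
  using cramer[OF assms, of "coef \<Phi> x v" v] coef_unique[OF assms, of "coef \<Phi> x v" v]
  by (simp add: vec_eq_iff divide_inverse)

lemma frame_update:
  "frame (\<Phi>(c := h)) x = (\<chi> i j. if j = c then grad h x $ i else frame \<Phi> x $ i $ j)"
  by (simp add: frame_def grad_def vec_eq_iff)

lemma det_frame_update:
  assumes "det (frame \<Phi> x) \<noteq> 0"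
  shows "det (frame (\<Phi>(c := h)) x) = along \<Phi> c h x * det (frame \<Phi> x)"
  using coef_cramer[OF assms, of "grad h x" c] assms by (simp add: along_def frame_update)

lemma smooth_frame:
  assumes "\<And>i. smooth V (\<Phi> i)" shows "smooth V (\<lambda>x. frame \<Phi> x $ i $ j)"
  using assms by (simp add: frame_def smooth_partial)

lemma smooth_along:
  assumes V: "open V" and \<Phi>: "\<And>i. smooth V (\<Phi> i)" and nz: "\<And>x. x \<in> V \<Longrightarrow> det (frame \<Phi> x) \<noteq> 0"
    and h: "smooth V h"
  shows "smooth V (along \<Phi> c h)"
proof -
  let ?f = "\<lambda>x. det (\<chi> i j. if j = c then grad h x $ i else frame \<Phi> x $ i $ j) * inverse (det (frame \<Phi> x))"
  have "smooth V (\<lambda>x. (\<chi> i j. if j = c then grad h x $ i else frame \<Phi> x $ i $ j) $ i $ j)" for i j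
    using smooth_partial[OF h] smooth_frame[OF \<Phi>]
    by (cases "j = c") (auto simp: grad_def)
  then have "smooth V ?f"
    by (intro smooth_mult smooth_inverse smooth_det V nz smooth_frame \<Phi>) auto
  then show ?thesis
    by (subst smooth_cong[OF V, of _ ?f]) (auto simp: along_def coef_cramer[OF nz])
qed

lemma continuous_on_grad: "smooth V h \<Longrightarrow> continuous_on V (grad h)"
  unfolding grad_def
  by (intro continuous_on_vec_lambda smooth_continuous_on smooth_partial)

section \<open>Points where a function is flat along the constraints\<close>

primrec word_deriv :: "('i \<Rightarrow> real^'i::finite \<Rightarrow> real) \<Rightarrow> (real^'i \<Rightarrow> real) \<Rightarrow> 'i list \<Rightarrow> real^'i \<Rightarrow> real"
  where
    "word_deriv \<Phi> g [] = g"
  | "word_deriv \<Phi> g (c # w) = along \<Phi> c (word_deriv \<Phi> g w)"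

lemma smooth_word_deriv:
  assumes "open V" "\<And>i. smooth V (\<Phi> i)" "\<And>x. x \<in> V \<Longrightarrow> det (frame \<Phi> x) \<noteq> 0" "smooth V g"
  shows "smooth V (word_deriv \<Phi> g w)"
  by (induction w) (use assms smooth_along[OF assms(1-3)] in auto)

text \<open>In the local coordinates given by the inverse function theorem, differentiation is given by the
operators \<open>along \<Phi> c\<close>.\<close>

lemma local_inverse:
  fixes \<Phi> :: "'i::finite \<Rightarrow> real^'i \<Rightarrow> real"
  assumes V: "open V" and \<Phi>: "\<And>i. smooth V (\<Phi> i)" and nz: "\<And>x. x \<in> V \<Longrightarrow> det (frame \<Phi> x) \<noteq> 0"
    and x0: "x0 \<in> V"
  shows "\<exists>U W \<Psi>. open U \<and> U \<subseteq> V \<and> x0 \<in> U \<and> open W \<and>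
    homeomorphism U W (\<lambda>x. \<chi> i. \<Phi> i x) \<Psi> \<and>
    (\<forall>z\<in>W. \<forall>h. smooth V h \<longrightarrow>
      ((\<lambda>z. h (\<Psi> z)) has_derivative (\<lambda>v. \<Sum>c\<in>UNIV. along \<Phi> c h (\<Psi> z) * v $ c)) (at z))"
proof -
  let ?P = "\<lambda>x. \<chi> i. \<Phi> i x"
  define P' where "P' x = Blinfun (\<lambda>v. transpose (frame \<Phi> x) *v v)" for x
  have P': "blinfun_apply (P' x) = (\<lambda>v. transpose (frame \<Phi> x) *v v)" for x
    unfolding P'_def by (rule bounded_linear_Blinfun_apply) (rule matrix_vector_mul_bounded_linear)
  have fr: "transpose (frame \<Phi> x) *v v = (\<chi> i. grad (\<Phi> i) x \<bullet> v)" for x v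
    by (simp add: vec_eq_iff matrix_vector_mult_def transpose_def frame_def grad_def inner_vec_def)
  have d: "(?P has_derivative blinfun_apply (P' x)) (at x)" if "x \<in> V" for x
    using vec_has_derivative_grad[of ?P x] smooth_differentiable[OF \<Phi> that] unfolding P' fr by simp
  have c: "continuous_on V P'"
  proof (rule continuous_on_blinfun_componentwise)
    fix b :: "real^'i" assume "b \<in> Basis"
    show "continuous_on V (\<lambda>x. blinfun_apply (P' x) b)"
      unfolding P' fr by (intro continuous_on_vec_lambda continuous_on_inner continuous_on_grad \<Phi>
          continuous_on_const)
  qed
  obtain B where B: "B ** transpose (frame \<Phi> x0) = mat 1"
    using nz[OF x0] by (metis invertible_def invertible_det_nz det_transpose)
  define Q where "Q = Blinfun (\<lambda>v. B *v v)"
  have Q: "blinfun_apply Q = (\<lambda>v. B *v v)"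
    unfolding Q_def by (rule bounded_linear_Blinfun_apply) (rule matrix_vector_mul_bounded_linear)
  have inv: "Q o\<^sub>L P' x0 = id_blinfun"
    by (rule blinfun_eqI) (simp add: Q P' matrix_vector_mul_assoc B del: transpose_matrix_vector)
  have "\<exists>U W \<Psi>. homeomorphism U W ?P \<Psi> \<and> open U \<and> U \<subseteq> V \<and> x0 \<in> U \<and> open W \<and>
      (\<forall>y\<in>W. \<exists>D. (\<Psi> has_derivative D) (at y))"
  proof (rule inverse_function_theorem[OF V d c x0 inv])
    fix U W \<Psi> g'
    assume *: "open U" "U \<subseteq> V" "x0 \<in> U" "open W" "homeomorphism U W ?P \<Psi>"
      and **: "\<And>y. y \<in> W \<Longrightarrow> (\<Psi> has_derivative g' y) (at y)"
    show ?thesis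
      by (intro exI[of _ U] exI[of _ W] exI[of _ \<Psi>] conjI ballI exI) (rule * **; assumption?)+
  qed
  then obtain U W \<Psi> g' where U: "open U" "U \<subseteq> V" "x0 \<in> U" "open W"
    and hom: "homeomorphism U W ?P \<Psi>"
    and der: "\<And>y. y \<in> W \<Longrightarrow> (\<Psi> has_derivative g' y) (at y)"
    by metis
  have "((\<lambda>z. h (\<Psi> z)) has_derivative (\<lambda>v. \<Sum>c\<in>UNIV. along \<Phi> c h (\<Psi> z) * v $ c)) (at z)"
    if z: "z \<in> W" and h: "smooth V h" for z h
  proof -
    have \<Psi>z: "\<Psi> z \<in> V" using hom z U(2) by (auto simp: homeomorphism_def)
    have 1: "((\<lambda>z. k (\<Psi> z)) has_derivative (\<lambda>v. grad k (\<Psi> z) \<bullet> g' z v)) (at z)" if "smooth V k" for k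
      by (rule has_derivative_compose[OF der[OF z] smoothD[OF that \<Psi>z]])
    have 2: "grad (\<Phi> c) (\<Psi> z) \<bullet> g' z v = v $ c" for c v
    proof -
      have "((\<lambda>z. z $ c) has_derivative (\<lambda>v. grad (\<Phi> c) (\<Psi> z) \<bullet> g' z v)) (at z)"
      proof (rule has_derivative_transform_within_open[OF 1[OF \<Phi>] U(4) z])
        fix y assume "y \<in> W"
        then have "?P (\<Psi> y) = y" using hom by (simp add: homeomorphism_def)
        then show "\<Phi> c (\<Psi> y) = y $ c" by (metis vec_lambda_beta)
      qed
      moreover have "((\<lambda>z. z $ c) has_derivative (\<lambda>v. v $ c)) (at z)"
        by (rule bounded_linear_imp_has_derivative[OF bounded_linear_vec_nth])
      ultimately have "(\<lambda>v. grad (\<Phi> c) (\<Psi> z) \<bullet> g' z v) = (\<lambda>v. v $ c)"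
        by (rule has_derivative_unique)
      then show ?thesis by metis
    qed
    have "grad h (\<Psi> z) \<bullet> g' z v = (\<Sum>c\<in>UNIV. along \<Phi> c h (\<Psi> z) * v $ c)" for v
    proof -
      have "grad h (\<Psi> z) \<bullet> g' z v
          = (\<Sum>c\<in>UNIV. coef \<Phi> (\<Psi> z) (grad h (\<Psi> z)) $ c *\<^sub>R grad (\<Phi> c) (\<Psi> z)) \<bullet> g' z v"
        by (simp only: coef_expansion[OF nz[OF \<Psi>z]])
      also have "\<dots> = (\<Sum>c\<in>UNIV. along \<Phi> c h (\<Psi> z) * v $ c)"
        by (simp add: inner_sum_left along_def 2)
      finally show ?thesis .
    qed
    with 1[OF h] show ?thesis by simp
  qed
  with U hom show ?thesis
    by (intro exI[of _ U] exI[of _ W] exI[of _ \<Psi>]) simp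
qed

text \<open>Here \<open>\<Psi>\<close> is a local inverse of the coordinate system \<open>\<Phi>\<close> and \<open>B\<close> a compact convex region of coordinate space. On the
segment from a flat point \<open>z0\<close> to \<open>z\<close> only coordinates outside \<open>K\<close> move, so a derivative of order
\<open>p + 1\<close> that is merely bounded is integrated \<open>p + 1\<close> times, each integration gaining one power of
the distance since the lower derivatives vanish at \<open>z0\<close>.\<close>

lemma flat_points_Holder:
  fixes \<Phi> :: "'i::finite \<Rightarrow> real^'i \<Rightarrow> real" and B :: "(real^'i) set"
  assumes V: "open V" and \<Phi>: "\<And>i. smooth V (\<Phi> i)" and nz: "\<And>x. x \<in> V \<Longrightarrow> det (frame \<Phi> x) \<noteq> 0"
    and g: "smooth V g"
    and B: "compact B" "convex B"
    and \<Psi>: "continuous_on B \<Psi>" "\<Psi> ` B \<subseteq> V"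
    and der: "\<And>z h. z \<in> B \<Longrightarrow> smooth V h \<Longrightarrow>
      ((\<lambda>z. h (\<Psi> z)) has_derivative (\<lambda>v. \<Sum>c\<in>UNIV. along \<Phi> c h (\<Psi> z) * v $ c)) (at z)"
    and E: "\<And>z0 w. z0 \<in> E \<Longrightarrow> set w \<subseteq> - K \<Longrightarrow> 1 \<le> length w \<Longrightarrow> length w \<le> p \<Longrightarrow>
      word_deriv \<Phi> g w (\<Psi> z0) = 0"
    and EB: "E \<subseteq> B" "\<And>z0 k. z0 \<in> E \<Longrightarrow> k \<in> K \<Longrightarrow> z0 $ k = 0"
  obtains M where "M \<ge> 0" "\<And>z0 z. z0 \<in> E \<Longrightarrow> z \<in> B \<Longrightarrow> (\<And>k. k \<in> K \<Longrightarrow> z $ k = 0) \<Longrightarrow>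
      \<bar>g (\<Psi> z) - g (\<Psi> z0)\<bar> \<le> M * norm (z - z0) ^ Suc p"
proof -
  define Z where "Z = {z \<in> B. \<forall>k\<in>K. z $ k = 0}"
  have sm: "smooth V (word_deriv \<Phi> g w)" for w
    by (rule smooth_word_deriv[OF V \<Phi> nz g])
  have integrate: "\<exists>M\<ge>0. \<forall>z0\<in>E. \<forall>z\<in>Z.
      \<bar>word_deriv \<Phi> g w (\<Psi> z) - word_deriv \<Phi> g w (\<Psi> z0)\<bar> \<le> M * norm (z - z0) ^ Suc n"
    if M: "\<And>c. c \<notin> K \<Longrightarrow> \<exists>M\<ge>0. \<forall>z0\<in>E. \<forall>z\<in>Z. \<bar>word_deriv \<Phi> g (c # w) (\<Psi> z)\<bar> \<le> M * norm (z - z0) ^ n"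
    for w n
  proof -
    obtain M where M0: "\<And>c. c \<notin> K \<Longrightarrow> M c \<ge> 0" and M1: "\<And>c z0 z. c \<notin> K \<Longrightarrow> z0 \<in> E \<Longrightarrow> z \<in> Z \<Longrightarrow>
        \<bar>word_deriv \<Phi> g (c # w) (\<Psi> z)\<bar> \<le> M c * norm (z - z0) ^ n"
      using M by metis
    have "\<bar>word_deriv \<Phi> g w (\<Psi> z) - word_deriv \<Phi> g w (\<Psi> z0)\<bar> \<le> sum M (- K) * norm (z - z0) ^ Suc n"
      if z0: "z0 \<in> E" and z: "z \<in> Z" for z0 z
    proof -
      let ?s = "\<lambda>t. z0 + t *\<^sub>R (z - z0)" and ?h = "word_deriv \<Phi> g w"
      have sZ: "?s t \<in> Z" if "0 \<le> t" "t \<le> 1" for t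
      proof -
        have "?s t = (1 - t) *\<^sub>R z0 + t *\<^sub>R z" by (simp add: algebra_simps)
        moreover have "(1 - t) *\<^sub>R z0 + t *\<^sub>R z \<in> B"
          using B(2) z0 z that EB(1) by (intro convexD) (auto simp: Z_def)
        ultimately show ?thesis using z0 z EB(2) by (auto simp: Z_def)
      qed
      have d: "((\<lambda>t. ?h (\<Psi> (?s t))) has_derivative
          (\<lambda>r. \<Sum>c\<in>UNIV. along \<Phi> c ?h (\<Psi> (?s t)) * (r *\<^sub>R (z - z0)) $ c)) (at t)"
        if "0 \<le> t" "t \<le> 1" for t
      proof (rule has_derivative_compose[where f = ?s and g = "\<lambda>z. ?h (\<Psi> z)"])
        show "(?s has_derivative (\<lambda>r. r *\<^sub>R (z - z0))) (at t)"
          by (auto intro!: derivative_eq_intros)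
        show "((\<lambda>z. ?h (\<Psi> z)) has_derivative
            (\<lambda>v. \<Sum>c\<in>UNIV. along \<Phi> c ?h (\<Psi> (?s t)) * v $ c)) (at (?s t))"
          using sZ[OF that] by (intro der sm) (auto simp: Z_def)
      qed
      obtain t where t: "0 \<le> t" "t \<le> 1" and
        eq: "?h (\<Psi> (?s 1)) - ?h (\<Psi> (?s 0)) =
          (\<Sum>c\<in>UNIV. along \<Phi> c ?h (\<Psi> (?s t)) * ((1 - 0) *\<^sub>R (z - z0)) $ c)"
        using mvt_very_simple[of 0 1 "\<lambda>t. ?h (\<Psi> (?s t))", OF _ has_derivative_at_withinI[OF d]]
        by (auto simp del: vector_minus_component)
      have "\<bar>?h (\<Psi> z) - ?h (\<Psi> z0)\<bar> = \<bar>\<Sum>c\<in>UNIV. along \<Phi> c ?h (\<Psi> (?s t)) * (z - z0) $ c\<bar>"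
        using eq by simp
      also have "\<dots> \<le> (\<Sum>c\<in>UNIV. \<bar>along \<Phi> c ?h (\<Psi> (?s t)) * (z - z0) $ c\<bar>)"
        by (rule sum_abs)
      also have "\<dots> = (\<Sum>c\<in>- K. \<bar>along \<Phi> c ?h (\<Psi> (?s t)) * (z - z0) $ c\<bar>)"
        using z z0 EB(2) by (intro sum.mono_neutral_right) (auto simp: Z_def)
      also have "\<dots> \<le> (\<Sum>c\<in>- K. M c * norm (z - z0) ^ Suc n)"
      proof (rule sum_mono)
        fix c assume c: "c \<in> - K"
        have "\<bar>along \<Phi> c ?h (\<Psi> (?s t))\<bar> \<le> M c * norm (?s t - z0) ^ n"
          using M1[OF _ z0 sZ[OF t]] c by simp
        also have "\<dots> \<le> M c * norm (z - z0) ^ n"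
          using t M0 c by (intro mult_left_mono power_mono) (auto simp: mult_left_le_one_le)
        finally have "\<bar>along \<Phi> c ?h (\<Psi> (?s t))\<bar> * \<bar>(z - z0) $ c\<bar> \<le> M c * norm (z - z0) ^ n * norm (z - z0)"
          using M0 c by (intro mult_mono component_le_norm_cart) auto
        then show "\<bar>along \<Phi> c ?h (\<Psi> (?s t)) * (z - z0) $ c\<bar> \<le> M c * norm (z - z0) ^ Suc n"
          by (simp add: abs_mult mult_ac)
      qed
      finally show ?thesis by (simp add: sum_distrib_right)
    qed
    moreover have "sum M (- K) \<ge> 0" using M0 by (intro sum_nonneg) auto
    ultimately show ?thesis by blast
  qed
  have bound: "\<exists>M\<ge>0. \<forall>z0\<in>E. \<forall>z\<in>Z. \<bar>word_deriv \<Phi> g w (\<Psi> z)\<bar> \<le> M * norm (z - z0) ^ n"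
    if "set w \<subseteq> - K" "length w + n = Suc p" "w \<noteq> []" for w n
    using that
  proof (induction n arbitrary: w)
    case 0
    have "continuous_on B (\<lambda>z. word_deriv \<Phi> g w (\<Psi> z))"
      by (rule continuous_on_compose2[OF smooth_continuous_on[OF sm] \<Psi>])
    then have "bounded ((\<lambda>z. word_deriv \<Phi> g w (\<Psi> z)) ` B)"
      using B(1) by (intro compact_imp_bounded compact_continuous_image)
    then obtain M where "M > 0" "\<And>z. z \<in> B \<Longrightarrow> \<bar>word_deriv \<Phi> g w (\<Psi> z)\<bar> \<le> M"
      by (auto simp: bounded_pos)
    then show ?case by (intro exI[of _ M]) (auto simp: Z_def)
  next
    case (Suc n)
    have "\<exists>M\<ge>0. \<forall>z0\<in>E. \<forall>z\<in>Z.
      \<bar>word_deriv \<Phi> g w (\<Psi> z) - word_deriv \<Phi> g w (\<Psi> z0)\<bar> \<le> M * norm (z - z0) ^ Suc n"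
      by (rule integrate[OF Suc.IH]) (use Suc.prems in auto)
    moreover have "word_deriv \<Phi> g w (\<Psi> z0) = 0" if "z0 \<in> E" for z0
      using E[OF that Suc.prems(1)] Suc.prems(2,3) by (simp add: Suc_le_eq)
    ultimately show ?case by simp
  qed
  obtain M where "M \<ge> 0" "\<And>z0 z. z0 \<in> E \<Longrightarrow> z \<in> Z \<Longrightarrow>
      \<bar>word_deriv \<Phi> g [] (\<Psi> z) - word_deriv \<Phi> g [] (\<Psi> z0)\<bar> \<le> M * norm (z - z0) ^ Suc p"
    using integrate[of "[]" p, OF bound] by auto
  then show ?thesis using that[of M] by (auto simp: Z_def)
qed

lemma negligible_image_if_locally:
  fixes F :: "'c::euclidean_space set" and g :: "'c \<Rightarrow> 'd::euclidean_space"
  assumes "\<And>x. x \<in> F \<Longrightarrow> \<exists>O'. open O' \<and> x \<in> O' \<and> negligible (g ` (F \<inter> O'))"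
  shows "negligible (g ` F)"
proof -
  define \<O> where "\<O> = {O'. open O' \<and> negligible (g ` (F \<inter> O'))}"
  obtain \<O>' where \<O>': "\<O>' \<subseteq> \<O>" "countable \<O>'" "\<Union>\<O>' = \<Union>\<O>"
    by (rule Lindelof[of \<O>]) (auto simp: \<O>_def)
  have "F \<subseteq> \<Union>\<O>'" using assms unfolding \<O>'(3) by (auto simp: \<O>_def)
  then have "g ` F \<subseteq> \<Union>((\<lambda>O'. g ` (F \<inter> O')) ` \<O>')" by blast
  moreover have "negligible (\<Union>((\<lambda>O'. g ` (F \<inter> O')) ` \<O>'))"
    using \<O>'(1,2) by (intro negligible_countable_Union) (auto simp: \<O>_def)
  ultimately show ?thesis by (rule negligible_subset[rotated])
qed

text \<open>A word of length up to the ambient dimension \<open>a\<close> gives the Hoelder exponent \<open>a + 1\<close>, which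
beats the \<open>O(n\<^sup>a)\<close> cells of a grid.\<close>

lemma negligible_image_of_flat_points:
  fixes \<Phi> :: "'i::finite \<Rightarrow> real^'i \<Rightarrow> real"
  assumes V: "open V" and \<Phi>: "\<And>i. smooth V (\<Phi> i)" and nz: "\<And>x. x \<in> V \<Longrightarrow> det (frame \<Phi> x) \<noteq> 0"
    and g: "smooth V g"
  shows "negligible (g ` {x \<in> V. (\<forall>k\<in>K. \<Phi> k x = 0) \<and>
    (\<forall>w. set w \<subseteq> - K \<longrightarrow> 1 \<le> length w \<longrightarrow> length w \<le> CARD('i) \<longrightarrow> word_deriv \<Phi> g w x = 0)})"
    (is "negligible (g ` ?F)")
proof -
  let ?P = "\<lambda>x. \<chi> i. \<Phi> i x"
  have loc: "\<exists>O'. open O' \<and> x0 \<in> O' \<and> negligible (g ` (?F \<inter> O'))" if x0: "x0 \<in> V" for x0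
  proof -
    obtain U W \<Psi> where U: "open U" "U \<subseteq> V" "x0 \<in> U" "open W" and hom: "homeomorphism U W ?P \<Psi>"
      and der: "\<forall>z\<in>W. \<forall>h. smooth V h \<longrightarrow>
        ((\<lambda>z. h (\<Psi> z)) has_derivative (\<lambda>v. \<Sum>c\<in>UNIV. along \<Phi> c h (\<Psi> z) * v $ c)) (at z)"
      using local_inverse[OF V \<Phi> nz x0] by blast
    have "?P x0 \<in> W" using hom U(3) by (auto simp: homeomorphism_def)
    then obtain r where r: "r > 0" "cball (?P x0) r \<subseteq> W"
      using U(4) open_contains_cball by metis
    let ?B = "cball (?P x0) r"
    let ?O = "U \<inter> ?P -` ball (?P x0) r"
    have PU: "continuous_on U ?P" using hom by (simp add: homeomorphism_def)
    have O: "open ?O"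
      by (rule continuous_open_preimage[OF PU U(1)]) simp
    define E where "E = ?P ` (?F \<inter> ?O)"
    have inv: "\<Psi> (?P x) = x" if "x \<in> U" for x
      using hom that by (simp add: homeomorphism_def)
    have "continuous_on W \<Psi>" "\<Psi> ` W = U"
      using hom by (auto simp: homeomorphism_def)
    then have \<Psi>B: "continuous_on ?B \<Psi>" "\<Psi> ` ?B \<subseteq> V"
      using r(2) U(2) by (auto intro: continuous_on_subset)
    have E1: "word_deriv \<Phi> g w (\<Psi> z0) = 0"
      if "z0 \<in> E" "set w \<subseteq> - K" "1 \<le> length w" "length w \<le> CARD('i)" for z0 w
      using that inv by (auto simp: E_def)
    have E2: "E \<subseteq> ?B" by (auto simp: E_def)
    have E3: "z0 $ k = 0" if "z0 \<in> E" "k \<in> K" for z0 k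
      using that by (auto simp: E_def)
    obtain M where M: "M \<ge> 0" "\<And>z0 z. z0 \<in> E \<Longrightarrow> z \<in> ?B \<Longrightarrow> (\<And>k. k \<in> K \<Longrightarrow> z $ k = 0) \<Longrightarrow>
      \<bar>g (\<Psi> z) - g (\<Psi> z0)\<bar> \<le> M * norm (z - z0) ^ Suc CARD('i)"
      by (rule flat_points_Holder[OF V \<Phi> nz g _ _ \<Psi>B, of E K "CARD('i)"])
        (use r(2) der E1 E2 E3 in auto)
    have "negligible ((\<lambda>z. g (\<Psi> z)) ` E)"
    proof (rule negligible_image_of_steep_Holder[OF _ M(1)])
      show "bounded E" using E2 bounded_subset bounded_cball by blast
      show "\<bar>g (\<Psi> y) - g (\<Psi> z)\<bar> \<le> M * norm (y - z) ^ Suc CARD('i)" if "y \<in> E" "z \<in> E" for y z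
        using M(2)[OF that(2), of y] that E2 E3 by blast
    qed
    moreover have "(\<lambda>z. g (\<Psi> z)) ` E = g ` (?F \<inter> ?O)"
      unfolding E_def image_image using inv by (intro image_cong) auto
    ultimately have "negligible (g ` (?F \<inter> ?O))" by simp
    then show ?thesis using O U(3) r(1) by (intro exI[of _ ?O]) auto
  qed
  show ?thesis
    by (rule negligible_image_if_locally) (rule loc, simp)
qed

section \<open>Sard's theorem on a constraint set\<close>

text \<open>With \<open>S\<close> the gradients of the constraints, \<open>x\<close> is a critical point of the components \<open>g b\<close>,
\<open>b \<in> J\<close>, on the constraint set.\<close>

definition dependent_mod ::
  "'b::euclidean_space set \<Rightarrow> ('b \<Rightarrow> real^'i::finite \<Rightarrow> real) \<Rightarrow> (real^'i) set \<Rightarrow> real^'i \<Rightarrow> bool"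
  where "dependent_mod J g S x \<longleftrightarrow>
    (\<exists>l::'b. (\<exists>b\<in>J. l \<bullet> b \<noteq> 0) \<and> (\<Sum>b\<in>J. (l \<bullet> b) *\<^sub>R grad (g b) x) \<in> span S)"

text \<open>The coordinates of \<open>u\<close> outside \<open>J\<close> are free: dropping a component of \<open>g\<close> leaves the target space,
and hence the measure, unchanged.\<close>

definition critical_values ::
  "(real^'i) set \<Rightarrow> ('i \<Rightarrow> real^'i::finite \<Rightarrow> real) \<Rightarrow> 'i set \<Rightarrow>
   'b set \<Rightarrow> ('b::euclidean_space \<Rightarrow> real^'i \<Rightarrow> real) \<Rightarrow> 'b set"
  where "critical_values V \<Phi> K J g = {u. \<exists>x\<in>V. (\<forall>k\<in>K. \<Phi> k x = 0) \<and>
    dependent_mod J g ((\<lambda>k. grad (\<Phi> k) x) ` K) x \<and> (\<forall>b\<in>J. u \<bullet> b = g b x)}"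

lemma span_image_finite_iff:
  fixes F :: "'i::finite \<Rightarrow> 'v::real_vector"
  shows "v \<in> span (F ` K) \<longleftrightarrow> (\<exists>m::real^'i. v = (\<Sum>k\<in>K. m $ k *\<^sub>R F k))"
proof
  assume "v \<in> span (F ` K)"
  then show "\<exists>m::real^'i. v = (\<Sum>k\<in>K. m $ k *\<^sub>R F k)"
  proof (induction rule: span_induct_alt)
    case base
    show ?case by (rule exI[of _ 0]) simp
  next
    case (step c y z)
    then obtain m :: "real^'i" and k where m: "z = (\<Sum>k\<in>K. m $ k *\<^sub>R F k)" and k: "k \<in> K" "y = F k"
      by blast
    have "(\<Sum>j\<in>K. (m + c *\<^sub>R axis k 1) $ j *\<^sub>R F j)
        = (\<Sum>j\<in>K. m $ j *\<^sub>R F j) + (\<Sum>j\<in>K. if j = k then c *\<^sub>R F k else 0)"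
      by (subst sum.distrib[symmetric], intro sum.cong) (auto simp: axis_def scaleR_add_left)
    also have "\<dots> = c *\<^sub>R y + z" using k m by simp
    finally show ?case by metis
  qed
next
  assume "\<exists>m::real^'i. v = (\<Sum>k\<in>K. m $ k *\<^sub>R F k)"
  then show "v \<in> span (F ` K)" by (auto intro!: span_sum span_scale intro: span_base)
qed

text \<open>The multipliers that express the dependence enter as additional real unknowns, so that the set is a
projection of a locally closed set.\<close>

lemma critical_values_borel:
  fixes g :: "'b::euclidean_space \<Rightarrow> real^'i::finite \<Rightarrow> real"
  assumes V: "open V" and \<Phi>: "\<And>i. smooth V (\<Phi> i)" and g: "\<And>b. b \<in> J \<Longrightarrow> smooth V (g b)"
    and J: "finite J"
  shows "critical_values V \<Phi> K J g \<in> sets borel"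
proof -
  define W where "W = (UNIV :: 'b set) \<times> V \<times> {l::'b. \<exists>b\<in>J. l \<bullet> b \<noteq> 0} \<times> (UNIV :: (real^'i) set)"
  \<comment> \<open>All equations are packed into one nonnegative function.\<close>
  define \<psi> where "\<psi> = (\<lambda>(u::'b, x, l::'b, m::real^'i).
    (\<Sum>k\<in>K. \<bar>\<Phi> k x\<bar>) + (\<Sum>b\<in>J. \<bar>u \<bullet> b - g b x\<bar>) +
    norm ((\<Sum>b\<in>J. (l \<bullet> b) *\<^sub>R grad (g b) x) - (\<Sum>k\<in>K. m $ k *\<^sub>R grad (\<Phi> k) x)))"
  have oW: "open W"
  proof -
    have "{l::'b. \<exists>b\<in>J. l \<bullet> b \<noteq> 0} = (\<Union>b\<in>J. {l. l \<bullet> b \<noteq> 0})" by blast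
    moreover have "open {l::'b. l \<bullet> b \<noteq> 0}" for b
      by (intro open_Collect_neq continuous_intros)
    ultimately have "open {l::'b. \<exists>b\<in>J. l \<bullet> b \<noteq> 0}" by auto
    then show ?thesis unfolding W_def by (intro open_Times V open_UNIV)
  qed
  have xW: "continuous_on W (\<lambda>z. f (fst (snd z)))" if "continuous_on V f" for f :: "real^'i \<Rightarrow> 'z::topological_space"
    by (rule continuous_on_compose2[OF that]) (auto simp: W_def intro!: continuous_intros)
  have c\<psi>: "continuous_on W \<psi>"
    unfolding \<psi>_def case_prod_unfold
    by (intro continuous_intros xW smooth_continuous_on continuous_on_grad \<Phi> g)
  have nn: "(\<Sum>k\<in>K. \<bar>\<Phi> k x\<bar>) + (\<Sum>b\<in>J. \<bar>u \<bullet> b - g b x\<bar>) + norm y = 0 \<longleftrightarrow>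
      (\<forall>k\<in>K. \<Phi> k x = 0) \<and> (\<forall>b\<in>J. u \<bullet> b = g b x) \<and> y = 0" for x u and y :: "real^'i"
  proof -
    have "(\<Sum>k\<in>K. \<bar>\<Phi> k x\<bar>) \<ge> 0" "(\<Sum>b\<in>J. \<bar>u \<bullet> b - g b x\<bar>) \<ge> 0" "norm y \<ge> 0"
      by (auto intro: sum_nonneg)
    then have "(\<Sum>k\<in>K. \<bar>\<Phi> k x\<bar>) + (\<Sum>b\<in>J. \<bar>u \<bullet> b - g b x\<bar>) + norm y = 0 \<longleftrightarrow>
      (\<Sum>k\<in>K. \<bar>\<Phi> k x\<bar>) = 0 \<and> (\<Sum>b\<in>J. \<bar>u \<bullet> b - g b x\<bar>) = 0 \<and> norm y = 0"
      by linarith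
    then show ?thesis using J by (simp add: sum_nonneg_eq_0_iff)
  qed
  have "critical_values V \<Phi> K J g = fst ` {z \<in> W. \<psi> z = 0}"
  proof (rule set_eqI)
    fix u :: 'b
    have "u \<in> critical_values V \<Phi> K J g \<longleftrightarrow> (\<exists>x\<in>V. \<exists>l m. (\<exists>b\<in>J. l \<bullet> b \<noteq> 0) \<and> \<psi> (u, x, l, m) = 0)"
      unfolding critical_values_def dependent_mod_def span_image_finite_iff \<psi>_def
      by (simp add: nn) blast
    also have "\<dots> \<longleftrightarrow> u \<in> fst ` {z \<in> W. \<psi> z = 0}"
      by (force simp: W_def)
    finally show "u \<in> critical_values V \<Phi> K J g \<longleftrightarrow> u \<in> fst ` {z \<in> W. \<psi> z = 0}" .
  qed
  also have "\<dots> \<in> sets borel"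
    by (rule image_locally_closed_borel[OF oW c\<psi>]) (intro continuous_intros)
  finally show ?thesis .
qed

lemma open_nonzero: "open V \<Longrightarrow> smooth V f \<Longrightarrow> open {x \<in> V. f x \<noteq> 0}"
  using continuous_open_preimage[of V f "- {0}"] smooth_continuous_on
  by (auto simp: vimage_def Int_def conj_commute)

lemma grad_diff_const:
  assumes "smooth V h" "x \<in> V" shows "grad (\<lambda>x. h x - c) x = grad h x"
  by (rule grad_eqI) (use has_derivative_diff[OF smoothD[OF assms] has_derivative_const] in simp)

text \<open>This is the induction described at the top, on the number of unconstrained coordinates.\<close>

lemma negligible_critical_values:
  fixes g :: "'b::euclidean_space \<Rightarrow> real^'i::finite \<Rightarrow> real"
  assumes "open V" "\<And>i. smooth V (\<Phi> i)" "\<And>x. x \<in> V \<Longrightarrow> det (frame \<Phi> x) \<noteq> 0"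
    and "\<And>b. b \<in> J \<Longrightarrow> smooth V (g b)" "J \<subseteq> Basis"
  shows "negligible (critical_values V \<Phi> K J g)"
  using assms
proof (induction "card (- K)" arbitrary: V \<Phi> K J rule: less_induct)
  case less
  note V = less.prems(1) and \<Phi> = less.prems(2) and nz = less.prems(3) and g = less.prems(4)
  have finJ: "finite J" using less.prems(5) finite_Basis finite_subset by blast
  have smaller: "card (- insert c K) < card (- K)" if "c \<notin> K" for c
    using that by (intro psubset_card_mono) auto
  show ?case
  proof (cases "J = {}")
    case True
    then show ?thesis by (simp add: critical_values_def dependent_mod_def)
  next
    case False
    then obtain b0 where b0: "b0 \<in> J" by blast
    then have b0B: "b0 \<in> Basis" using less.prems(5) by blast
    note g0 = g[OF b0]
    let ?w = "word_deriv \<Phi> (g b0)"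
    note sw = smooth_word_deriv[OF V \<Phi> nz g0]
    \<comment> \<open>On \<open>R w c\<close> the derivative of order \<open>length w\<close> may take the place of \<open>\<Phi> c\<close>.\<close>
    define R where "R w c = {x \<in> V. along \<Phi> c (?w w) x \<noteq> 0}" for w c
    have R: "open (R w c)" "R w c \<subseteq> V" for w c
      unfolding R_def using open_nonzero[OF V smooth_along[OF V \<Phi> nz sw]] by auto
    have sub\<Phi>: "smooth (R w c) (\<Phi> i)" and subg: "b \<in> J \<Longrightarrow> smooth (R w c) (g b)" for w c i b
      using smooth_subset[OF \<Phi> R(2)] smooth_subset[OF g R(2)] by auto

    \<comment> \<open>A nonzero first derivative: on the slice \<open>u \<bullet> b0 = t\<close>, the component \<open>g b0\<close> is one more constraint.\<close>
    have A: "negligible (critical_values (R [] c) \<Phi> K J g)" if c: "c \<notin> K" for c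
    proof (rule negligible_if_negligible_slices[where b = b0])
      show "critical_values (R [] c) \<Phi> K J g \<in> sets borel"
        by (rule critical_values_borel[OF R(1) sub\<Phi> subg finJ])
      fix t
      let ?h = "\<lambda>x. g b0 x - t"
      let ?\<Phi> = "\<Phi>(c := ?h)"
      have gh: "grad ?h x = grad (g b0) x" if "x \<in> R [] c" for x
        using grad_diff_const[OF g0] R(2) that by blast
      have "negligible (critical_values (R [] c) ?\<Phi> (insert c K) (J - {b0}) g)"
      proof (rule less.hyps[OF smaller[OF c] R(1)])
        show "smooth (R [] c) (?\<Phi> i)" for i
          using sub\<Phi> subg[OF b0] by (auto intro!: smooth_diff smooth_const R(1))
        show "det (frame ?\<Phi> x) \<noteq> 0" if x: "x \<in> R [] c" for x
        proof -
          have "along \<Phi> c ?h x = along \<Phi> c (g b0) x" by (simp add: along_def gh[OF x])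
          then show ?thesis
            using x nz[of x] by (simp add: det_frame_update R_def)
        qed
      qed (use subg less.prems(5) in auto)
      moreover have "{u. u + (t - u \<bullet> b0) *\<^sub>R b0 \<in> critical_values (R [] c) \<Phi> K J g}
          \<subseteq> critical_values (R [] c) ?\<Phi> (insert c K) (J - {b0}) g"
      proof
        fix u assume "u \<in> {u. u + (t - u \<bullet> b0) *\<^sub>R b0 \<in> critical_values (R [] c) \<Phi> K J g}"
        then obtain x where x: "x \<in> R [] c" "\<forall>k\<in>K. \<Phi> k x = 0"
          "dependent_mod J g ((\<lambda>k. grad (\<Phi> k) x) ` K) x"
          and ux: "\<forall>b\<in>J. (u + (t - u \<bullet> b0) *\<^sub>R b0) \<bullet> b = g b x"
          by (auto simp: critical_values_def)
        have "g b0 x = t"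
          using ux b0 b0B by (auto simp: inner_add_left inner_diff_left algebra_simps)
        moreover have "u \<bullet> b = g b x" if "b \<in> J - {b0}" for b
        proof -
          have "b0 \<bullet> b = 0" using that b0B less.prems(5) by (auto simp: inner_not_same_Basis)
          then show ?thesis using ux that by (auto simp: inner_add_left)
        qed
        moreover have "\<forall>k\<in>insert c K. ?\<Phi> k x = 0"
          using x(2) \<open>g b0 x = t\<close> c by auto
        moreover have "dependent_mod (J - {b0}) g ((\<lambda>k. grad (?\<Phi> k) x) ` insert c K) x"
        proof -
          have img: "(\<lambda>k. grad (?\<Phi> k) x) ` insert c K
              = insert (grad (g b0) x) ((\<lambda>k. grad (\<Phi> k) x) ` K)"
            using c gh[OF x(1)] by (auto simp: image_iff)
          obtain l where l: "\<exists>b\<in>J. l \<bullet> b \<noteq> 0"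
            "(\<Sum>b\<in>J. (l \<bullet> b) *\<^sub>R grad (g b) x) \<in> span ((\<lambda>k. grad (\<Phi> k) x) ` K)"
            using x(3) by (auto simp: dependent_mod_def)
          have split: "(\<Sum>b\<in>J. (l \<bullet> b) *\<^sub>R grad (g b) x)
              = (l \<bullet> b0) *\<^sub>R grad (g b0) x + (\<Sum>b\<in>J - {b0}. (l \<bullet> b) *\<^sub>R grad (g b) x)"
            by (rule sum.remove[OF finJ b0])
          have "\<exists>b\<in>J - {b0}. l \<bullet> b \<noteq> 0"
          proof (rule ccontr)
            assume n: "\<not> (\<exists>b\<in>J - {b0}. l \<bullet> b \<noteq> 0)"
            then have "l \<bullet> b0 \<noteq> 0" using l(1) by blast
            moreover have "(l \<bullet> b0) *\<^sub>R grad (g b0) x \<in> span ((\<lambda>k. grad (\<Phi> k) x) ` K)"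
              using l(2) n unfolding split by simp
            ultimately have "grad (g b0) x \<in> span ((\<lambda>k. grad (\<Phi> k) x) ` K)"
              using span_scale[of "(l \<bullet> b0) *\<^sub>R grad (g b0) x" _ "inverse (l \<bullet> b0)"] by simp
            then have "coef \<Phi> x (grad (g b0) x) $ c = 0"
              using in_span_frame_iff[OF nz] R(2) x(1) c by blast
            then show False using x(1) by (simp add: R_def along_def)
          qed
          moreover have "(\<Sum>b\<in>J - {b0}. (l \<bullet> b) *\<^sub>R grad (g b) x)
              \<in> span (insert (grad (g b0) x) ((\<lambda>k. grad (\<Phi> k) x) ` K))" (is "_ \<in> ?X")
          proof -
            have "(\<Sum>b\<in>J. (l \<bullet> b) *\<^sub>R grad (g b) x) \<in> ?X"
              using l(2) span_mono[OF subset_insertI] by blast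
            moreover have "(l \<bullet> b0) *\<^sub>R grad (g b0) x \<in> ?X"
              by (intro span_scale span_base) simp
            ultimately have "(\<Sum>b\<in>J. (l \<bullet> b) *\<^sub>R grad (g b) x) - (l \<bullet> b0) *\<^sub>R grad (g b0) x \<in> ?X"
              by (rule span_diff)
            then show ?thesis by (simp add: split)
          qed
          ultimately show ?thesis unfolding dependent_mod_def img by blast
        qed
        ultimately show "u \<in> critical_values (R [] c) ?\<Phi> (insert c K) (J - {b0}) g"
          using x(1) unfolding critical_values_def by blast
      qed
      ultimately show "negligible {u. u + (t - u \<bullet> b0) *\<^sub>R b0 \<in> critical_values (R [] c) \<Phi> K J g}"
        using negligible_subset by blast
    qed

    \<comment> \<open>The first nonzero derivative has order \<open>length w + 1\<close>: its predecessor is one more constraint.\<close>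
    have B: "negligible (critical_values (R w c) (\<Phi>(c := ?w w)) (insert c K) J g)" if c: "c \<notin> K" for w c
    proof (rule less.hyps[OF smaller[OF c] R(1) _ _ subg less.prems(5)])
      show "smooth (R w c) ((\<Phi>(c := ?w w)) i)" for i
        using sub\<Phi> smooth_subset[OF sw R(2)] by auto
      show "det (frame (\<Phi>(c := ?w w)) x) \<noteq> 0" if x: "x \<in> R w c" for x
        using x nz[of x] by (simp add: det_frame_update R_def)
    qed

    \<comment> \<open>At flat points a single component of \<open>g\<close> already has a null image.\<close>
    define flat where "flat = {x \<in> V. (\<forall>k\<in>K. \<Phi> k x = 0) \<and>
      (\<forall>w. set w \<subseteq> - K \<longrightarrow> 1 \<le> length w \<longrightarrow> length w \<le> CARD('i) \<longrightarrow> ?w w x = 0)}"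
    have C: "negligible {u. u \<bullet> b0 \<in> g b0 ` flat}"
      unfolding flat_def
      by (intro negligible_coordinate_preimage negligible_image_of_flat_points V \<Phi> nz g0 b0B)

    define words where "words = {w :: 'i list. set w \<subseteq> UNIV \<and> length w \<le> CARD('i)}"
    have fw: "finite words" unfolding words_def by (rule finite_lists_length_le) simp
    let ?cover = "{u. u \<bullet> b0 \<in> g b0 ` flat} \<union>
      (\<Union>c\<in>- K. critical_values (R [] c) \<Phi> K J g) \<union>
      (\<Union>w\<in>words. \<Union>c\<in>- K. critical_values (R w c) (\<Phi>(c := ?w w)) (insert c K) J g)"
    have "critical_values V \<Phi> K J g \<subseteq> ?cover"
    proof
      fix u assume "u \<in> critical_values V \<Phi> K J g"
      then obtain x where x: "x \<in> V" "\<forall>k\<in>K. \<Phi> k x = 0"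
        and dep: "dependent_mod J g ((\<lambda>k. grad (\<Phi> k) x) ` K) x"
        and ux: "\<forall>b\<in>J. u \<bullet> b = g b x"
        by (auto simp: critical_values_def)
      show "u \<in> ?cover"
      proof (cases "x \<in> flat")
        case True
        then show ?thesis using ux b0 by blast
      next
        case False
        define bad where "bad w \<longleftrightarrow> set w \<subseteq> - K \<and> 1 \<le> length w \<and> length w \<le> CARD('i) \<and> ?w w x \<noteq> 0" for w
        have "\<exists>w. bad w" using False x by (auto simp: flat_def bad_def)
        \<comment> \<open>A shortest word is needed: all its nonempty proper tails give vanishing derivatives.\<close>
        then obtain w where w: "bad w" and least: "\<And>w'. bad w' \<Longrightarrow> length w \<le> length w'"
          using ex_has_least_nat[of bad _ length] by blast
        from w obtain c w0 where cw: "w = c # w0" by (cases w) (auto simp: bad_def)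
        have c: "c \<in> - K" and xR: "x \<in> R w0 c" and w0: "w0 \<in> words"
          using w x(1) by (auto simp: bad_def cw R_def words_def)
        show ?thesis
        proof (cases "w0 = []")
          case True
          then have "u \<in> critical_values (R [] c) \<Phi> K J g"
            using xR x(2) dep ux by (auto simp: critical_values_def)
          then show ?thesis using c by blast
        next
          case False
          have "\<not> bad w0" using least[of w0] by (auto simp: cw)
          then have 0: "?w w0 x = 0"
            using w False by (auto simp: bad_def cw Suc_le_eq)
          let ?\<Phi> = "\<Phi>(c := ?w w0)"
          have "(\<lambda>k. grad (\<Phi> k) x) ` K \<subseteq> (\<lambda>k. grad (?\<Phi> k) x) ` insert c K"
            using c by (auto simp: image_iff)
          then have "dependent_mod J g ((\<lambda>k. grad (?\<Phi> k) x) ` insert c K) x"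
            using dep span_mono unfolding dependent_mod_def by blast
          moreover have "\<forall>k\<in>insert c K. ?\<Phi> k x = 0" using x(2) 0 c by auto
          ultimately have "u \<in> critical_values (R w0 c) ?\<Phi> (insert c K) J g"
            using xR ux unfolding critical_values_def by blast
          then show ?thesis using c w0 by blast
        qed
      qed
    qed
    moreover have "negligible ?cover"
      using A B C fw by (intro negligible_Un negligible_Union) auto
    ultimately show ?thesis using negligible_subset by blast
  qed
qed

text \<open>Independent constraints \<open>w i\<close> are moved into the frame one at a time: the gradient of \<open>w j\<close> is outside
the span of the constraints already in the frame, so some \<open>\<Phi> c\<close> with \<open>c \<notin> K\<close> can be exchanged
for it.\<close>

lemma sard_constraints_step:
  fixes g :: "'b::euclidean_space \<Rightarrow> real^'i::finite \<Rightarrow> real" and w :: "'w \<Rightarrow> real^'i \<Rightarrow> real"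
  assumes "finite I" "open V" "\<And>i. smooth V (\<Phi> i)" "\<And>x. x \<in> V \<Longrightarrow> det (frame \<Phi> x) \<noteq> 0"
    and "\<And>b. b \<in> J \<Longrightarrow> smooth V (g b)" "J \<subseteq> Basis" "\<And>i. i \<in> I \<Longrightarrow> smooth V (w i)"
  shows "negligible {u. \<exists>x\<in>V. (\<forall>k\<in>K. \<Phi> k x = 0) \<and> (\<forall>i\<in>I. w i x = 0) \<and>
    (\<forall>\<alpha>. (\<Sum>i\<in>I. \<alpha> i *\<^sub>R grad (w i) x) \<in> span ((\<lambda>k. grad (\<Phi> k) x) ` K) \<longrightarrow> (\<forall>i\<in>I. \<alpha> i = 0)) \<and>
    (\<exists>l \<alpha>. (\<exists>b\<in>J. l \<bullet> b \<noteq> 0) \<and>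
      (\<Sum>b\<in>J. (l \<bullet> b) *\<^sub>R grad (g b) x) + (\<Sum>i\<in>I. \<alpha> i *\<^sub>R grad (w i) x)
        \<in> span ((\<lambda>k. grad (\<Phi> k) x) ` K)) \<and>
    (\<forall>b\<in>J. u \<bullet> b = g b x)}"
    (is "negligible (?S I V \<Phi> K)")
  using assms
proof (induction I arbitrary: V \<Phi> K rule: finite_induct)
  case empty
  have "?S {} V \<Phi> K = critical_values V \<Phi> K J g"
    by (auto simp: critical_values_def dependent_mod_def)
  then show ?case using negligible_critical_values[of V \<Phi> J g K] empty.prems by simp
next
  case (insert j I)
  note V = insert.prems(1) and \<Phi> = insert.prems(2) and nz = insert.prems(3)
  have wj: "smooth V (w j)" using insert.prems by blast
  define R where "R c = {x \<in> V. along \<Phi> c (w j) x \<noteq> 0}" for c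
  have R: "open (R c)" "R c \<subseteq> V" for c
    unfolding R_def using open_nonzero[OF V smooth_along[OF V \<Phi> nz wj]] by auto
  have neg: "negligible (?S I (R c) (\<Phi>(c := w j)) (insert c K))" for c
  proof (rule insert.IH[OF R(1)])
    show "smooth (R c) ((\<Phi>(c := w j)) i)" for i
      using smooth_subset[OF \<Phi> R(2)] smooth_subset[OF wj R(2)] by auto
    show "det (frame (\<Phi>(c := w j)) x) \<noteq> 0" if "x \<in> R c" for x
      using that nz[of x] by (simp add: det_frame_update R_def)
  qed (use insert.prems smooth_subset[OF _ R(2)] in auto)
  have "?S (insert j I) V \<Phi> K \<subseteq> (\<Union>c\<in>- K. ?S I (R c) (\<Phi>(c := w j)) (insert c K))"
  proof
    fix u assume "u \<in> ?S (insert j I) V \<Phi> K"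
    then obtain x l \<alpha> where x: "x \<in> V" "\<forall>k\<in>K. \<Phi> k x = 0" "\<forall>i\<in>insert j I. w i x = 0"
      and ind: "\<And>\<alpha>. (\<Sum>i\<in>insert j I. \<alpha> i *\<^sub>R grad (w i) x) \<in> span ((\<lambda>k. grad (\<Phi> k) x) ` K) \<Longrightarrow>
        (\<forall>i\<in>insert j I. \<alpha> i = 0)"
      and l: "\<exists>b\<in>J. l \<bullet> b \<noteq> 0" "(\<Sum>b\<in>J. (l \<bullet> b) *\<^sub>R grad (g b) x)
        + (\<Sum>i\<in>insert j I. \<alpha> i *\<^sub>R grad (w i) x) \<in> span ((\<lambda>k. grad (\<Phi> k) x) ` K)"
      and ux: "\<forall>b\<in>J. u \<bullet> b = g b x"
      by blast
    let ?G = "(\<lambda>k. grad (\<Phi> k) x) ` K"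
    have sumj: "(\<Sum>i\<in>insert j I. \<beta> i *\<^sub>R grad (w i) x)
        = \<beta> j *\<^sub>R grad (w j) x + (\<Sum>i\<in>I. \<beta> i *\<^sub>R grad (w i) x)" for \<beta>
      using insert.hyps by simp
    have "grad (w j) x \<notin> span ?G"
    proof
      assume "grad (w j) x \<in> span ?G"
      moreover have "(\<Sum>i\<in>I. (if i = j then 1 else 0) *\<^sub>R grad (w i) x) = 0"
        using insert.hyps by (intro sum.neutral) auto
      ultimately have "(\<Sum>i\<in>insert j I. (if i = j then 1 else 0) *\<^sub>R grad (w i) x) \<in> span ?G"
        unfolding sumj by simp
      from ind[OF this] show False by simp
    qed
    then obtain c where c: "c \<notin> K" "along \<Phi> c (w j) x \<noteq> 0"
      using in_span_frame_iff[OF nz[OF x(1)]] by (auto simp: along_def)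
    let ?\<Phi> = "\<Phi>(c := w j)"
    have img: "(\<lambda>k. grad (?\<Phi> k) x) ` insert c K = insert (grad (w j) x) ?G"
      using c by (auto simp: image_iff)
    have indep: "\<forall>i\<in>I. \<beta> i = 0" if \<beta>: "(\<Sum>i\<in>I. \<beta> i *\<^sub>R grad (w i) x) \<in> span (insert (grad (w j) x) ?G)" for \<beta>
    proof -
      obtain r where "(\<Sum>i\<in>I. \<beta> i *\<^sub>R grad (w i) x) - r *\<^sub>R grad (w j) x \<in> span ?G"
        using \<beta> unfolding span_breakdown_eq by blast
      moreover have "(\<Sum>i\<in>I. (\<beta>(j := - r)) i *\<^sub>R grad (w i) x) = (\<Sum>i\<in>I. \<beta> i *\<^sub>R grad (w i) x)"
        using insert.hyps by (intro sum.cong) auto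
      ultimately have "(\<Sum>i\<in>insert j I. (\<beta>(j := - r)) i *\<^sub>R grad (w i) x) \<in> span ?G"
        unfolding sumj by simp
      from ind[OF this] show ?thesis using insert.hyps by (metis fun_upd_other insertI2)
    qed
    have dep: "(\<Sum>b\<in>J. (l \<bullet> b) *\<^sub>R grad (g b) x) + (\<Sum>i\<in>I. \<alpha> i *\<^sub>R grad (w i) x)
        \<in> span (insert (grad (w j) x) ?G)"
      unfolding span_breakdown_eq
      by (rule exI[of _ "- \<alpha> j"]) (use l(2) in \<open>simp add: sumj add_ac\<close>)
    have zero: "\<forall>k\<in>insert c K. ?\<Phi> k x = 0" using x c by auto
    have xR: "x \<in> R c" using x(1) c(2) by (simp add: R_def)
    have "u \<in> ?S I (R c) ?\<Phi> (insert c K)"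
      unfolding mem_Collect_eq
    proof (intro bexI[OF _ xR] conjI zero ux)
      show "\<forall>i\<in>I. w i x = 0" using x(3) by simp
      show "\<forall>\<alpha>. (\<Sum>i\<in>I. \<alpha> i *\<^sub>R grad (w i) x) \<in> span ((\<lambda>k. grad (?\<Phi> k) x) ` insert c K) \<longrightarrow>
          (\<forall>i\<in>I. \<alpha> i = 0)"
        unfolding img by (intro allI impI indep)
      show "\<exists>l \<alpha>. (\<exists>b\<in>J. l \<bullet> b \<noteq> 0) \<and>
          (\<Sum>b\<in>J. (l \<bullet> b) *\<^sub>R grad (g b) x) + (\<Sum>i\<in>I. \<alpha> i *\<^sub>R grad (w i) x)
            \<in> span ((\<lambda>k. grad (?\<Phi> k) x) ` insert c K)"
        unfolding img by (intro exI[of _ l] exI[of _ \<alpha>] conjI l(1) dep)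
    qed
    then show "u \<in> (\<Union>c\<in>- K. ?S I (R c) (\<Phi>(c := w j)) (insert c K))"
      using c(1) by blast
  qed
  moreover have "negligible (\<Union>c\<in>- K. ?S I (R c) (\<Phi>(c := w j)) (insert c K))"
    by (intro negligible_Union) (use neg in auto)
  ultimately show ?case using negligible_subset by blast
qed

text \<open>The induction starts from the standard coordinates, of which none is constrained.\<close>

theorem sard_on_constraint_set:
  fixes g :: "real^'i::finite \<Rightarrow> 'b::euclidean_space" and w :: "'w \<Rightarrow> real^'i \<Rightarrow> real"
  assumes "finite I" "open V" "\<And>i. i \<in> I \<Longrightarrow> smooth V (w i)" "\<And>b. b \<in> Basis \<Longrightarrow> smooth V (\<lambda>x. g x \<bullet> b)"
  shows "negligible (g ` {x \<in> V. (\<forall>i\<in>I. w i x = 0) \<and>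
    (\<forall>\<alpha>. (\<Sum>i\<in>I. \<alpha> i *\<^sub>R grad (w i) x) = 0 \<longrightarrow> (\<forall>i\<in>I. \<alpha> i = 0)) \<and>
    (\<exists>l \<alpha>. l \<noteq> 0 \<and>
      (\<Sum>b\<in>Basis. (l \<bullet> b) *\<^sub>R grad (\<lambda>x. g x \<bullet> b) x) = (\<Sum>i\<in>I. \<alpha> i *\<^sub>R grad (w i) x))})"
    (is "negligible (g ` ?C)")
proof -
  let ?\<Phi> = "\<lambda>i (x::real^'i). x $ i"
  have gr: "grad (?\<Phi> j) x = axis j 1" for j :: 'i and x
    by (rule grad_eqI)
      (use bounded_linear_imp_has_derivative[OF bounded_linear_vec_nth] in \<open>simp add: inner_axis'\<close>)
  have "partial i (?\<Phi> j) x = axis j 1 $ i" for i j :: 'i and x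
    using gr[of j x] by (metis grad_def vec_lambda_beta)
  then have fr: "frame ?\<Phi> x = mat 1" for x :: "real^'i"
    by (simp add: frame_def mat_def vec_eq_iff axis_def)
  let ?S = "{u. \<exists>x\<in>V. (\<forall>k\<in>{}. ?\<Phi> k x = 0) \<and> (\<forall>i\<in>I. w i x = 0) \<and>
    (\<forall>\<alpha>. (\<Sum>i\<in>I. \<alpha> i *\<^sub>R grad (w i) x) \<in> span ((\<lambda>k. grad (?\<Phi> k) x) ` {}) \<longrightarrow> (\<forall>i\<in>I. \<alpha> i = 0)) \<and>
    (\<exists>l \<alpha>. (\<exists>b\<in>Basis. l \<bullet> b \<noteq> 0) \<and>
      (\<Sum>b\<in>Basis. (l \<bullet> b) *\<^sub>R grad (\<lambda>x. g x \<bullet> b) x) + (\<Sum>i\<in>I. \<alpha> i *\<^sub>R grad (w i) x)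
        \<in> span ((\<lambda>k. grad (?\<Phi> k) x) ` {})) \<and>
    (\<forall>b\<in>Basis. u \<bullet> b = g x \<bullet> b)}"
  have "negligible ?S"
    by (rule sard_constraints_step) (use assms smooth_nth[OF assms(2)] in \<open>auto simp: fr\<close>)
  moreover have "g ` ?C \<subseteq> ?S"
  proof
    fix u assume "u \<in> g ` ?C"
    then obtain x l \<alpha> where x: "u = g x" "x \<in> V" "\<forall>i\<in>I. w i x = 0"
      "\<forall>\<alpha>. (\<Sum>i\<in>I. \<alpha> i *\<^sub>R grad (w i) x) = 0 \<longrightarrow> (\<forall>i\<in>I. \<alpha> i = 0)"
      and l: "l \<noteq> 0" "(\<Sum>b\<in>Basis. (l \<bullet> b) *\<^sub>R grad (\<lambda>x. g x \<bullet> b) x) = (\<Sum>i\<in>I. \<alpha> i *\<^sub>R grad (w i) x)"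
      by blast
    have "\<exists>b\<in>Basis. l \<bullet> b \<noteq> 0" using l(1) euclidean_all_zero_iff by blast
    moreover have "(\<Sum>b\<in>Basis. (l \<bullet> b) *\<^sub>R grad (\<lambda>x. g x \<bullet> b) x) + (\<Sum>i\<in>I. (- \<alpha> i) *\<^sub>R grad (w i) x) = 0"
      by (simp add: l(2) sum_negf)
    ultimately have "\<exists>l \<alpha>. (\<exists>b\<in>Basis. l \<bullet> b \<noteq> 0) \<and>
      (\<Sum>b\<in>Basis. (l \<bullet> b) *\<^sub>R grad (\<lambda>x. g x \<bullet> b) x) + (\<Sum>i\<in>I. \<alpha> i *\<^sub>R grad (w i) x) = 0"
      by (intro exI[of _ l] exI[of _ "\<lambda>i. - \<alpha> i"] conjI)
    then show "u \<in> ?S" using x by auto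
  qed
  ultimately show ?thesis by (rule negligible_subset)
qed

section \<open>Generic linear perturbations in coordinates\<close>

text \<open>The solvable right-hand sides form a subspace. If it were proper, then a nonzero vector orthogonal
to it would be a covector as in the assumption, since it annihilates the diagonal (the vectors with
all components \<open>b\<close>) and the image of each \<open>g p\<close>.\<close>

lemma solvable_if_no_covector:
  fixes S :: "'p::finite set" and g :: "'p \<Rightarrow> 'l::finite \<Rightarrow> 'v::euclidean_space" and u :: "'p \<Rightarrow> real^'l"
  assumes "\<And>l :: 'p \<Rightarrow> real^'l. (\<Sum>p\<in>S. l p) = 0 \<Longrightarrow>
    (\<And>p. p \<in> S \<Longrightarrow> (\<Sum>j\<in>UNIV. l p $ j *\<^sub>R g p j) = 0) \<Longrightarrow> \<forall>p\<in>S. l p = 0"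
  shows "\<exists>a b. \<forall>p\<in>S. \<forall>j. u p $ j = g p j \<bullet> a p + b $ j"
proof -
  define W where "W = {v::real^'l^'p. \<exists>a b. \<forall>p\<in>S. \<forall>j. v $ p $ j = g p j \<bullet> a p + b $ j}"
  have W1: "v \<in> W" if "\<And>p j. p \<in> S \<Longrightarrow> v $ p $ j = g p j \<bullet> a p + b $ j" for v a b
    unfolding W_def using that by blast
  have sub: "subspace W"
  proof (rule subspaceI)
    show "0 \<in> W" by (rule W1[of _ "\<lambda>_. 0" 0]) simp
  next
    fix v v' assume "v \<in> W" "v' \<in> W"
    then obtain a b a' b' where "\<forall>p\<in>S. \<forall>j. v $ p $ j = g p j \<bullet> a p + b $ j"
      "\<forall>p\<in>S. \<forall>j. v' $ p $ j = g p j \<bullet> a' p + b' $ j"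
      unfolding W_def by blast
    then show "v + v' \<in> W"
      by (intro W1[of _ "\<lambda>p. a p + a' p" "b + b'"]) (simp add: inner_add_right)
  next
    fix v c assume "v \<in> W"
    then obtain a b where "\<forall>p\<in>S. \<forall>j. v $ p $ j = g p j \<bullet> a p + b $ j"
      unfolding W_def by blast
    then show "c *\<^sub>R v \<in> W"
      by (intro W1[of _ "\<lambda>p. c *\<^sub>R a p" "c *\<^sub>R b"]) (simp add: algebra_simps)
  qed
  have "W = UNIV"
  proof (rule ccontr)
    assume "W \<noteq> UNIV"
    then have "dim W < DIM(real^'l^'p)"
      using sub by (metis dim_eq_full dim_subset_UNIV le_neq_implies_less span_eq_iff)
    then obtain x :: "real^'l^'p" where x: "x \<noteq> 0" and orth: "\<And>v. v \<in> span W \<Longrightarrow> orthogonal x v"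
      by (rule orthogonal_to_subspace_exists) blast
    have perp: "x \<bullet> v = 0" if "v \<in> W" for v
      using orth[OF span_base[OF that]] by (simp add: orthogonal_def)
    have out: "x $ p = 0" if p: "p \<notin> S" for p
    proof -
      have "axis p (x $ p) \<in> W"
        by (rule W1[of _ "\<lambda>_. 0" 0]) (use p in \<open>auto simp: axis_def\<close>)
      from perp[OF this] show ?thesis by (simp add: inner_axis)
    qed
    have "(\<Sum>p\<in>S. x $ p) = 0"
    proof -
      have "(\<Sum>p\<in>UNIV. x $ p) = (\<Sum>p\<in>S. x $ p)"
        using out by (intro sum.mono_neutral_right) auto
      moreover have "(\<chi> p. \<Sum>p\<in>UNIV. x $ p) \<in> W"
        by (rule W1[of _ "\<lambda>_. 0" "\<Sum>p\<in>UNIV. x $ p"]) simp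
      from perp[OF this] have "(\<Sum>p\<in>UNIV. x $ p) \<bullet> (\<Sum>p\<in>UNIV. x $ p) = 0"
        by (simp add: inner_vec_def[of x] inner_sum_left)
      ultimately show ?thesis by simp
    qed
    moreover have "(\<Sum>j\<in>UNIV. x $ p $ j *\<^sub>R g p j) = 0" if p: "p \<in> S" for p
    proof -
      let ?y = "\<Sum>j\<in>UNIV. x $ p $ j *\<^sub>R g p j"
      have "axis p (\<chi> j. g p j \<bullet> ?y) \<in> W"
        by (rule W1[of _ "\<lambda>q. if q = p then ?y else 0" 0]) (auto simp: axis_def)
      from perp[OF this] have "?y \<bullet> ?y = 0"
        by (simp add: inner_axis inner_vec_def[of "x $ p"] inner_sum_left[of _ _ ?y])
      then show ?thesis by simp
    qed
    ultimately have "\<forall>p\<in>S. x $ p = 0" by (rule assms)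
    with out have "x = 0" by (metis vec_eq_iff zero_index)
    with x show False ..
  qed
  then have "(\<chi> p. u p) \<in> W" by simp
  then show ?thesis by (simp add: W_def)
qed

text \<open>The maps \<open>h k\<close> stand for \<open>f\<close> in a chart around the \<open>k\<close>-th point. The conclusion says that the images
of the differentials at the points \<open>x k\<close>, together with the diagonal, span \<open>(R\<^sup>l)\<^sup>s\<close>.

The unknown is \<open>z = (x, A)\<close>. As \<open>s \<le> m + 1\<close> takes finitely many values only, the \<open>s\<close> points are
stored in a fixed type, with \<open>'m option\<close> supplying \<open>m + 1\<close> places; places not in use are dummy
coordinates.\<close>

lemma generic_perturbation_in_coordinates:
  fixes h :: "nat \<Rightarrow> real^'n::finite \<Rightarrow> real^'m::finite" and F :: "real^'m \<Rightarrow> real^'l::finite"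
  assumes s: "1 \<le> s" "s \<le> Suc CARD('m)"
    and D: "\<And>k. k \<in> {1..s} \<Longrightarrow> open (D k)" "\<And>k. k \<in> {1..s} \<Longrightarrow> h k ` D k \<subseteq> U"
    and h: "\<And>k i. k \<in> {1..s} \<Longrightarrow> smooth (D k) (\<lambda>x. h k x $ i)"
    and F: "open U" "\<And>j. smooth U (\<lambda>y. F y $ j)"
  shows "\<exists>N :: (real^'m^'l) set. negligible N \<and> (\<forall>A. A \<notin> N \<longrightarrow>
    (\<forall>x u. (\<forall>k\<in>{1..s}. x k \<in> D k) \<longrightarrow>
    (\<forall>\<alpha>. (\<Sum>k\<in>{2..s}. \<alpha> k *\<^sub>R (h k (x k) - h 1 (x 1))) = 0 \<longrightarrow> (\<forall>k\<in>{2..s}. \<alpha> k = 0)) \<longrightarrow>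
    (\<forall>k\<in>{1..s}. F (h k (x k)) + A *v h k (x k) = F (h 1 (x 1)) + A *v h 1 (x 1)) \<longrightarrow>
    (\<exists>a b. \<forall>k\<in>{1..s}. \<forall>j.
      u k $ j = grad (\<lambda>y. (F (h k y) + A *v h k y) $ j) (x k) \<bullet> a k + b $ j)))"
proof -
  have "card {1..s} \<le> card (UNIV :: 'm option set)" using s by (simp add: card_UNIV_option)
  then obtain e :: "nat \<Rightarrow> 'm option" where e: "inj_on e {1..s}"
    by (metis card_le_inj finite finite_atLeastAtMost)
  define pt where "pt k z = (\<chi> i. z $ Inl (e k, i))" for k and z :: "real^(('m option \<times> 'n) + ('l \<times> 'm))"
  define par where "par z = (\<chi> j i. z $ Inr (j, i))" for z :: "real^(('m option \<times> 'n) + ('l \<times> 'm))"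
  define G where "G k A j y = (F (h k y) + A *v h k y) $ j" for k A j y
  define H where "H k j z = G k (par z) j (pt k z)" for k j z
  define V where "V = {z. \<forall>k\<in>{1..s}. pt k z \<in> D k}"
  define w where "w = (\<lambda>(k, j) z. H k j z - H 1 j z)"
  define I where "I = {2..s} \<times> (UNIV :: 'l set)"
  have bl_pt: "bounded_linear (pt k)" and bl_par: "bounded_linear par" for k
    unfolding pt_def par_def linear_conv_bounded_linear[symmetric]
    by (auto simp: linear_iff vec_eq_iff)
  have oV: "open V"
  proof -
    have "V = (\<Inter>k\<in>{1..s}. pt k -` D k)" by (auto simp: V_def)
    moreover have "open (pt k -` D k)" if "k \<in> {1..s}" for k
      using D(1)[OF that] linear_continuous_on[OF bl_pt] by (auto intro: open_vimage)
    ultimately show ?thesis by (simp add: open_INT)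
  qed
  have Fh: "smooth (D k) (\<lambda>y. F (h k y) $ j)" if "k \<in> {1..s}" for k j
    by (rule smooth_compose[of "D k" U "h k" "\<lambda>y. F y $ j"]) (use D that h F in auto)
  have smG: "smooth (D k) (G k A j)" if "k \<in> {1..s}" for k A j
    unfolding G_def matrix_vector_mult_def
    by (simp, intro smooth_add smooth_sum smooth_mult smooth_const D(1) Fh h that)
  have smpt: "smooth V (\<lambda>z. f (pt k z))" if "k \<in> {1..s}" "smooth (D k) f" for k f
    by (rule smooth_compose[of V "D k" "pt k" f])
      (use that oV D(1) in \<open>auto simp: V_def pt_def intro: smooth_nth\<close>)
  have smH: "smooth V (H k j)" if "k \<in> {1..s}" for k j
  proof -
    have eq: "H k j = (\<lambda>z. F (h k (pt k z)) $ j + (\<Sum>i\<in>UNIV. z $ Inr (j, i) * h k (pt k z) $ i))"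
      by (rule ext) (simp add: H_def G_def par_def matrix_vector_mult_def)
    show ?thesis unfolding eq
      by (intro smooth_add smooth_sum smooth_mult smooth_nth oV
          smpt[of k "\<lambda>y. F (h k y) $ j"] smpt[of k "\<lambda>y. h k y $ _"] Fh h that)
  qed
  have gradH: "grad (H k j) z \<bullet> v = grad (G k (par z) j) (pt k z) \<bullet> pt k v + (par v *v h k (pt k z)) $ j"
    if k: "k \<in> {1..s}" and z: "z \<in> V" for k j z v
  proof -
    have ptD: "pt k z \<in> D k" using k z by (simp add: V_def)
    have 1: "((\<lambda>z'. G k (par z) j (pt k z')) has_derivative
        (\<lambda>v. grad (G k (par z) j) (pt k z) \<bullet> pt k v)) (at z)"
      by (rule has_derivative_compose[OF bounded_linear_imp_has_derivative[OF bl_pt] smoothD[OF smG[OF k] ptD]])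
    have 2: "((\<lambda>z'. h k (pt k z') $ i) has_derivative (\<lambda>v. grad (\<lambda>y. h k y $ i) (pt k z) \<bullet> pt k v)) (at z)" for i
      by (rule has_derivative_compose[OF bounded_linear_imp_has_derivative[OF bl_pt] smoothD[OF h[OF k] ptD]])
    have 3: "((\<lambda>z'. (z' - z) $ Inr (j, i)) has_derivative (\<lambda>v. v $ Inr (j, i))) (at z)" for i
      by (auto intro!: derivative_eq_intros bounded_linear_imp_has_derivative bounded_linear_vec_nth)
    \<comment> \<open>With the matrix held fixed at its value at \<open>z\<close>, the rest of \<open>H\<close> is linear in the matrix increment.\<close>
    have "((\<lambda>z'. G k (par z) j (pt k z') + (\<Sum>i\<in>UNIV. (z' - z) $ Inr (j, i) * h k (pt k z') $ i)) has_derivative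
        (\<lambda>v. grad (G k (par z) j) (pt k z) \<bullet> pt k v
          + (\<Sum>i\<in>UNIV. (z - z) $ Inr (j, i) * (grad (\<lambda>y. h k y $ i) (pt k z) \<bullet> pt k v)
              + v $ Inr (j, i) * h k (pt k z) $ i))) (at z)"
      by (intro has_derivative_add has_derivative_sum has_derivative_mult 1 2 3)
    moreover have "(\<lambda>z'. G k (par z) j (pt k z') + (\<Sum>i\<in>UNIV. (z' - z) $ Inr (j, i) * h k (pt k z') $ i)) = H k j"
      by (simp add: fun_eq_iff H_def G_def par_def matrix_vector_mult_def algebra_simps sum_subtractf)
    ultimately have "(H k j has_derivative (\<lambda>v. grad (G k (par z) j) (pt k z) \<bullet> pt k v
          + (\<Sum>i\<in>UNIV. v $ Inr (j, i) * h k (pt k z) $ i))) (at z)"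
      by simp
    from has_derivative_unique[OF this smoothD[OF smH[OF k] z]]
    have "grad (H k j) z \<bullet> v = grad (G k (par z) j) (pt k z) \<bullet> pt k v
          + (\<Sum>i\<in>UNIV. v $ Inr (j, i) * h k (pt k z) $ i)"
      by metis
    then show ?thesis by (simp add: par_def matrix_vector_mult_def)
  qed
  have smw: "smooth V (w i)" if "i \<in> I" for i
    using that s by (auto simp: w_def I_def intro!: smooth_diff oV smH)
  have gradw: "grad (w (k, j)) z \<bullet> v = grad (G k (par z) j) (pt k z) \<bullet> pt k v
      - grad (G 1 (par z) j) (pt 1 z) \<bullet> pt 1 v + (par v *v (h k (pt k z) - h 1 (pt 1 z))) $ j"
    if k: "k \<in> {2..s}" and z: "z \<in> V" for k j z v
  proof -
    have k': "k \<in> {1..s}" "1 \<in> {1..s}" using k by auto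
    have "(w (k, j) has_derivative (\<lambda>v. grad (H k j) z \<bullet> v - grad (H 1 j) z \<bullet> v)) (at z)"
      unfolding w_def prod.case by (intro has_derivative_diff smoothD[OF smH] k' z)
    moreover have "smooth V (w (k, j))" using k by (intro smw) (simp add: I_def)
    ultimately have "(\<lambda>v. grad (H k j) z \<bullet> v - grad (H 1 j) z \<bullet> v) = (\<lambda>v. grad (w (k, j)) z \<bullet> v)"
      using has_derivative_unique smoothD z by blast
    then have "grad (w (k, j)) z \<bullet> v = grad (H k j) z \<bullet> v - grad (H 1 j) z \<bullet> v"
      by metis
    also have "\<dots> = (grad (G k (par z) j) (pt k z) \<bullet> pt k v + (par v *v h k (pt k z)) $ j)
        - (grad (G 1 (par z) j) (pt 1 z) \<bullet> pt 1 v + (par v *v h 1 (pt 1 z)) $ j)"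
      by (simp only: gradH[OF k'(1) z] gradH[OF k'(2) z])
    finally show ?thesis by (simp add: matrix_vector_mult_diff_distrib)
  qed
  have smpar: "smooth V (\<lambda>z. par z \<bullet> b)" if "b \<in> Basis" for b
    by (rule smooth_linear[OF oV]) (intro bounded_linear_compose[OF bounded_linear_inner_left bl_par])
  have gradpar: "grad (\<lambda>z. par z \<bullet> b) z \<bullet> v = par v \<bullet> b" if "z \<in> V" "b \<in> Basis" for b z v
    using has_derivative_unique[OF smoothD[OF smpar that(1)] bounded_linear_imp_has_derivative[OF
        bounded_linear_compose[OF bounded_linear_inner_left bl_par]]] that(2)
    by metis
  let ?indep = "\<lambda>z. \<forall>\<alpha>. (\<Sum>i\<in>I. \<alpha> i *\<^sub>R grad (w i) z) = 0 \<longrightarrow> (\<forall>i\<in>I. \<alpha> i = 0)"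
  let ?crit = "\<lambda>z. \<exists>l \<alpha>. l \<noteq> 0 \<and>
      (\<Sum>b\<in>Basis. (l \<bullet> b) *\<^sub>R grad (\<lambda>x. par x \<bullet> b) z) = (\<Sum>i\<in>I. \<alpha> i *\<^sub>R grad (w i) z)"
  define N where "N = par ` {z \<in> V. (\<forall>i\<in>I. w i z = 0) \<and> ?indep z \<and> ?crit z}"
  have neg: "negligible N"
    unfolding N_def
    by (rule sard_on_constraint_set) (use oV smw smpar in \<open>auto simp: I_def\<close>)
  have solvable: "\<exists>a b. \<forall>k\<in>{1..s}. \<forall>j. u k $ j = grad (G k A j) (x k) \<bullet> a k + b $ j"
    if AN: "A \<notin> N" and xD: "\<forall>k\<in>{1..s}. x k \<in> D k"
      and ind: "\<forall>\<alpha>. (\<Sum>k\<in>{2..s}. \<alpha> k *\<^sub>R (h k (x k) - h 1 (x 1))) = 0 \<longrightarrow> (\<forall>k\<in>{2..s}. \<alpha> k = 0)"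
      and eq: "\<forall>k\<in>{1..s}. F (h k (x k)) + A *v h k (x k) = F (h 1 (x 1)) + A *v h 1 (x 1)"
    for A :: "real^'m^'l" and x and u :: "nat \<Rightarrow> real^'l"
  proof -
    define inv where "inv = inv_into {1..s} e"
    have inv: "inv (e k) = k" if "k \<in> {1..s}" for k
      unfolding inv_def by (rule inv_into_f_f[OF e that])
    define z where "z = (\<chi> r. case r of Inl (p, i) \<Rightarrow> x (inv p) $ i | Inr (j, i) \<Rightarrow> A $ j $ i)"
    have ptz: "pt k z = x k" if "k \<in> {1..s}" for k
      by (simp add: pt_def z_def vec_eq_iff inv[OF that])
    have parz: "par z = A" by (simp add: par_def z_def vec_eq_iff)
    have zV: "z \<in> V" using xD by (simp add: V_def ptz)
    have w0: "\<forall>i\<in>I. w i z = 0"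
    proof -
      have "w (k, j) z = 0" if "k \<in> {2..s}" for k j
        using eq[rule_format, of k] that s
        by (simp add: w_def H_def G_def parz ptz del: vector_add_component)
      then show ?thesis by (auto simp: I_def)
    qed
    define d where "d k = h k (x k) - h 1 (x 1)" for k
    have gw: "grad (w (k, j)) z \<bullet> v = grad (G k A j) (x k) \<bullet> pt k v
      - grad (G 1 A j) (x 1) \<bullet> pt 1 v + (par v *v d k) $ j" if "k \<in> {2..s}" for k j v
      using gradw[OF that zV] that s by (simp add: parz ptz d_def)
    have sumI: "(\<Sum>i\<in>I. f i) = (\<Sum>k\<in>{2..s}. \<Sum>j\<in>UNIV. f (k, j))" for f :: "nat \<times> 'l \<Rightarrow> 'z::comm_monoid_add"
      unfolding I_def by (simp add: sum.cartesian_product)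
    \<comment> \<open>Independence of the equations is visible in the matrix directions alone.\<close>
    have indep_matrix: "\<forall>i\<in>I. \<alpha> i = 0"
      if M: "\<And>B :: real^'m^'l. (\<Sum>k\<in>{2..s}. \<Sum>j\<in>UNIV. \<alpha> (k, j) * (B *v d k) $ j) = 0" for \<alpha>
    proof -
      have "(\<Sum>k\<in>{2..s}. \<alpha> (k, j) *\<^sub>R d k) = 0" for j
      proof -
        have "(\<Sum>k\<in>{2..s}. \<alpha> (k, j) * d k $ i) = 0" for i
        proof -
          have "((axis j (axis i 1) :: real^'m^'l) *v d k) $ j' = (if j' = j then d k $ i else 0)" for k j'
            by (simp add: matrix_vector_mult_def axis_def if_distrib[of "\<lambda>t. t $ _"]
                if_distrib[of "\<lambda>t. t * _"] cong: if_cong)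
          then show ?thesis
            using M[of "axis j (axis i 1)"] by (simp add: if_distrib[of "\<lambda>t. _ * t"] cong: if_cong)
        qed
        then show ?thesis by (simp add: vec_eq_iff)
      qed
      then have "\<forall>k\<in>{2..s}. \<alpha> (k, j) = 0" for j
        using ind[unfolded d_def[symmetric], rule_format, of "\<lambda>k. \<alpha> (k, j)"] by blast
      then show ?thesis by (auto simp: I_def)
    qed
    have zi: "?indep z"
    proof (intro allI impI)
      fix \<alpha> assume 0: "(\<Sum>i\<in>I. \<alpha> i *\<^sub>R grad (w i) z) = 0"
      show "\<forall>i\<in>I. \<alpha> i = 0"
      proof (rule indep_matrix)
        fix B :: "real^'m^'l"
        define v where "v = (\<chi> r. case r of Inl (p :: 'm option, i :: 'n) \<Rightarrow> 0 | Inr (j, i) \<Rightarrow> B $ j $ i)"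
        have v: "pt k v = 0" "par v = B" for k by (simp_all add: pt_def par_def v_def vec_eq_iff)
        have "0 = (\<Sum>i\<in>I. \<alpha> i *\<^sub>R grad (w i) z) \<bullet> v" using 0 by simp
        also have "\<dots> = (\<Sum>k\<in>{2..s}. \<Sum>j\<in>UNIV. \<alpha> (k, j) * (B *v d k) $ j)"
          unfolding inner_sum_left sumI by (intro sum.cong refl) (simp add: gw v)
        finally show "(\<Sum>k\<in>{2..s}. \<Sum>j\<in>UNIV. \<alpha> (k, j) * (B *v d k) $ j) = 0" by simp
      qed
    qed
    have nc: "\<not> ?crit z"
    proof
      assume c: "?crit z"
      have "par z \<in> N"
        unfolding N_def by (intro imageI CollectI conjI zV w0 zi c)
      then show False using AN parz by simp
    qed
    have no_cov: "\<forall>k\<in>{1..s}. l k = 0" if l0: "(\<Sum>k\<in>{1..s}. l k) = 0"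
      and lG: "\<And>k. k \<in> {1..s} \<Longrightarrow> (\<Sum>j\<in>UNIV. l k $ j *\<^sub>R grad (G k A j) (x k)) = 0"
      for l :: "nat \<Rightarrow> real^'l"
    proof (rule ccontr)
      assume nz: "\<not> (\<forall>k\<in>{1..s}. l k = 0)"
      have split: "{1..s} = insert 1 {2..s}" using s by auto
      have l1: "l 1 = - (\<Sum>k\<in>{2..s}. l k)"
        using l0 unfolding split by (simp add: eq_neg_iff_add_eq_0)
      define \<alpha> where "\<alpha> = (\<lambda>(k, j). l k $ j)"
      \<comment> \<open>\<open>L\<close> is the matrix part of the combination of the equations with coefficients \<open>l\<close>.\<close>
      define L where "L = (\<chi> j i. \<Sum>k\<in>{2..s}. l k $ j * d k $ i)"
      have LB: "L \<bullet> B = (\<Sum>k\<in>{2..s}. \<Sum>j\<in>UNIV. \<alpha> (k, j) * (B *v d k) $ j)" for B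
      proof -
        have "L \<bullet> B = (\<Sum>j\<in>UNIV. \<Sum>i\<in>UNIV. \<Sum>k\<in>{2..s}. l k $ j * d k $ i * B $ j $ i)"
          by (simp add: L_def inner_vec_def sum_distrib_right)
        also have "\<dots> = (\<Sum>j\<in>UNIV. \<Sum>k\<in>{2..s}. \<Sum>i\<in>UNIV. l k $ j * d k $ i * B $ j $ i)"
          by (intro sum.cong refl sum.swap)
        also have "\<dots> = (\<Sum>k\<in>{2..s}. \<Sum>j\<in>UNIV. \<Sum>i\<in>UNIV. l k $ j * d k $ i * B $ j $ i)"
          by (rule sum.swap)
        finally show ?thesis
          by (simp add: \<alpha>_def matrix_vector_mult_def sum_distrib_left mult_ac)
      qed
      have "L \<noteq> 0"
      proof
        assume "L = 0"
        then have "\<forall>i\<in>I. \<alpha> i = 0" using LB by (intro indep_matrix) simp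
        then have "\<forall>k\<in>{2..s}. l k = 0" by (auto simp: I_def \<alpha>_def vec_eq_iff)
        then show False using nz l1 unfolding split by simp
      qed
      moreover have "(\<Sum>b\<in>Basis. (L \<bullet> b) *\<^sub>R grad (\<lambda>x. par x \<bullet> b) z) = (\<Sum>i\<in>I. \<alpha> i *\<^sub>R grad (w i) z)"
      proof -
        have "(\<Sum>b\<in>Basis. (L \<bullet> b) *\<^sub>R grad (\<lambda>x. par x \<bullet> b) z) \<bullet> v = (\<Sum>i\<in>I. \<alpha> i *\<^sub>R grad (w i) z) \<bullet> v" for v
        proof -
          let ?c = "\<lambda>j. grad (G 1 A j) (x 1) \<bullet> pt 1 v"
          have z1: "(\<Sum>j\<in>UNIV. l k $ j * (grad (G k A j) (x k) \<bullet> pt k v)) = 0" if "k \<in> {1..s}" for k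
            using arg_cong[OF lG[OF that], of "\<lambda>y. y \<bullet> pt k v"] by (simp add: inner_sum_left)
          have "(\<Sum>k\<in>{2..s}. \<Sum>j\<in>UNIV. l k $ j * ?c j) = (\<Sum>j\<in>UNIV. (\<Sum>k\<in>{2..s}. l k) $ j * ?c j)"
            by (subst sum.swap) (simp add: sum_distrib_right)
          also have "\<dots> = - (\<Sum>j\<in>UNIV. l 1 $ j * ?c j)"
            using l1 by (simp add: sum_negf)
          also have "\<dots> = 0" using z1[of 1] s by simp
          finally have z2: "(\<Sum>k\<in>{2..s}. \<Sum>j\<in>UNIV. l k $ j * ?c j) = 0" .
          have "(\<Sum>i\<in>I. \<alpha> i *\<^sub>R grad (w i) z) \<bullet> v
            = (\<Sum>k\<in>{2..s}. \<Sum>j\<in>UNIV. l k $ j * (grad (G k A j) (x k) \<bullet> pt k v)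
                - l k $ j * ?c j + \<alpha> (k, j) * (par v *v d k) $ j)"
            unfolding inner_sum_left sumI
            by (intro sum.cong refl) (simp add: gw \<alpha>_def algebra_simps)
          also have "\<dots> = (\<Sum>k\<in>{2..s}. \<Sum>j\<in>UNIV. l k $ j * (grad (G k A j) (x k) \<bullet> pt k v))
              - (\<Sum>k\<in>{2..s}. \<Sum>j\<in>UNIV. l k $ j * ?c j) + L \<bullet> par v"
            by (simp only: LB sum.distrib sum_subtractf)
          also have "\<dots> = L \<bullet> par v" using z1 z2 by simp
          also have "\<dots> = (\<Sum>b\<in>Basis. (L \<bullet> b) * (par v \<bullet> b))" by (rule euclidean_inner)
          also have "\<dots> = (\<Sum>b\<in>Basis. (L \<bullet> b) *\<^sub>R grad (\<lambda>x. par x \<bullet> b) z) \<bullet> v"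
            by (simp add: inner_sum_left gradpar[OF zV])
          finally show ?thesis by simp
        qed
        then show ?thesis using vector_eq_rdot by blast
      qed
      ultimately show False using nc by blast
    qed
    have "\<exists>a b. \<forall>p\<in>e ` {1..s}. \<forall>j. u (inv p) $ j = grad (G (inv p) A j) (x (inv p)) \<bullet> a p + b $ j"
    proof (rule solvable_if_no_covector)
      fix l :: "'m option \<Rightarrow> real^'l"
      assume 0: "(\<Sum>p\<in>e ` {1..s}. l p) = 0"
        and 1: "\<And>p. p \<in> e ` {1..s} \<Longrightarrow> (\<Sum>j\<in>UNIV. l p $ j *\<^sub>R grad (G (inv p) A j) (x (inv p))) = 0"
      have "\<forall>k\<in>{1..s}. l (e k) = 0"
      proof (rule no_cov)
        show "(\<Sum>k\<in>{1..s}. l (e k)) = 0" using 0 unfolding sum.reindex[OF e] by (simp add: o_def)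
        show "(\<Sum>j\<in>UNIV. l (e k) $ j *\<^sub>R grad (G k A j) (x k)) = 0" if "k \<in> {1..s}" for k
          using 1[of "e k"] that by (simp add: inv)
      qed
      then show "\<forall>p\<in>e ` {1..s}. l p = 0" by blast
    qed
    then obtain a b where "\<forall>p\<in>e ` {1..s}. \<forall>j. u (inv p) $ j = grad (G (inv p) A j) (x (inv p)) \<bullet> a p + b $ j"
      by blast
    then show ?thesis
      by (intro exI[of _ "\<lambda>k. a (e k)"] exI[of _ b]) (simp add: inv)
  qed
  show ?thesis
    by (intro exI[of _ N] conjI neg allI impI, rule solvable[unfolded G_def])
qed

section \<open>Iterated coordinate derivatives and Frechet derivatives\<close>

text \<open>Moving from \<open>x\<close> to \<open>y\<close> one coordinate at a time, the mean value theorem compares each step with the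
partial derivative at \<open>x\<close>.\<close>

lemma has_derivative_if_continuous_partials:
  fixes H :: "real^'n::finite \<Rightarrow> real" and p :: "'n \<Rightarrow> real^'n \<Rightarrow> real"
  assumes V: "open V" and cont: "\<And>i. continuous_on V (p i)"
    and p: "\<And>x i. x \<in> V \<Longrightarrow> ((\<lambda>t. H (x + t *\<^sub>R axis i 1)) has_real_derivative p i x) (at 0)"
    and x: "x \<in> V"
  shows "(H has_derivative (\<lambda>v. \<Sum>i\<in>UNIV. p i x * v $ i)) (at x)"
  unfolding has_derivative_at_alt
proof (intro conjI allI impI)
  show "bounded_linear (\<lambda>v. \<Sum>i\<in>UNIV. p i x * v $ i)"
    by (intro bounded_linear_sum bounded_linear_const_mult bounded_linear_vec_nth)
next
  fix e :: real assume e: "e > 0"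
  define e' where "e' = e / real CARD('n)"
  have e': "e' > 0" using e by (simp add: e'_def)
  have "\<exists>d>0. \<forall>y. dist y x < d \<longrightarrow> y \<in> V \<and> \<bar>p i y - p i x\<bar> \<le> e'" for i
  proof -
    have "continuous (at x) (p i)"
      using cont V x by (simp add: continuous_on_eq_continuous_at)
    then obtain d1 where d1: "d1 > 0" "\<And>y. dist y x < d1 \<Longrightarrow> dist (p i y) (p i x) < e'"
      using e' unfolding continuous_at_eps_delta by blast
    obtain d2 where d2: "d2 > 0" "\<And>y. dist y x < d2 \<Longrightarrow> y \<in> V"
      using V x unfolding open_dist by blast
    show ?thesis
      using d1 d2 by (intro exI[of _ "min d1 d2"]) (auto simp: dist_real_def intro: less_imp_le)
  qed
  then obtain \<delta> where \<delta>: "\<And>i. \<delta> i > 0"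
    "\<And>i y. dist y x < \<delta> i \<Longrightarrow> y \<in> V \<and> \<bar>p i y - p i x\<bar> \<le> e'"
    by metis
  define d where "d = Min (range \<delta>)"
  have d: "d > 0" "\<And>i. d \<le> \<delta> i" using \<delta>(1) by (auto simp: d_def)
  have near: "y \<in> V" "\<bar>p i y - p i x\<bar> \<le> e'" if "norm (y - x) < d" for y i
    using \<delta>(2)[of y i] d(2)[of i] that by (auto simp: dist_norm)
  show "\<exists>d>0. \<forall>y. norm (y - x) < d \<longrightarrow>
      norm (H y - H x - (\<Sum>i\<in>UNIV. p i x * (y - x) $ i)) \<le> e * norm (y - x)"
  proof (intro exI conjI allI impI)
    show "d > 0" by (rule d)
    fix y assume y: "norm (y - x) < d"
    define v where "v = y - x"
    define part where "part S = (\<chi> i. if i \<in> S then v $ i else 0)" for S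
    have "\<bar>H (x + part S) - H x - (\<Sum>i\<in>S. p i x * v $ i)\<bar> \<le> real (card S) * e' * norm v" for S
    proof (induction S rule: infinite_finite_induct)
      case (insert i S)
      define z where "z r = x + part S + (r * v $ i) *\<^sub>R axis i 1" for r
      have z01: "z 0 = x + part S" "z 1 = x + part (insert i S)"
        using insert.hyps by (auto simp: z_def part_def vec_eq_iff axis_def)
      have zd: "norm (z r - x) < d" if "0 \<le> r" "r \<le> 1" for r
      proof -
        have "norm (z r - x) \<le> norm v"
          using that insert.hyps
          by (intro norm_le_componentwise_cart)
            (auto simp: z_def part_def axis_def abs_mult mult_left_le_one_le)
        then show ?thesis using y by (simp add: v_def)
      qed
      have der: "((\<lambda>r. H (z r)) has_real_derivative v $ i * p i (z r)) (at r)"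
        if "0 \<le> r" "r \<le> 1" for r
      proof -
        have 1: "((\<lambda>t. H (z r + t *\<^sub>R axis i 1)) has_real_derivative p i (z r)) (at ((r - r) * v $ i))"
          using p[OF near(1)[OF zd[OF that]], of i] by simp
        have 2: "((\<lambda>r'. (r' - r) * v $ i) has_real_derivative v $ i) (at r)"
          by (auto intro!: derivative_eq_intros)
        have "((\<lambda>r'. H (z r + ((r' - r) * v $ i) *\<^sub>R axis i 1)) has_real_derivative p i (z r) * v $ i) (at r)"
          by (rule DERIV_chain2[OF 1 2])
        moreover have "z r + ((r' - r) * v $ i) *\<^sub>R axis i 1 = z r'" for r'
          by (simp add: z_def algebra_simps)
        ultimately show ?thesis by (simp add: mult.commute)
      qed
      obtain r where r: "0 < r" "r < 1" and eq: "H (z 1) - H (z 0) = (1 - 0) * (v $ i * p i (z r))"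
        using MVT2[of 0 1 "\<lambda>r. H (z r)" "\<lambda>r. v $ i * p i (z r)"] der by auto
      have "\<bar>H (z 1) - H (z 0) - p i x * v $ i\<bar> = \<bar>p i (z r) - p i x\<bar> * \<bar>v $ i\<bar>"
        unfolding eq by (simp add: abs_mult[symmetric] algebra_simps)
      also have "\<dots> \<le> e' * norm v"
        using near(2)[OF zd] r e' by (intro mult_mono component_le_norm_cart) auto
      finally have "\<bar>H (z 1) - H (z 0) - p i x * v $ i\<bar> \<le> e' * norm v" .
      then show ?case
        using insert.IH insert.hyps unfolding z01 by (simp add: algebra_simps)
    qed (simp_all add: part_def zero_vec_def[symmetric])
    from this[of UNIV] have "\<bar>H (x + v) - H x - (\<Sum>i\<in>UNIV. p i x * v $ i)\<bar> \<le> e * norm v"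
      by (simp add: part_def e'_def)
    then show "norm (H y - H x - (\<Sum>i\<in>UNIV. p i x * (y - x) $ i)) \<le> e * norm (y - x)"
      by (simp add: v_def)
  qed
qed

lemma openin_powertop_UNIV: "openin (powertop_real UNIV) V \<longleftrightarrow> open V"
  by (simp add: euclidean_product_topology)

lemma continuous_map_powertop_UNIV:
  "continuous_map (subtopology (powertop_real UNIV) V) euclideanreal h \<longleftrightarrow> continuous_on V h"
  by (simp add: euclidean_product_topology)

lemma continuous_on_vec_nth: "continuous_on S (($) :: real^'n \<Rightarrow> 'n \<Rightarrow> real)"
  by (intro continuous_on_coordinatewise_then_product continuous_intros)

lemma open_vec_vimage: "open V \<Longrightarrow> open {x :: real^'n. ($) x \<in> V}"
  using open_vimage[OF _ continuous_on_vec_nth, of V] by (simp add: vimage_def)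

lemma C_k_on_imp_cdiff:
  fixes h :: "('n::finite \<Rightarrow> real) \<Rightarrow> real"
  assumes V: "open V" and "C_k_on UNIV V k h"
  shows "cdiff k {x. ($) x \<in> V} (\<lambda>x. h (($) x))"
  using assms(2)
proof (induction k arbitrary: h)
  case 0
  then have "continuous_on V h" by (simp add: continuous_map_powertop_UNIV)
  then show ?case
    using continuous_on_compose2[OF _ continuous_on_vec_nth, of V h "{x. ($) x \<in> V}"] by auto
next
  case (Suc k)
  let ?V = "{x :: real^'n. ($) x \<in> V}"
  have IH: "cdiff k ?V (\<lambda>x. partial_deriv i h (($) x))" for i
    using Suc by simp
  show ?case
  proof (rule cdiff_SucI[OF open_vec_vimage[OF V]])
    fix x assume x: "x \<in> ?V"
    show "((\<lambda>x. h (($) x)) has_derivative (\<lambda>v. \<Sum>i\<in>UNIV. partial_deriv i h (($) x) * v $ i)) (at x)"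
    proof (rule has_derivative_if_continuous_partials[OF open_vec_vimage[OF V] cdiff_continuous_on[OF IH] _ x])
      fix x i assume x: "x \<in> ?V"
      have "(\<lambda>t. h ((($) x)(i := t))) field_differentiable at (x $ i)"
        using Suc.prems x by auto
      then have "((\<lambda>t. h ((($) x)(i := t))) has_real_derivative partial_deriv i h (($) x)) (at (x $ i))"
        unfolding partial_deriv_def using DERIV_deriv_iff_field_differentiable by blast
      then have "((\<lambda>t. h ((($) x)(i := x $ i + t))) has_real_derivative partial_deriv i h (($) x)) (at 0)"
        using DERIV_at_within_shift[of "\<lambda>t. h ((($) x)(i := t))" _ "x $ i" 0 UNIV] by simp
      moreover have "(($) x)(i := x $ i + t) = ($) (x + t *\<^sub>R axis i 1)" for t
        by (auto simp: axis_def fun_eq_iff)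
      ultimately show "((\<lambda>t. h (($) (x + t *\<^sub>R axis i 1))) has_real_derivative partial_deriv i h (($) x)) (at 0)"
        by simp
    qed
  next
    fix i :: 'n
    show "cdiff k ?V (\<lambda>x. \<Sum>j\<in>UNIV. partial_deriv j h (($) x) * axis i 1 $ j)"
      by (intro cdiff_sum cdiff_mult cdiff_const open_vec_vimage V IH)
  qed
qed

lemma C_infinity_on_imp_smooth:
  fixes h :: "('n::finite \<Rightarrow> real) \<Rightarrow> real"
  assumes "open V" "C_infinity_on UNIV V h"
  shows "smooth {x. ($) x \<in> V} (\<lambda>x. h (($) x))"
  using assms C_k_on_imp_cdiff by (auto simp: smooth_def C_infinity_on_def)

lemma continuous_on_fun_upd: "continuous_on S (\<lambda>t. x(i := t :: real))"
proof (rule continuous_on_coordinatewise_then_product)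
  show "continuous_on S (\<lambda>t. (x(i := t)) j)" for j
    by (cases "j = i") (auto intro: continuous_intros)
qed

lemma C_k_on_cong:
  fixes f g :: "('n::finite \<Rightarrow> real) \<Rightarrow> real"
  assumes W: "open W" and "\<And>x. x \<in> W \<Longrightarrow> f x = g x"
  shows "C_k_on UNIV W k f \<longleftrightarrow> C_k_on UNIV W k g"
  using assms(2)
proof (induction k arbitrary: f g)
  case 0
  then show ?case by (simp add: continuous_map_powertop_UNIV cong: continuous_on_cong)
next
  case (Suc k)
  have ev: "\<forall>\<^sub>F t in nhds (x i). f (x(i := t)) = g (x(i := t))" if x: "x \<in> W" for x i
  proof -
    have "open ((\<lambda>t. x(i := t)) -` W)" by (intro open_vimage W continuous_on_fun_upd)
    then show ?thesis
      using x Suc.prems by (auto simp: eventually_nhds intro!: exI[of _ "(\<lambda>t. x(i := t)) -` W"])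
  qed
  have D: "((\<lambda>t. f (x(i := t))) has_field_derivative c) (at (x i)) \<longleftrightarrow>
      ((\<lambda>t. g (x(i := t))) has_field_derivative c) (at (x i))" if x: "x \<in> W" for x i c
    using ev[OF x] by (intro DERIV_cong_ev) auto
  have "partial_deriv i f x = partial_deriv i g x" if x: "x \<in> W" for x i
    unfolding partial_deriv_def deriv_def D[OF x] ..
  then have "C_k_on UNIV W k (partial_deriv i f) \<longleftrightarrow> C_k_on UNIV W k (partial_deriv i g)" for i
    by (intro Suc.IH) blast
  then show ?case
    using Suc.prems D by (simp add: continuous_map_powertop_UNIV field_differentiable_def cong: continuous_on_cong)
qed

text \<open>All curves that have to be shown smooth are straight lines in some chart, so smoothness of a
restriction to a line is the only instance of the converse of \<open>C_infinity_on_imp_smooth\<close> that matters.\<close>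

lemma C_infinity_on_line:
  fixes h :: "real^'n::finite \<Rightarrow> real" and W :: "(unit \<Rightarrow> real) set"
  assumes V: "open V" and h: "smooth V h" and W: "open W" and in_V: "\<And>y. y \<in> W \<Longrightarrow> x0 + y () *\<^sub>R a \<in> V"
  shows "C_infinity_on UNIV W (\<lambda>y. h (x0 + y () *\<^sub>R a))"
  unfolding C_infinity_on_def
proof
  fix k
  have cont: "continuous_on W (\<lambda>y. h (x0 + y () *\<^sub>R a))" if "smooth V h" for h
    by (rule continuous_on_compose2[OF smooth_continuous_on[OF that]])
      (use in_V in \<open>auto intro!: continuous_intros continuous_on_product_coordinates[THEN continuous_on_subset]\<close>)
  show "C_k_on UNIV W k (\<lambda>y. h (x0 + y () *\<^sub>R a))"
    using h
  proof (induction k arbitrary: h)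
    case 0
    then show ?case using cont by (simp add: continuous_map_powertop_UNIV)
  next
    case (Suc k)
    let ?h' = "\<lambda>x. \<Sum>i\<in>UNIV. partial i h x * a $ i"
    have h': "smooth V ?h'"
      by (intro smooth_sum smooth_mult smooth_const smooth_partial V Suc.prems)
    have D: "((\<lambda>t. h (x0 + (y(i := t)) () *\<^sub>R a)) has_real_derivative ?h' (x0 + y () *\<^sub>R a)) (at (y i))"
      if y: "y \<in> W" for y :: "unit \<Rightarrow> real" and i
    proof -
      have [simp]: "i = ()" by simp
      have "((\<lambda>t. h (x0 + t *\<^sub>R a)) has_derivative (\<lambda>r. grad h (x0 + y () *\<^sub>R a) \<bullet> (r *\<^sub>R a))) (at (y ()))"
        by (rule has_derivative_compose[where f = "\<lambda>t. x0 + t *\<^sub>R a" and g = h,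
              OF _ smoothD[OF Suc.prems in_V[OF y]]])
          (auto intro!: derivative_eq_intros)
      then have "((\<lambda>t. h (x0 + t *\<^sub>R a)) has_derivative (\<lambda>r. r * ?h' (x0 + y () *\<^sub>R a))) (at (y ()))"
        by (simp add: grad_def inner_vec_def sum_distrib_left mult.left_commute)
      then show ?thesis by (simp add: has_field_derivative_def mult_commute_abs)
    qed
    have "partial_deriv i (\<lambda>y. h (x0 + y () *\<^sub>R a)) y = ?h' (x0 + y () *\<^sub>R a)" if "y \<in> W" for y i
      unfolding partial_deriv_def by (rule DERIV_imp_deriv[OF D[OF that]])
    then have "C_k_on UNIV W k (partial_deriv i (\<lambda>y. h (x0 + y () *\<^sub>R a)))" for i
      using C_k_on_cong[OF W, of "partial_deriv i (\<lambda>y. h (x0 + y () *\<^sub>R a))"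
          "\<lambda>y. ?h' (x0 + y () *\<^sub>R a)"] Suc.IH[OF h'] by blast
    then show ?case
      using cont[OF Suc.prems] D by (auto simp: continuous_map_powertop_UNIV field_differentiable_def)
  qed
qed

section \<open>Smooth curves\<close>

lemma open_curve_preimage:
  assumes "continuous_map (subtopology euclideanreal {-e<..<e}) X \<gamma>" "openin X W"
  shows "open {t. t \<in> {-e<..<e} \<and> \<gamma> t \<in> W}"
proof -
  have "openin (subtopology euclideanreal {-e<..<e}) {t \<in> topspace (subtopology euclideanreal {-e<..<e}). \<gamma> t \<in> W}"
    by (rule openin_continuous_map_preimage[OF assms])
  then show ?thesis by (simp add: openin_open_subtopology)
qed

lemma smooth_curveI:
  assumes "continuous_map (subtopology euclideanreal {-e<..<e}) (top_of M) \<gamma>"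
    and "\<And>W \<Psi> j. (W, \<Psi>) \<in> atlas M \<Longrightarrow> j \<in> coords M \<Longrightarrow>
      C_infinity_on UNIV {y::unit \<Rightarrow> real. y () \<in> {-e<..<e} \<and> \<gamma> (y ()) \<in> W} (\<lambda>y. \<Psi> (\<gamma> (y ())) j)"
    and "\<And>W \<Psi>. (W, \<Psi>) \<in> atlas M \<Longrightarrow> openin (top_of M) W"
  shows "smooth_map (open_submanifold real_line {-e<..<e}) M \<gamma>"
proof -
  have img: "(\<lambda>t (_::unit). t) ` ({-e<..<e} \<inter> \<gamma> -` W) = {y. y () \<in> {-e<..<e} \<and> \<gamma> (y ()) \<in> W}" for W
  proof (intro set_eqI iffI)
    fix y :: "unit \<Rightarrow> real" assume "y \<in> {y. y () \<in> {-e<..<e} \<and> \<gamma> (y ()) \<in> W}"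
    then have "y () \<in> {-e<..<e} \<inter> \<gamma> -` W" "y = (\<lambda>_. y ())" by (auto simp: fun_eq_iff)
    then show "y \<in> (\<lambda>t (_::unit). t) ` ({-e<..<e} \<inter> \<gamma> -` W)" by blast
  qed auto
  have inv: "inv_into {-e<..<e} (\<lambda>t (_::unit). t) y = y ()" if "y () \<in> {-e<..<e}" for y
  proof -
    have "inv_into {-e<..<e} (\<lambda>t (_::unit). t) (\<lambda>_. y ()) = y ()"
      by (rule inv_into_f_f) (use that in \<open>auto simp: inj_on_def fun_eq_iff\<close>)
    moreover have "(\<lambda>_. y ()) = y" by (auto simp: fun_eq_iff)
    ultimately show ?thesis by simp
  qed
  have "C_infinity_on UNIV {y::unit \<Rightarrow> real. y () \<in> {-e<..<e} \<and> \<gamma> (y ()) \<in> W}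
      (\<lambda>y. \<Psi> (\<gamma> (inv_into {-e<..<e} (\<lambda>t (_::unit). t) y)) j)"
    if W: "(W, \<Psi>) \<in> atlas M" and j: "j \<in> coords M" for W \<Psi> j
  proof -
    have "open {t. t \<in> {-e<..<e} \<and> \<gamma> t \<in> W}"
      by (rule open_curve_preimage[OF assms(1) assms(3)[OF W]])
    then have "open ((\<lambda>y::unit \<Rightarrow> real. y ()) -` {t. t \<in> {-e<..<e} \<and> \<gamma> t \<in> W})"
      by (intro open_vimage continuous_on_product_coordinates)
    then have o: "open {y::unit \<Rightarrow> real. y () \<in> {-e<..<e} \<and> \<gamma> (y ()) \<in> W}"
      by (simp add: vimage_def)
    show ?thesis
      using assms(2)[OF W j] C_k_on_cong[OF o, of "\<lambda>y. \<Psi> (\<gamma> (y ())) j"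
          "\<lambda>y. \<Psi> (\<gamma> (inv_into {-e<..<e} (\<lambda>t (_::unit). t) y)) j"]
      by (auto simp: C_infinity_on_def inv)
  qed
  then show ?thesis
    using assms(1) by (auto simp: smooth_map_def open_submanifold_def real_line_def img)
qed

lemma smooth_curveD:
  assumes "smooth_map (open_submanifold real_line {-e<..<e}) M \<gamma>" "e > 0"
  shows smooth_curve_continuous: "continuous_map (subtopology euclideanreal {-e<..<e}) (top_of M) \<gamma>"
    and smooth_curve_differentiable: "(W, \<Psi>) \<in> atlas M \<Longrightarrow> openin (top_of M) W \<Longrightarrow> \<gamma> 0 \<in> W \<Longrightarrow>
      j \<in> coords M \<Longrightarrow> (\<lambda>t. \<Psi> (\<gamma> t) j) field_differentiable (at 0)"
proof -
  show c: "continuous_map (subtopology euclideanreal {-e<..<e}) (top_of M) \<gamma>"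
    using assms(1) by (simp add: smooth_map_def open_submanifold_def real_line_def)
  assume W: "(W, \<Psi>) \<in> atlas M" "openin (top_of M) W" and 0: "\<gamma> 0 \<in> W" and j: "j \<in> coords M"
  let ?E = "{-e<..<e}" and ?c = "\<lambda>t (_::unit). t"
  let ?h = "\<lambda>x. \<Psi> (\<gamma> (inv_into ?E ?c x)) j"
  have "C_infinity_on UNIV (?c ` (?E \<inter> \<gamma> -` W)) ?h"
    using assms(1) W(1) j by (fastforce simp: smooth_map_def open_submanifold_def real_line_def)
  then have "C_k_on UNIV (?c ` (?E \<inter> \<gamma> -` W)) (Suc 0) ?h"
    unfolding C_infinity_on_def by blast
  moreover have "?c 0 \<in> ?c ` (?E \<inter> \<gamma> -` W)" using 0 assms(2) by auto
  ultimately have "(\<lambda>t. ?h ((?c 0)(() := t))) field_differentiable at (?c 0 ())"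
    unfolding C_k_on.simps by blast
  then have d: "(\<lambda>t. ?h (?c t)) field_differentiable at 0"
    by (simp add: fun_upd_def)
  have inv: "inv_into ?E ?c (?c t) = t" if "t \<in> ?E" for t
    by (rule inv_into_f_f) (use that in \<open>auto simp: inj_on_def fun_eq_iff\<close>)
  have "\<forall>\<^sub>F t in nhds 0. ?h (?c t) = \<Psi> (\<gamma> t) j"
    unfolding eventually_nhds using assms(2) inv by (intro exI[of _ ?E]) auto
  then have "((\<lambda>t. ?h (?c t)) has_field_derivative D) (at 0) \<longleftrightarrow>
      ((\<lambda>t. \<Psi> (\<gamma> t) j) has_field_derivative D) (at 0)" for D
    by (intro DERIV_cong_ev) auto
  then show "(\<lambda>t. \<Psi> (\<gamma> t) j) field_differentiable (at 0)"
    using d by (simp add: field_differentiable_def)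
qed

section \<open>Tangent vectors of a power of Euclidean space\<close>

text \<open>The shape of every tangent vector of a power of Euclidean space: its atlas has a single chart, and
the vector is given by the velocities \<open>a k\<close> of the components there.\<close>

definition power_tangent :: "nat \<Rightarrow> (nat \<Rightarrow> real^'l) \<Rightarrow>
    ((nat \<Rightarrow> real^'l) set \<times> ((nat \<Rightarrow> real^'l) \<Rightarrow> nat \<times> 'l \<Rightarrow> real)) \<Rightarrow> nat \<times> 'l::finite \<Rightarrow> real"
  where "power_tangent s a = (\<lambda>c i.
    if c \<in> atlas (power_manifold Euclid s) \<and> i \<in> {1..s} \<times> UNIV then a (fst i) $ snd i else 0)"

lemma power_tangent_add:
  "(\<lambda>c i. power_tangent s a c i + power_tangent s b c i) = power_tangent s (\<lambda>k. a k + b k)"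
  by (auto simp: power_tangent_def fun_eq_iff)

lemma coords_power_Euclid: "coords (power_manifold (Euclid :: (real^'l::finite, 'l) smooth_space) s) = {1..s} \<times> UNIV"
  by (simp add: power_manifold_def Euclid_def)

lemma top_power_Euclid:
  "top_of (power_manifold (Euclid :: (real^'l::finite, 'l) smooth_space) s) = product_topology (\<lambda>_. euclidean) {1..s}"
  by (simp add: power_manifold_def Euclid_def)

lemma atlas_power_EuclidD:
  fixes c :: "(nat \<Rightarrow> real^'l) set \<times> ((nat \<Rightarrow> real^'l) \<Rightarrow> nat \<times> 'l::finite \<Rightarrow> real)"
  assumes "c \<in> atlas (power_manifold Euclid s)"
  shows "fst c = PiE {1..s} (\<lambda>_. UNIV)" "k \<in> {1..s} \<Longrightarrow> snd c q (k, j) = q k $ j"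
proof -
  obtain c' :: "nat \<Rightarrow> (real^'l) set \<times> (real^'l \<Rightarrow> 'l \<Rightarrow> real)"
    where c: "c = (PiE {1..s} (\<lambda>k. fst (c' k)), \<lambda>q. restrict (\<lambda>(k, i). snd (c' k) (q k) i) ({1..s} \<times> UNIV))"
      and c': "\<And>k. k \<in> {1..s} \<Longrightarrow> c' k = (UNIV, \<lambda>x i. x $ i)"
    using assms by (auto simp: power_manifold_def Euclid_def)
  show "fst c = PiE {1..s} (\<lambda>_. UNIV)" unfolding c using c' by (auto simp: PiE_iff)
  show "k \<in> {1..s} \<Longrightarrow> snd c q (k, j) = q k $ j" unfolding c using c' by simp
qed

lemma velocity_power_Euclid:
  fixes \<gamma> :: "real \<Rightarrow> nat \<Rightarrow> real^'l::finite"
  assumes "\<gamma> 0 \<in> extensional {1..s}"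
  shows "velocity (power_manifold Euclid s) \<gamma> = power_tangent s (\<lambda>k. \<chi> j. deriv (\<lambda>t. \<gamma> t k $ j) 0)"
proof (intro ext)
  fix c :: "(nat \<Rightarrow> real^'l) set \<times> ((nat \<Rightarrow> real^'l) \<Rightarrow> nat \<times> 'l \<Rightarrow> real)" and i :: "nat \<times> 'l"
  obtain k j where i: "i = (k, j)" by (cases i)
  have "\<gamma> 0 \<in> fst c" if "c \<in> atlas (power_manifold Euclid s)"
    unfolding atlas_power_EuclidD(1)[OF that] using assms by (simp add: PiE_def)
  then show "velocity (power_manifold Euclid s) \<gamma> c i
      = power_tangent s (\<lambda>k. \<chi> j. deriv (\<lambda>t. \<gamma> t k $ j) 0) c i"
    by (auto simp: velocity_def power_tangent_def coords_power_Euclid i atlas_power_EuclidD(2))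
qed

lemma line_in_power_Euclid:
  fixes y a :: "nat \<Rightarrow> real^'l::finite"
  assumes y: "y \<in> extensional {1..s}"
  defines "\<gamma> \<equiv> \<lambda>t. \<lambda>k\<in>{1..s}. y k + t *\<^sub>R a k"
  shows "\<gamma> \<in> curves_at (power_manifold Euclid s) y"
    and "velocity (power_manifold Euclid s) \<gamma> = power_tangent s a"
proof -
  have \<gamma>0: "\<gamma> 0 = y" using y by (auto simp: \<gamma>_def extensional_def fun_eq_iff)
  have cont: "continuous_map (subtopology euclideanreal {-1<..<1}) (top_of (power_manifold Euclid s)) \<gamma>"
    unfolding top_power_Euclid continuous_map_componentwise
    by (auto simp: \<gamma>_def intro!: continuous_intros)
  have "smooth_map (open_submanifold real_line {-1<..<1}) (power_manifold Euclid s) \<gamma>"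
  proof (rule smooth_curveI[OF cont])
    fix W and \<Psi> :: "(nat \<Rightarrow> real^'l) \<Rightarrow> nat \<times> 'l \<Rightarrow> real" and j
    assume c: "(W, \<Psi>) \<in> atlas (power_manifold Euclid s)" and j: "j \<in> coords (power_manifold (Euclid :: (real^'l, 'l) smooth_space) s)"
    obtain k i where ki: "j = (k, i)" "k \<in> {1..s}" using j by (auto simp: coords_power_Euclid)
    have W: "W = PiE {1..s} (\<lambda>_. UNIV)" using atlas_power_EuclidD(1)[OF c] by simp
    have set: "{t. t \<in> {-1<..<1} \<and> \<gamma> t \<in> W} = {-1<..<1}" by (auto simp: W \<gamma>_def)
    have f: "\<Psi> (\<gamma> t) j = (y k + t *\<^sub>R a k) $ i" for t
      using atlas_power_EuclidD(2)[OF c ki(2), of "\<gamma> t" i] ki by (simp add: \<gamma>_def)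
    have o: "open ((\<lambda>y::unit \<Rightarrow> real. y ()) -` {-1<..<1})"
      by (intro open_vimage continuous_on_product_coordinates) simp
    have "C_infinity_on UNIV {y::unit \<Rightarrow> real. y () \<in> {-1<..<1}} (\<lambda>z. (y k + z () *\<^sub>R a k) $ i)"
      by (rule C_infinity_on_line[of UNIV "\<lambda>x. x $ i"]) (use o in \<open>auto simp: vimage_def intro: smooth_nth\<close>)
    moreover have "{z::unit \<Rightarrow> real. z () \<in> {-1<..<1} \<and> \<gamma> (z ()) \<in> W} = {z. z () \<in> {-1<..<1}}"
      using set by blast
    ultimately show "C_infinity_on UNIV {y::unit \<Rightarrow> real. y () \<in> {-1<..<1} \<and> \<gamma> (y ()) \<in> W} (\<lambda>y. \<Psi> (\<gamma> (y ())) j)"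
      by (simp only: f)
  next
    fix W and \<Psi> :: "(nat \<Rightarrow> real^'l) \<Rightarrow> nat \<times> 'l \<Rightarrow> real"
    assume c: "(W, \<Psi>) \<in> atlas (power_manifold Euclid s)"
    have "W = PiE {1..s} (\<lambda>_. UNIV)" using atlas_power_EuclidD(1)[OF c] by simp
    then show "openin (top_of (power_manifold (Euclid :: (real^'l, 'l) smooth_space) s)) W"
      by (simp add: top_power_Euclid openin_PiE)
  qed
  then show "\<gamma> \<in> curves_at (power_manifold Euclid s) y"
    using \<gamma>0 by (auto simp: curves_at_def intro!: exI[of _ 1])
  have "deriv (\<lambda>t. \<gamma> t k $ j) 0 = a k $ j" if "k \<in> {1..s}" for k j
    by (rule DERIV_imp_deriv) (use that in \<open>auto simp: \<gamma>_def intro!: derivative_eq_intros\<close>)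
  then have "power_tangent s (\<lambda>k. \<chi> j. deriv (\<lambda>t. \<gamma> t k $ j) 0) = power_tangent s a"
    by (auto simp: power_tangent_def fun_eq_iff)
  then show "velocity (power_manifold Euclid s) \<gamma> = power_tangent s a"
    using velocity_power_Euclid[of \<gamma> s] \<gamma>0 y by simp
qed

lemma tangent_space_power_Euclid:
  fixes y :: "nat \<Rightarrow> real^'l::finite"
  assumes "y \<in> extensional {1..s}"
  shows "tangent_space (power_manifold Euclid s) y = range (power_tangent s)"
proof
  show "tangent_space (power_manifold Euclid s) y \<subseteq> range (power_tangent s)"
    unfolding tangent_space_def
  proof (rule image_subsetI)
    fix \<gamma> assume "\<gamma> \<in> curves_at (power_manifold Euclid s) y"
    then have "\<gamma> 0 \<in> extensional {1..s}" using assms by (simp add: curves_at_def)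
    from velocity_power_Euclid[of \<gamma> s, OF this]
    show "velocity (power_manifold Euclid s) \<gamma> \<in> range (power_tangent s)" by simp
  qed
  show "range (power_tangent s) \<subseteq> tangent_space (power_manifold Euclid s) y"
  proof (rule image_subsetI)
    fix a :: "nat \<Rightarrow> real^'l"
    show "power_tangent s a \<in> tangent_space (power_manifold Euclid s) y"
      unfolding tangent_space_def
      by (rule image_eqI[where f = "velocity (power_manifold Euclid s)",
            OF line_in_power_Euclid(2)[OF assms, symmetric] line_in_power_Euclid(1)[OF assms]])
  qed
qed

lemma diagonal_tangent:
  fixes y :: "nat \<Rightarrow> real^'l::finite"
  assumes "y \<in> diagonal Euclid s"
  shows "power_tangent s (\<lambda>_. b) \<in> tangent_subspace (power_manifold Euclid s) (diagonal Euclid s) y"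
proof -
  obtain y0 where y: "y = (\<lambda>k\<in>{1..s}. y0)" using assms by (auto simp: diagonal_def)
  let ?\<gamma> = "\<lambda>t. \<lambda>k\<in>{1..s}. y k + t *\<^sub>R b"
  have "?\<gamma> t \<in> diagonal Euclid s" for t
    unfolding diagonal_def Euclid_def by (auto simp: y intro!: exI[of _ "y0 + t *\<^sub>R b"])
  moreover have "y \<in> extensional {1..s}" by (simp add: y)
  note line_in_power_Euclid[OF this, of "\<lambda>_. b"]
  ultimately show ?thesis
    unfolding tangent_subspace_def
    by (intro image_eqI[of _ _ ?\<gamma>]) (auto intro!: exI[of _ 1])
qed

section \<open>Charts of a manifold and of its powers\<close>

definition chart_domain :: "'a set \<times> ('a \<Rightarrow> 'n \<Rightarrow> real) \<Rightarrow> (real^'n) set"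
  where "chart_domain c = {x. ($) x \<in> snd c ` fst c}"

definition chart_inv :: "'a set \<times> ('a \<Rightarrow> 'n \<Rightarrow> real) \<Rightarrow> real^'n \<Rightarrow> 'a"
  where "chart_inv c x = inv_into (fst c) (snd c) (($) x)"

definition chart_vec :: "'a set \<times> ('a \<Rightarrow> 'n \<Rightarrow> real) \<Rightarrow> 'a \<Rightarrow> real^'n::finite"
  where "chart_vec c p = (\<chi> i. snd c p i)"

lemma nth_chart_vec: "($) (chart_vec c p) = snd c p"
  by (simp add: chart_vec_def fun_eq_iff)

lemma chart_inv_in: "x \<in> chart_domain c \<Longrightarrow> chart_inv c x \<in> fst c"
  unfolding chart_domain_def chart_inv_def by (auto intro: inv_into_into)

lemma chart_vec_chart_inv: "x \<in> chart_domain c \<Longrightarrow> snd c (chart_inv c x) i = x $ i"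
  unfolding chart_domain_def chart_inv_def by (simp add: f_inv_into_f)

lemma chart_vec_in: "p \<in> fst c \<Longrightarrow> chart_vec c p \<in> chart_domain c"
  by (simp add: chart_domain_def nth_chart_vec)

lemma distinct_power_simps:
  "top_of (distinct_power N s) =
    subtopology (product_topology (\<lambda>_. top_of N) {1..s}) (distinct_tuples (topspace (top_of N)) s)"
  "coords (distinct_power N s) = {1..s} \<times> coords N"
  by (simp_all add: distinct_power_def open_submanifold_def power_manifold_def)

lemma topspace_distinct_power:
  "topspace (top_of (distinct_power N s)) = distinct_tuples (topspace (top_of N)) s"
  by (auto simp: distinct_power_simps distinct_tuples_def)

definition power_chart ::
  "('a, 'i) smooth_space \<Rightarrow> nat \<Rightarrow> (nat \<Rightarrow> 'a set \<times> ('a \<Rightarrow> 'i \<Rightarrow> real)) \<Rightarrow>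
   (nat \<Rightarrow> 'a) set \<times> ((nat \<Rightarrow> 'a) \<Rightarrow> nat \<times> 'i \<Rightarrow> real)"
  where "power_chart N s c =
    (PiE {1..s} (\<lambda>k. fst (c k)) \<inter> distinct_tuples (topspace (top_of N)) s,
     \<lambda>q. restrict (\<lambda>(k, i). snd (c k) (q k) i) ({1..s} \<times> coords N))"

lemma atlas_distinct_power:
  "atlas (distinct_power N s) = power_chart N s ` {c. \<forall>k\<in>{1..s}. c k \<in> atlas N}"
  by (simp add: distinct_power_def open_submanifold_def power_manifold_def power_chart_def
      setcompr_eq_image image_image)

context
  fixes N :: "('a, 'n::finite) smooth_space"
  assumes manifold: "smooth_manifold N" and coords: "coords N = UNIV"
begin

lemma chart_open: "c \<in> atlas N \<Longrightarrow> openin (top_of N) (fst c)"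
  and chart_image_open: "c \<in> atlas N \<Longrightarrow> open (snd c ` fst c)"
  and chart_homeomorphic: "c \<in> atlas N \<Longrightarrow> homeomorphic_map (subtopology (top_of N) (fst c))
      (subtopology (powertop_real UNIV) (snd c ` fst c)) (snd c)"
  and chart_transition: "c \<in> atlas N \<Longrightarrow> c' \<in> atlas N \<Longrightarrow>
      C_infinity_on UNIV (snd c ` (fst c \<inter> fst c')) (\<lambda>x. snd c' (inv_into (fst c) (snd c) x) j)"
  using manifold unfolding smooth_manifold_def coords openin_powertop_UNIV
  by (force simp: case_prod_beta)+

lemma chart_subset: "c \<in> atlas N \<Longrightarrow> fst c \<subseteq> topspace (top_of N)"
  using chart_open openin_subset by blast

lemma chart_inj: "c \<in> atlas N \<Longrightarrow> inj_on (snd c) (fst c)"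
  using homeomorphic_imp_injective_map[OF chart_homeomorphic, of c] chart_subset[of c]
  by (simp add: Int_absorb1)

lemma chart_inv_chart_vec: "c \<in> atlas N \<Longrightarrow> p \<in> fst c \<Longrightarrow> chart_inv c (chart_vec c p) = p"
  using chart_inj by (simp add: chart_inv_def nth_chart_vec)

lemma open_chart_domain: "c \<in> atlas N \<Longrightarrow> open (chart_domain c)"
  unfolding chart_domain_def by (intro open_vec_vimage chart_image_open)

lemma continuous_map_inv_chart:
  assumes c: "c \<in> atlas N"
  shows "continuous_map (subtopology (powertop_real UNIV) (snd c ` fst c)) (top_of N) (inv_into (fst c) (snd c))"
proof -
  let ?X = "subtopology (top_of N) (fst c)" and ?Y = "subtopology (powertop_real UNIV) (snd c ` fst c)"
  obtain g where g: "homeomorphic_maps ?X ?Y (snd c) g"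
    using chart_homeomorphic[OF c] by (auto simp: homeomorphic_map_maps)
  have "continuous_map ?Y ?X (inv_into (fst c) (snd c))"
  proof (rule continuous_map_eq)
    show "continuous_map ?Y ?X g" using g by (simp add: homeomorphic_maps_def)
    fix y assume "y \<in> topspace ?Y"
    then obtain v where v: "v \<in> fst c" "y = snd c v" by auto
    then have "g y = v"
      using g chart_subset[OF c] by (auto simp: homeomorphic_maps_def)
    then show "g y = inv_into (fst c) (snd c) y" using v chart_inj[OF c] by simp
  qed
  then show ?thesis by (simp add: continuous_map_in_subtopology)
qed

lemma continuous_map_chart_inv:
  assumes c: "c \<in> atlas N"
  shows "continuous_map (subtopology euclidean (chart_domain c)) (top_of N) (chart_inv c)"
proof -
  have "continuous_map (subtopology euclidean (chart_domain c))
      (subtopology (powertop_real UNIV) (snd c ` fst c)) ($)"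
    unfolding continuous_map_in_subtopology euclidean_product_topology
    using continuous_on_vec_nth[of "chart_domain c"] by (auto simp: chart_domain_def)
  from continuous_map_compose[OF this continuous_map_inv_chart[OF c]]
  have "continuous_map (subtopology euclidean (chart_domain c)) (top_of N) (inv_into (fst c) (snd c) \<circ> ($))" .
  moreover have "inv_into (fst c) (snd c) \<circ> ($) = chart_inv c"
    by (simp add: fun_eq_iff chart_inv_def)
  ultimately show ?thesis by simp
qed

lemma smooth_in_chart:
  assumes c: "c \<in> atlas N" and S: "openin (top_of N) S"
    and g: "C_infinity_on UNIV (snd c ` (fst c \<inter> S)) (\<lambda>x. g (inv_into (fst c) (snd c) x))"
  shows "smooth {x \<in> chart_domain c. chart_inv c x \<in> S} (\<lambda>x. g (chart_inv c x))"
proof -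
  have eq: "snd c ` (fst c \<inter> S) = {x \<in> snd c ` fst c. inv_into (fst c) (snd c) x \<in> S}"
    using chart_inj[OF c] by (auto simp: inv_into_f_f)
  have "openin (subtopology (powertop_real UNIV) (snd c ` fst c))
      {x \<in> topspace (subtopology (powertop_real UNIV) (snd c ` fst c)). inv_into (fst c) (snd c) x \<in> S}"
    by (rule openin_continuous_map_preimage[OF continuous_map_inv_chart[OF c] S])
  then have "open (snd c ` (fst c \<inter> S))"
    using chart_image_open[OF c] unfolding eq
    by (simp add: euclidean_product_topology openin_open_subtopology)
  from C_infinity_on_imp_smooth[OF this g] show ?thesis
    by (simp add: eq chart_domain_def chart_inv_def conj_commute)
qed

lemma smooth_transition:
  assumes "c \<in> atlas N" "c' \<in> atlas N"
  shows "smooth {x \<in> chart_domain c. chart_inv c x \<in> fst c'} (\<lambda>x. snd c' (chart_inv c x) i)"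
  by (rule smooth_in_chart[OF assms(1) chart_open[OF assms(2)] chart_transition[OF assms]])

lemma open_transition_domain:
  assumes "c \<in> atlas N" "c' \<in> atlas N"
  shows "open {x \<in> chart_domain c. chart_inv c x \<in> fst c'}"
proof -
  have "openin (subtopology euclidean (chart_domain c))
      {x \<in> topspace (subtopology euclidean (chart_domain c)). chart_inv c x \<in> fst c'}"
    by (rule openin_continuous_map_preimage[OF continuous_map_chart_inv chart_open]) (rule assms)+
  then show ?thesis using open_chart_domain[OF assms(1)] by (simp add: openin_open_subtopology)
qed

lemma power_chart_atlas: "\<forall>k\<in>{1..s}. c k \<in> atlas N \<Longrightarrow> power_chart N s c \<in> atlas (distinct_power N s)"
  by (auto simp: atlas_distinct_power)

lemma power_chart_open:
  assumes "\<forall>k\<in>{1..s}. c k \<in> atlas N"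
  shows "openin (top_of (distinct_power N s)) (fst (power_chart N s c))"
proof -
  have "openin (product_topology (\<lambda>_. top_of N) {1..s}) (PiE {1..s} (\<lambda>k. fst (c k)))"
    using assms chart_open by (auto simp: openin_PiE)
  then show ?thesis
    by (auto simp: distinct_power_simps power_chart_def intro: openin_subtopology_Int)
qed

lemma distinct_power_chart_open:
  assumes "C \<in> atlas (distinct_power N s)" shows "openin (top_of (distinct_power N s)) (fst C)"
  using assms power_chart_open unfolding atlas_distinct_power by blast

lemma snd_power_chart: "k \<in> {1..s} \<Longrightarrow> snd (power_chart N s c) q (k, i) = snd (c k) (q k) i"
  by (simp add: power_chart_def coords)

lemma velocity_power_chart:
  assumes "\<forall>k\<in>{1..s}. c k \<in> atlas N \<and> q k \<in> fst (c k)" "q \<in> distinct_tuples (topspace (top_of N)) s"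
    and "\<gamma> 0 = q" "k \<in> {1..s}"
  shows "velocity (distinct_power N s) \<gamma> (power_chart N s c) (k, i) = deriv (\<lambda>t. snd (c k) (\<gamma> t k) i) 0"
proof -
  have "q \<in> fst (power_chart N s c)"
    using assms(1,2) by (auto simp: power_chart_def distinct_tuples_def)
  then show ?thesis
    using assms power_chart_atlas[of s c] by (simp add: velocity_def distinct_power_simps coords snd_power_chart)
qed

text \<open>Straight lines in product charts realize all velocities. The Hausdorff property keeps the
components of the curve distinct for small parameters.\<close>

lemma chart_line:
  fixes a :: "nat \<Rightarrow> real^'n"
  assumes c: "\<forall>k\<in>{1..s}. c k \<in> atlas N \<and> q k \<in> fst (c k)"
    and q: "q \<in> distinct_tuples (topspace (top_of N)) s"
  defines "\<gamma> \<equiv> \<lambda>t. \<lambda>k\<in>{1..s}. chart_inv (c k) (chart_vec (c k) (q k) + t *\<^sub>R a k)"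
  shows chart_line_curve: "\<gamma> \<in> curves_at (distinct_power N s) q"
    and chart_line_velocity: "k \<in> {1..s} \<Longrightarrow> deriv (\<lambda>t. snd (c k) (\<gamma> t k) i) 0 = a k $ i"
proof -
  define l where "l k t = chart_vec (c k) (q k) + t *\<^sub>R a k" for k t
  define L where "L k t = chart_inv (c k) (l k t)" for k t
  define T where "T k = {t. l k t \<in> chart_domain (c k)}" for k
  have \<gamma>: "\<gamma> t = (\<lambda>k\<in>{1..s}. L k t)" for t by (simp add: \<gamma>_def L_def l_def)
  have cl: "continuous_on S (l k)" for S k unfolding l_def by (intro continuous_intros)
  have oT: "open (T k)" if "k \<in> {1..s}" for k
    using open_vimage[OF open_chart_domain cl[of UNIV k], of "c k"] c that by (simp add: T_def vimage_def)
  have T0: "0 \<in> T k" if "k \<in> {1..s}" for k using c that by (simp add: T_def l_def chart_vec_in)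
  have L0: "L k 0 = q k" if "k \<in> {1..s}" for k
    using c that by (simp add: L_def l_def chart_inv_chart_vec)
  have cL: "continuous_map (subtopology euclideanreal (T k)) (top_of N) (L k)" if "k \<in> {1..s}" for k
  proof -
    have "continuous_map (subtopology euclideanreal (T k)) (subtopology euclidean (chart_domain (c k))) (l k)"
      unfolding continuous_map_in_subtopology using cl[of "T k"] by (auto simp: T_def)
    from continuous_map_compose[OF this continuous_map_chart_inv] show ?thesis
      using c that unfolding L_def o_def by blast
  qed
  have near: "\<forall>\<^sub>F t in nhds 0. t \<in> T k \<and> L k t \<in> A" if "k \<in> {1..s}" "openin (top_of N) A" "q k \<in> A" for k A
  proof -
    have "openin (subtopology euclideanreal (T k)) {t \<in> topspace (subtopology euclideanreal (T k)). L k t \<in> A}"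
      by (rule openin_continuous_map_preimage[OF cL[OF that(1)] that(2)])
    then have "open {t \<in> T k. L k t \<in> A}" using oT[OF that(1)] by (simp add: openin_open_subtopology)
    then show ?thesis
      unfolding eventually_nhds using T0[OF that(1)] L0[OF that(1)] that(3)
      by (intro exI[of _ "{t \<in> T k. L k t \<in> A}"]) auto
  qed
  have ev: "\<forall>\<^sub>F t in nhds 0. \<forall>k\<in>{1..s}. t \<in> T k \<and> (\<forall>k'\<in>{1..s}. k \<noteq> k' \<longrightarrow> L k t \<noteq> L k' t)"
  proof (intro eventually_ball_finite ballI eventually_conj finite_atLeastAtMost)
    fix k assume k: "k \<in> {1..s}"
    show "\<forall>\<^sub>F t in nhds 0. t \<in> T k"
      using near[OF k chart_open, of "c k"] c k by (auto elim: eventually_mono)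
    fix k' assume k': "k' \<in> {1..s}"
    show "\<forall>\<^sub>F t in nhds 0. k \<noteq> k' \<longrightarrow> L k t \<noteq> L k' t"
    proof (cases "k = k'")
      case False
      have "inj_on q {1..s}" "q \<in> PiE {1..s} (\<lambda>_. topspace (top_of N))"
        using q by (auto simp: distinct_tuples_def)
      then have "q k \<noteq> q k'" "q k \<in> topspace (top_of N)" "q k' \<in> topspace (top_of N)"
        using False k k' by (metis inj_onD, metis PiE_mem, metis PiE_mem)
      moreover have "Hausdorff_space (top_of N)" using manifold by (simp add: smooth_manifold_def)
      ultimately obtain A A' where A: "openin (top_of N) A" "openin (top_of N) A'" "q k \<in> A" "q k' \<in> A'" "disjnt A A'"
        unfolding Hausdorff_space_def by blast
      show ?thesis
        using near[OF k A(1,3)] near[OF k' A(2,4)]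
        by eventually_elim (use A(5) in \<open>auto simp: disjnt_iff\<close>)
    qed simp
  qed
  obtain e where e: "e > 0" and
    *: "\<And>t. dist t 0 < e \<Longrightarrow> \<forall>k\<in>{1..s}. t \<in> T k \<and> (\<forall>k'\<in>{1..s}. k \<noteq> k' \<longrightarrow> L k t \<noteq> L k' t)"
    using ev unfolding eventually_nhds_metric by blast
  have "dist t 0 < e" if "t \<in> {-e<..<e}" for t :: real
    using that by (simp add: dist_real_def abs_less_iff)
  then have eT: "t \<in> T k" and ed: "k' \<in> {1..s} \<Longrightarrow> k \<noteq> k' \<Longrightarrow> L k t \<noteq> L k' t"
    if "t \<in> {-e<..<e}" "k \<in> {1..s}" for t k k'
    using * that by blast+
  have top: "L k t \<in> topspace (top_of N)" if "t \<in> {-e<..<e}" "k \<in> {1..s}" for k t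
    using chart_inv_in[of "l k t" "c k"] eT[OF that] chart_subset[of "c k"] c that(2) by (auto simp: L_def T_def)
  have cont: "continuous_map (subtopology euclideanreal {-e<..<e}) (top_of (distinct_power N s)) \<gamma>"
    unfolding distinct_power_simps continuous_map_in_subtopology continuous_map_componentwise
  proof (intro conjI ballI)
    show "\<gamma> \<in> topspace (subtopology euclideanreal {-e<..<e}) \<rightarrow> distinct_tuples (topspace (top_of N)) s"
    proof (rule Pi_I)
      fix t assume "t \<in> topspace (subtopology euclideanreal {-e<..<e})"
      then have t: "t \<in> {-e<..<e}" by simp
      have "inj_on (\<gamma> t) {1..s}"
        using ed[OF t] unfolding \<gamma> by (intro inj_onI) (metis restrict_apply)
      then show "\<gamma> t \<in> distinct_tuples (topspace (top_of N)) s"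
        using top[OF t] by (simp add: distinct_tuples_def \<gamma>)
    qed
    fix k assume k: "k \<in> {1..s}"
    have "continuous_map (subtopology euclideanreal {-e<..<e}) (top_of N) (L k)"
      using continuous_map_from_subtopology_mono[OF cL[OF k]] eT k by blast
    then show "continuous_map (subtopology euclideanreal {-e<..<e}) (top_of N) (\<lambda>t. \<gamma> t k)"
      using k by (simp add: \<gamma>)
  qed (auto simp: \<gamma>)
  have "smooth_map (open_submanifold real_line {-e<..<e}) (distinct_power N s) \<gamma>"
  proof (rule smooth_curveI[OF cont])
    fix W \<Psi> assume W: "(W, \<Psi>) \<in> atlas (distinct_power N s)"
    then obtain c' where c': "\<forall>k\<in>{1..s}. c' k \<in> atlas N" and eq: "(W, \<Psi>) = power_chart N s c'"
      unfolding atlas_distinct_power by blast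
    have Weq: "W = fst (power_chart N s c')" and \<Psi>eq: "\<Psi> = snd (power_chart N s c')"
      using eq by (metis fst_conv, metis snd_conv)
    have oW: "openin (top_of (distinct_power N s)) W"
      using distinct_power_chart_open[OF W] by simp
    fix j assume "j \<in> coords (distinct_power N s)"
    then obtain k i where j: "j = (k, i)" and k: "k \<in> {1..s}"
      by (auto simp: distinct_power_simps)
    have "open ((\<lambda>y::unit \<Rightarrow> real. y ()) -` {t. t \<in> {-e<..<e} \<and> \<gamma> t \<in> W})"
      by (intro open_vimage open_curve_preimage[OF cont oW] continuous_on_product_coordinates)
    then have o: "open {y::unit \<Rightarrow> real. y () \<in> {-e<..<e} \<and> \<gamma> (y ()) \<in> W}"
      by (simp add: vimage_def)
    have f: "\<Psi> (\<gamma> t) j = snd (c' k) (chart_inv (c k) (chart_vec (c k) (q k) + t *\<^sub>R a k)) i" for t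
      using k by (simp add: \<Psi>eq j snd_power_chart \<gamma> L_def l_def)
    show "C_infinity_on UNIV {y::unit \<Rightarrow> real. y () \<in> {-e<..<e} \<and> \<gamma> (y ()) \<in> W} (\<lambda>y. \<Psi> (\<gamma> (y ())) j)"
      unfolding f
    proof (rule C_infinity_on_line[OF open_transition_domain smooth_transition o])
      show "c k \<in> atlas N" "c k \<in> atlas N" "c' k \<in> atlas N" "c' k \<in> atlas N" using c c' k by auto
      fix y :: "unit \<Rightarrow> real" assume y: "y \<in> {y. y () \<in> {-e<..<e} \<and> \<gamma> (y ()) \<in> W}"
      then have "\<gamma> (y ()) k \<in> fst (c' k)" using k by (auto simp: Weq power_chart_def)
      then show "chart_vec (c k) (q k) + y () *\<^sub>R a k \<in> {x \<in> chart_domain (c k). chart_inv (c k) x \<in> fst (c' k)}"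
        using eT[of "y ()" k] y k by (simp add: \<gamma> L_def l_def T_def)
    qed
  next
    fix W \<Psi> assume "(W, \<Psi>) \<in> atlas (distinct_power N s)"
    from distinct_power_chart_open[OF this] show "openin (top_of (distinct_power N s)) W" by simp
  qed
  moreover have "\<gamma> 0 = q"
    using L0 q by (auto simp: \<gamma> distinct_tuples_def fun_eq_iff PiE_def extensional_def)
  ultimately show "\<gamma> \<in> curves_at (distinct_power N s) q"
    using e by (auto simp: curves_at_def)
  show "deriv (\<lambda>t. snd (c k) (\<gamma> t k) i) 0 = a k $ i" if k: "k \<in> {1..s}"
  proof (rule DERIV_imp_deriv)
    have "\<forall>\<^sub>F t in nhds 0. snd (c k) (\<gamma> t k) i = l k t $ i"
      unfolding eventually_nhds using oT[OF k] T0[OF k] k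
      by (intro exI[of _ "T k"]) (auto simp: \<gamma> L_def T_def chart_vec_chart_inv)
    moreover have "((\<lambda>t. l k t $ i) has_field_derivative a k $ i) (at 0)"
      by (auto simp: l_def intro!: derivative_eq_intros)
    ultimately show "((\<lambda>t. snd (c k) (\<gamma> t k) i) has_field_derivative a k $ i) (at 0)"
      using DERIV_cong_ev by fastforce
  qed
qed

text \<open>This makes the differential independent of the curve that represents a tangent vector.\<close>

lemma deriv_along_curve:
  assumes c: "\<forall>k\<in>{1..s}. c k \<in> atlas N \<and> q k \<in> fst (c k)"
    and q: "q \<in> distinct_tuples (topspace (top_of N)) s"
    and \<gamma>: "\<gamma> \<in> curves_at (distinct_power N s) q" and k: "k \<in> {1..s}"
    and g: "smooth (chart_domain (c k)) (\<lambda>x. g (chart_inv (c k) x))"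
  shows "deriv (\<lambda>t. g (\<gamma> t k)) 0 =
    grad (\<lambda>x. g (chart_inv (c k) x)) (chart_vec (c k) (q k)) \<bullet> (\<chi> i. deriv (\<lambda>t. snd (c k) (\<gamma> t k) i) 0)"
proof -
  obtain e where e: "e > 0" and sm: "smooth_map (open_submanifold real_line {-e<..<e}) (distinct_power N s) \<gamma>"
    and \<gamma>0: "\<gamma> 0 = q"
    using \<gamma> by (auto simp: curves_at_def)
  have ck: "c k \<in> atlas N" "q k \<in> fst (c k)" and call: "\<forall>k\<in>{1..s}. c k \<in> atlas N" using c k by auto
  define v where "v t = chart_vec (c k) (\<gamma> t k)" for t
  have "(\<lambda>t. snd (power_chart N s c) (\<gamma> t) (k, i)) field_differentiable (at 0)" for i
  proof (rule smooth_curve_differentiable[OF sm e])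
    show "(fst (power_chart N s c), snd (power_chart N s c)) \<in> atlas (distinct_power N s)"
      using power_chart_atlas[OF call] by simp
    show "openin (top_of (distinct_power N s)) (fst (power_chart N s c))" by (rule power_chart_open[OF call])
    show "\<gamma> 0 \<in> fst (power_chart N s c)"
      using c q by (auto simp: \<gamma>0 power_chart_def distinct_tuples_def)
    show "(k, i) \<in> coords (distinct_power N s)" using k by (simp add: distinct_power_simps coords)
  qed
  then have d: "((\<lambda>t. v t $ i) has_field_derivative deriv (\<lambda>t. snd (c k) (\<gamma> t k) i) 0) (at 0)" for i
    using k by (simp add: v_def chart_vec_def snd_power_chart DERIV_deriv_iff_field_differentiable)
  let ?d = "\<chi> i. deriv (\<lambda>t. snd (c k) (\<gamma> t k) i) 0"
  have "((\<lambda>t. v t \<bullet> b) has_derivative (\<lambda>r. (r *\<^sub>R ?d) \<bullet> b)) (at 0)" if b: "b \<in> Basis" for b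
  proof -
    obtain i where b: "b = axis i 1" using b by (auto simp: Basis_vec_def)
    show ?thesis unfolding b using d[of i] by (simp add: inner_axis has_field_derivative_def mult_commute_abs)
  qed
  then have dv: "(v has_derivative (\<lambda>r. r *\<^sub>R ?d)) (at 0)"
    using has_derivative_componentwise_within[of v _ 0 UNIV] by blast
  have v0: "v 0 = chart_vec (c k) (q k)" by (simp add: v_def \<gamma>0)
  have "((\<lambda>t. g (chart_inv (c k) (v t))) has_derivative
      (\<lambda>r. grad (\<lambda>x. g (chart_inv (c k) x)) (v 0) \<bullet> (r *\<^sub>R ?d))) (at 0)"
    by (rule has_derivative_compose[where g = "\<lambda>x. g (chart_inv (c k) x)", OF dv smoothD[OF g]])
      (simp add: v0 chart_vec_in ck)
  then have 1: "((\<lambda>t. g (chart_inv (c k) (v t))) has_field_derivative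
      grad (\<lambda>x. g (chart_inv (c k) x)) (v 0) \<bullet> ?d) (at 0)"
    by (simp add: has_field_derivative_def mult_commute_abs)
  have "continuous_map (subtopology euclideanreal {-e<..<e}) (top_of N) (\<lambda>t. \<gamma> t k)"
    using smooth_curve_continuous[OF sm e] k
    by (auto simp: distinct_power_simps continuous_map_in_subtopology continuous_map_componentwise)
  then have "open {t. t \<in> {-e<..<e} \<and> \<gamma> t k \<in> fst (c k)}"
    by (rule open_curve_preimage[OF _ chart_open[OF ck(1)]])
  then have "\<forall>\<^sub>F t in nhds 0. g (chart_inv (c k) (v t)) = g (\<gamma> t k)"
    unfolding eventually_nhds using e ck
    by (intro exI[of _ "{t. t \<in> {-e<..<e} \<and> \<gamma> t k \<in> fst (c k)}"])
      (auto simp: \<gamma>0 v_def chart_inv_chart_vec)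
  then have "((\<lambda>t. g (\<gamma> t k)) has_field_derivative
      grad (\<lambda>x. g (chart_inv (c k) x)) (v 0) \<bullet> ?d) (at 0)"
    using 1 DERIV_cong_ev by fastforce
  then show ?thesis unfolding v0 by (rule DERIV_imp_deriv)
qed

text \<open>The sum of the tangent spaces is contained in \<open>tangent_space\<close> of the target because the latter consists
of all vectors of the shape \<open>power_tangent\<close>; the converse inclusion is the linear system.\<close>

lemma transverse_if_solvable:
  fixes G :: "'a \<Rightarrow> real^'l::finite"
  assumes s: "1 \<le> s"
    and G: "\<And>c j. c \<in> atlas N \<Longrightarrow> smooth (chart_domain c) (\<lambda>x. G (chart_inv c x) $ j)"
    and solv: "\<And>q. q \<in> distinct_tuples (topspace (top_of N)) s \<Longrightarrow> (\<forall>k\<in>{1..s}. G (q k) = G (q 1)) \<Longrightarrow>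
      \<exists>c. (\<forall>k\<in>{1..s}. c k \<in> atlas N \<and> q k \<in> fst (c k)) \<and>
        (\<forall>u. \<exists>a b. \<forall>k\<in>{1..s}. \<forall>j.
          u k $ j = grad (\<lambda>x. G (chart_inv (c k) x) $ j) (chart_vec (c k) (q k)) \<bullet> a k + b $ j)"
  shows "transverse (distinct_power N s) (power_manifold Euclid s) (tuple_map s G) (diagonal Euclid s)"
  unfolding transverse_def topspace_distinct_power
proof (intro ballI)
  let ?N = "distinct_power N s" and ?P = "power_manifold (Euclid :: (real^'l, 'l) smooth_space) s"
  let ?g = "tuple_map s G" and ?D = "diagonal (Euclid :: (real^'l, 'l) smooth_space) s"
  fix q assume q: "q \<in> distinct_tuples (topspace (top_of N)) s"
  have ext: "?g q' \<in> extensional {1..s}" for q' by (simp add: tuple_map_def)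
  note Tspace = tangent_space_power_Euclid[OF ext]
  have differential: "\<exists>\<gamma>. \<gamma> \<in> curves_at ?N q \<and> velocity ?N \<gamma> = v \<and>
      differential ?N ?P ?g q v = power_tangent s (\<lambda>k. \<chi> j. deriv (\<lambda>t. G (\<gamma> t k) $ j) 0)"
    if v: "v \<in> tangent_space ?N q" for v
  proof -
    have "\<exists>\<gamma>. \<gamma> \<in> curves_at ?N q \<and> velocity ?N \<gamma> = v"
      using v by (auto simp: tangent_space_def)
    from someI_ex[OF this]
    obtain \<gamma> where \<gamma>: "\<gamma> \<in> curves_at ?N q" "velocity ?N \<gamma> = v"
      and D: "differential ?N ?P ?g q v = velocity ?P (?g \<circ> \<gamma>)"
      unfolding differential_def by blast
    have "velocity ?P (?g \<circ> \<gamma>) = power_tangent s (\<lambda>k. \<chi> j. deriv (\<lambda>t. (?g \<circ> \<gamma>) t k $ j) 0)"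
      by (rule velocity_power_Euclid) (simp only: o_apply ext)
    also have "\<dots> = power_tangent s (\<lambda>k. \<chi> j. deriv (\<lambda>t. G (\<gamma> t k) $ j) 0)"
      by (auto simp: power_tangent_def tuple_map_def fun_eq_iff)
    finally show ?thesis using \<gamma> D by auto
  qed
  show "?g q \<notin> ?D \<or> ?g q \<in> ?D \<and>
      {(\<lambda>c j. v c j + w c j) | v w. v \<in> differential ?N ?P ?g q ` tangent_space ?N q \<and>
        w \<in> tangent_subspace ?P ?D (?g q)} = tangent_space ?P (?g q)"
  proof (cases "?g q \<in> ?D")
    case True
    then obtain y where "?g q = (\<lambda>k\<in>{1..s}. y)" by (auto simp: diagonal_def)
    then have "G (q k) = y" if "k \<in> {1..s}" for k
      using that by (metis restrict_apply tuple_map_def)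
    then have "\<forall>k\<in>{1..s}. G (q k) = G (q 1)" using s by simp
    from solv[OF q this] obtain c where c: "\<forall>k\<in>{1..s}. c k \<in> atlas N \<and> q k \<in> fst (c k)"
      and sol: "\<And>u. \<exists>a b. \<forall>k\<in>{1..s}. \<forall>j.
          u k $ j = grad (\<lambda>x. G (chart_inv (c k) x) $ j) (chart_vec (c k) (q k)) \<bullet> a k + b $ j"
      by blast
    let ?S = "{(\<lambda>c j. v c j + w c j) | v w. v \<in> differential ?N ?P ?g q ` tangent_space ?N q \<and>
        w \<in> tangent_subspace ?P ?D (?g q)}"
    have "?S \<subseteq> tangent_space ?P (?g q)"
    proof
      fix r assume "r \<in> ?S"
      then obtain v w where r: "r = (\<lambda>c j. differential ?N ?P ?g q v c j + w c j)"
        and v: "v \<in> tangent_space ?N q" and w: "w \<in> tangent_subspace ?P ?D (?g q)"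
        by blast
      obtain a where a: "differential ?N ?P ?g q v = power_tangent s a"
        using differential[OF v] by blast
      have "w \<in> tangent_space ?P (?g q)"
        using w by (auto simp: tangent_subspace_def tangent_space_def)
      then obtain b where "w = power_tangent s b" unfolding Tspace by blast
      then show "r \<in> tangent_space ?P (?g q)"
        unfolding r a Tspace by (simp add: power_tangent_add)
    qed
    moreover have "tangent_space ?P (?g q) \<subseteq> ?S"
    proof
      fix r assume "r \<in> tangent_space ?P (?g q)"
      then obtain u where r: "r = power_tangent s u" unfolding Tspace by blast
      obtain a b where ab: "\<forall>k\<in>{1..s}. \<forall>j.
          u k $ j = grad (\<lambda>x. G (chart_inv (c k) x) $ j) (chart_vec (c k) (q k)) \<bullet> a k + b $ j"
        using sol[of u] by blast
      define \<gamma> where "\<gamma> = (\<lambda>t. \<lambda>k\<in>{1..s}. chart_inv (c k) (chart_vec (c k) (q k) + t *\<^sub>R a k))"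
      have \<gamma>: "\<gamma> \<in> curves_at ?N q" unfolding \<gamma>_def by (rule chart_line_curve[OF c q])
      define v where "v = velocity ?N \<gamma>"
      have v: "v \<in> tangent_space ?N q" using \<gamma> by (simp add: v_def tangent_space_def)
      obtain \<gamma>' where \<gamma>': "\<gamma>' \<in> curves_at ?N q" "velocity ?N \<gamma>' = v"
        and D: "differential ?N ?P ?g q v = power_tangent s (\<lambda>k. \<chi> j. deriv (\<lambda>t. G (\<gamma>' t k) $ j) 0)"
        using differential[OF v] by blast
      have "deriv (\<lambda>t. snd (c k) (\<gamma>' t k) i) 0 = a k $ i" if k: "k \<in> {1..s}" for k i
      proof -
        have "\<gamma> 0 = q" "\<gamma>' 0 = q" using \<gamma> \<gamma>' by (auto simp: curves_at_def)
        then have "deriv (\<lambda>t. snd (c k) (\<gamma>' t k) i) 0 = deriv (\<lambda>t. snd (c k) (\<gamma> t k) i) 0"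
          using velocity_power_chart[OF c q _ k] \<gamma>'(2) unfolding v_def by metis
        also have "\<dots> = a k $ i" unfolding \<gamma>_def by (rule chart_line_velocity[OF c q k])
        finally show ?thesis .
      qed
      then have "deriv (\<lambda>t. G (\<gamma>' t k) $ j) 0
          = grad (\<lambda>x. G (chart_inv (c k) x) $ j) (chart_vec (c k) (q k)) \<bullet> a k" if "k \<in> {1..s}" for k j
        using deriv_along_curve[OF c q \<gamma>'(1) that G, of j] c that by (simp add: vec_lambda_eta)
      then have "r = (\<lambda>i j. differential ?N ?P ?g q v i j + power_tangent s (\<lambda>_. b) i j)"
        unfolding r D power_tangent_add using ab by (auto simp: power_tangent_def fun_eq_iff)
      then show "r \<in> ?S" using v diagonal_tangent[OF True, of b] by blast
    qed
    ultimately show ?thesis using True by blast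
  qed simp
qed

end

section \<open>The number \<open>s_f\<close>\<close>

text \<open>The dimension is positive, since \<open>'n\<close> is nonempty.\<close>

lemma infinite_nonempty_manifold:
  fixes N :: "('a, 'n::finite) smooth_space"
  assumes "smooth_manifold N" "coords N = UNIV" "topspace (top_of N) \<noteq> {}"
  shows "infinite (topspace (top_of N))"
proof
  assume fin: "finite (topspace (top_of N))"
  obtain p where p: "p \<in> topspace (top_of N)" using assms(3) by blast
  moreover have "topspace (top_of N) = (\<Union>(V, \<phi>)\<in>atlas N. V)"
    using assms(1) by (simp add: smooth_manifold_def)
  ultimately obtain c where c: "c \<in> atlas N" "p \<in> fst c" by force
  have "finite (fst c)" using fin chart_subset[OF assms(1,2) c(1)] finite_subset by blast
  then have "finite (snd c ` fst c)" by simp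
  moreover have "chart_domain c \<subseteq> vec_lambda ` (snd c ` fst c)"
    by (auto simp: chart_domain_def image_iff) (metis vec_nth_inverse)
  ultimately have "finite (chart_domain c)" using finite_surj by blast
  moreover have "open (chart_domain c)" by (rule open_chart_domain[OF assms(1,2) c(1)])
  ultimately have "chart_domain c = {}" using finite_imp_not_open by blast
  then show False using chart_vec_in[OF c(2)] by simp
qed

lemma distinct_tuple_extends:
  assumes S: "infinite S" and q: "q \<in> distinct_tuples S s" and "s \<le> t"
  shows "\<exists>q'\<in>distinct_tuples S t. \<forall>k\<in>{1..s}. q' k = q k"
proof -
  have "infinite (S - q ` {1..s})" using S by simp
  then obtain r :: "nat \<Rightarrow> 'a" where r: "inj r" "range r \<subseteq> S - q ` {1..s}"
    using infinite_countable_subset by blast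
  define q' where "q' k = (if k \<in> {1..t} then if k \<le> s then q k else r k else undefined)" for k
  have qS: "q k \<in> S" if "k \<in> {1..s}" for k using q that by (auto simp: distinct_tuples_def)
  have qinj: "inj_on q {1..s}" using q by (simp add: distinct_tuples_def)
  have rS: "r k \<in> S" "r k \<notin> q ` {1..s}" for k using r(2) by auto
  have "q' \<in> PiE {1..t} (\<lambda>_. S)"
    using qS rS(1) by (auto simp: q'_def PiE_iff extensional_def)
  moreover have "inj_on q' {1..t}"
  proof (rule inj_onI)
    fix i j assume ij: "i \<in> {1..t}" "j \<in> {1..t}" "q' i = q' j"
    have notq: "q a \<noteq> r b" if "a \<in> {1..s}" for a b using rS(2)[of b] that by (metis imageI)
    show "i = j"
      using ij inj_onD[OF qinj, of i j] injD[OF r(1), of i j] notq[of i j] notq[of j i]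
      by (auto simp: q'_def split: if_splits)
  qed
  ultimately have "q' \<in> distinct_tuples S t" by (simp add: distinct_tuples_def)
  then show ?thesis using \<open>s \<le> t\<close> by (intro bexI[of _ q']) (auto simp: q'_def)
qed

text \<open>If the span has as many dimensions as there are vectors, then the family is injective with
independent range.\<close>

lemma independent_family_if_dim:
  fixes v :: "'i \<Rightarrow> 'v::euclidean_space"
  assumes I: "finite I" and dim: "dim (span (v ` I)) = card I"
    and J: "J \<subseteq> I" and 0: "(\<Sum>k\<in>J. \<alpha> k *\<^sub>R v k) = 0" and k: "k \<in> J"
  shows "\<alpha> k = 0"
proof -
  have "card I \<le> card (v ` I)"
    using dim dim_le_card[of "v ` I" "v ` I", OF span_superset] I by simp
  then have inj: "inj_on v I"
    using I by (simp add: card_image_le eq_card_imp_inj_on le_antisym)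
  have "independent (v ` I)"
    by (rule card_le_dim_spanning[of _ "v ` I"]) (use I dim inj in \<open>auto simp: card_image span_superset\<close>)
  then have ind: "independent (v ` J)" using J independent_mono by blast
  have injJ: "inj_on v J" using inj J inj_on_subset by blast
  have finJ: "finite J" using I J finite_subset by blast
  have "(\<Sum>y\<in>v ` J. \<alpha> (inv_into J v y) *\<^sub>R y) = 0"
    using 0 injJ by (simp add: sum.reindex)
  then have "\<alpha> (inv_into J v (v k)) = 0"
    by (rule independentD[OF ind _ subset_refl, rotated]) (use finJ k in auto)
  then show ?thesis using injJ k by simp
qed

text \<open>On an infinite set the maximum that defines \<open>s_f\<close> is attained, and any tuple of length \<open>s \<le> s_f\<close>
extends to one of length \<open>s_f\<close>; independence for the longer tuple is inherited by the shorter one.\<close>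

lemma s_index_independent:
  fixes f :: "'a \<Rightarrow> real^'m::finite"
  assumes S: "infinite S" and q: "q \<in> distinct_tuples S s" and s: "2 \<le> s" "s \<le> s_index S f"
  shows "s \<le> Suc CARD('m)"
    and "(\<Sum>k\<in>{2..s}. \<alpha> k *\<^sub>R (f (q k) - f (q 1))) = 0 \<Longrightarrow> k \<in> {2..s} \<Longrightarrow> \<alpha> k = 0"
proof -
  define Q where "Q = {s. 1 \<le> s \<and>
    (\<forall>q\<in>distinct_tuples S s. dim (span ((\<lambda>i. f (q i) - f (q 1)) ` {2..s})) = s - 1)}"
  have bound: "t \<le> Suc CARD('m)" if t: "t \<in> Q" for t
  proof -
    have "(\<lambda>_. undefined) \<in> distinct_tuples S 0" by (simp add: distinct_tuples_def)
    from distinct_tuple_extends[OF S this, of t] obtain q' where "q' \<in> distinct_tuples S t" by auto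
    then have "dim (span ((\<lambda>i. f (q' i) - f (q' 1)) ` {2..t})) = t - 1" using t by (auto simp: Q_def)
    moreover have "dim (span ((\<lambda>i. f (q' i) - f (q' 1)) ` {2..t})) \<le> DIM(real^'m)" by (rule dim_subset_UNIV)
    ultimately show ?thesis by simp
  qed
  have "finite Q" using bound finite_nat_set_iff_bounded_le by blast
  moreover have "1 \<in> Q" by (simp add: Q_def)
  ultimately have M: "s_index S f \<in> Q"
    unfolding s_index_def Q_def[symmetric] by (intro Max_in) auto
  then show "s \<le> Suc CARD('m)" using bound s(2) le_trans by blast
  assume 0: "(\<Sum>k\<in>{2..s}. \<alpha> k *\<^sub>R (f (q k) - f (q 1))) = 0" and k: "k \<in> {2..s}"
  obtain q' where q': "q' \<in> distinct_tuples S (s_index S f)" and eq: "\<And>k. k \<in> {1..s} \<Longrightarrow> q' k = q k"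
    using distinct_tuple_extends[OF S q s(2)] by blast
  show "\<alpha> k = 0"
  proof (rule independent_family_if_dim[of "{2..s_index S f}" "\<lambda>i. f (q' i) - f (q' 1)" "{2..s}" \<alpha>])
    show "dim (span ((\<lambda>i. f (q' i) - f (q' 1)) ` {2..s_index S f})) = card {2..s_index S f}"
      using M q' by (auto simp: Q_def)
    have "(\<Sum>k\<in>{2..s}. \<alpha> k *\<^sub>R (f (q' k) - f (q' 1))) = (\<Sum>k\<in>{2..s}. \<alpha> k *\<^sub>R (f (q k) - f (q 1)))"
      using eq s by (intro sum.cong) auto
    then show "(\<Sum>k\<in>{2..s}. \<alpha> k *\<^sub>R (f (q' k) - f (q' 1))) = 0" using 0 by simp
  qed (use s k in auto)
qed

section \<open>Transversality of generic linear perturbations\<close>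

text \<open>The atlas may be uncountable, but null sets can be united over countably many charts only.\<close>

lemma countable_subatlas:
  assumes "smooth_manifold N"
  obtains \<A> where "countable \<A>" "\<A> \<subseteq> atlas N" "\<And>p. p \<in> topspace (top_of N) \<Longrightarrow> \<exists>c\<in>\<A>. p \<in> fst c"
proof -
  have "Lindelof_space (top_of N)"
    using assms by (simp add: smooth_manifold_def second_countable_imp_Lindelof_space)
  moreover have "openin (top_of N) V" if "V \<in> fst ` atlas N" for V
    using assms that by (auto simp: smooth_manifold_def)
  moreover have "\<Union>(fst ` atlas N) = topspace (top_of N)"
    using assms unfolding smooth_manifold_def case_prod_beta by (simp only:)
  ultimately have "\<exists>\<V>. countable \<V> \<and> \<V> \<subseteq> fst ` atlas N \<and> \<Union>\<V> = topspace (top_of N)"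
    by (rule Lindelof_spaceD)
  then obtain \<V> where \<V>: "countable \<V>" "\<V> \<subseteq> fst ` atlas N" "\<Union>\<V> = topspace (top_of N)"
    by metis
  define ch where "ch = inv_into (atlas N) fst"
  show thesis
  proof (rule that[of "ch ` \<V>"])
    show "countable (ch ` \<V>)" using \<V>(1) by simp
    show "ch ` \<V> \<subseteq> atlas N"
      unfolding ch_def using \<V>(2) by (intro image_subsetI inv_into_into) blast
    fix p assume "p \<in> topspace (top_of N)"
    then obtain V where V: "V \<in> \<V>" "p \<in> V" using \<V>(3) by blast
    moreover have "fst (ch V) = V"
      unfolding ch_def using V(1) \<V>(2) by (intro f_inv_into_f) blast
    ultimately show "\<exists>c\<in>ch ` \<V>. p \<in> fst c" by (intro bexI[of _ "ch V"]) auto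
  qed
qed

lemma atlas_open_submanifold_Euclid:
  "atlas (open_submanifold (Euclid :: (real^'m::finite, 'm) smooth_space) U) = {(U, \<lambda>x i. x $ i)}"
  "coords (open_submanifold (Euclid :: (real^'m::finite, 'm) smooth_space) U) = UNIV"
  "top_of (open_submanifold (Euclid :: (real^'m::finite, 'm) smooth_space) U) = subtopology euclidean U"
  by (simp_all add: open_submanifold_def Euclid_def)

lemma smooth_chart_expression:
  fixes N :: "('a, 'n::finite) smooth_space" and f :: "'a \<Rightarrow> real^'m::finite"
  assumes N: "smooth_manifold N" "coords N = UNIV"
    and f: "smooth_map N (open_submanifold Euclid U) f" and c: "c \<in> atlas N"
  shows "smooth (chart_domain c) (\<lambda>x. f (chart_inv c x) $ i)"
    and "x \<in> chart_domain c \<Longrightarrow> f (chart_inv c x) \<in> U"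
proof -
  have fU: "f p \<in> U" if "p \<in> topspace (top_of N)" for p
    using f that by (auto simp: smooth_map_def atlas_open_submanifold_Euclid continuous_map_in_subtopology)
  obtain V \<phi> where [simp]: "c = (V, \<phi>)" by (cases c)
  have V: "V \<subseteq> topspace (top_of N)" using chart_subset[OF N c] by simp
  then have "V \<inter> f -` U = V" using fU by auto
  moreover have "C_infinity_on UNIV (\<phi> ` (V \<inter> f -` U)) (\<lambda>x. f (inv_into V \<phi> x) $ i)"
    using f c N(2) by (fastforce simp: smooth_map_def atlas_open_submanifold_Euclid)
  ultimately have "C_infinity_on UNIV (snd c ` fst c) (\<lambda>x. f (inv_into (fst c) (snd c) x) $ i)"
    by simp
  from C_infinity_on_imp_smooth[OF chart_image_open[OF N c] this]
  show "smooth (chart_domain c) (\<lambda>x. f (chart_inv c x) $ i)"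
    by (simp only: chart_domain_def chart_inv_def)
  show "f (chart_inv c x) \<in> U" if "x \<in> chart_domain c"
    using chart_inv_in[OF that] V fU by auto
qed

lemma smooth_map_Euclid_imp_smooth:
  fixes F :: "real^'m::finite \<Rightarrow> real^'l::finite"
  assumes U: "open U" and F: "smooth_map (open_submanifold Euclid U) Euclid F"
  shows "smooth U (\<lambda>y. F y $ j)"
proof -
  let ?n = "\<lambda>(x::real^'m) i. x $ i"
  have "C_infinity_on UNIV (?n ` U) (\<lambda>x. F (inv_into U ?n x) $ j)"
    using F by (auto simp: smooth_map_def atlas_open_submanifold_Euclid) (simp add: Euclid_def)
  moreover have inv: "inv_into U ?n (?n y) = y" if "y \<in> U" for y
    by (rule inv_into_f_f) (use that in \<open>auto simp: inj_on_def vec_nth_inject\<close>)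
  have oU: "open (?n ` U)"
  proof -
    have "?n ` U = vec_lambda -` U" by (auto simp: image_iff vec_nth_inverse) (metis vec_lambda_inverse UNIV_I)
    moreover have "continuous_on UNIV (vec_lambda :: ('m \<Rightarrow> real) \<Rightarrow> real^'m)"
      using continuous_on_vec_lambda[of UNIV "\<lambda>i x. x i"] continuous_on_product_coordinates by simp
    ultimately show ?thesis using open_vimage[OF U] by simp
  qed
  ultimately have "smooth {x. ?n x \<in> ?n ` U} (\<lambda>x. F (inv_into U ?n (?n x)) $ j)"
    using C_infinity_on_imp_smooth[OF oU] by blast
  moreover have "{x. ?n x \<in> ?n ` U} = U" by (auto simp: vec_nth_inject)
  ultimately have "smooth U (\<lambda>x. F (inv_into U ?n (?n x)) $ j)" by simp
  then show ?thesis
    by (subst smooth_cong[OF U, of _ "\<lambda>x. F (inv_into U ?n (?n x)) $ j"]) (simp_all only: inv)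
qed

theorem theorem2:
  fixes N :: "('a, 'n::finite) smooth_space"
    and f :: "'a \<Rightarrow> real ^ 'm"
    and U :: "(real ^ 'm) set"
    and F :: "real ^ 'm \<Rightarrow> real ^ 'l"
  assumes "smooth_manifold N" and "coords N = UNIV"
    and "open U"
    and "smooth_map N (open_submanifold Euclid U) f"
    and "inj_on f (topspace (top_of N))"
    and "smooth_map (open_submanifold Euclid U) Euclid F"
  shows "\<exists>\<Sigma> \<subseteq> {\<pi> :: real ^ 'm \<Rightarrow> real ^ 'l. linear \<pi>}.
    matrix ` \<Sigma> \<in> null_sets lebesgue \<and>
    (\<forall>\<pi> \<in> {\<pi>. linear \<pi>} - \<Sigma>.
       (\<forall>s. 2 \<le> s \<and> s \<le> s_index (topspace (top_of N)) f \<longrightarrow>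
          transverse (distinct_power N s) (power_manifold Euclid s)
            (tuple_map s ((\<lambda>x. F x + \<pi> x) \<circ> f)) (diagonal Euclid s)) \<and>
       ((\<forall>y. finite {x \<in> U. F x + \<pi> x = y} \<and>
             card {x \<in> U. F x + \<pi> x = y} \<le> s_index (topspace (top_of N)) f) \<longrightarrow>
          normal_crossings N Euclid ((\<lambda>x. F x + \<pi> x) \<circ> f)))"
proof -
  note N = assms(1,2)
  let ?S = "topspace (top_of N)"
  define sf where "sf = s_index ?S f"
  obtain \<A> where \<A>: "countable \<A>" "\<A> \<subseteq> atlas N" "\<And>p. p \<in> ?S \<Longrightarrow> \<exists>c\<in>\<A>. p \<in> fst c"
    using countable_subatlas[OF N(1)] by blast
  define h where "h c x = f (chart_inv c x)" for c :: "'a set \<times> ('a \<Rightarrow> 'n \<Rightarrow> real)" and x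
  have hs: "smooth (chart_domain c) (\<lambda>x. h c x $ i)" and hU: "h c ` chart_domain c \<subseteq> U"
    if "c \<in> atlas N" for c i
    using smooth_chart_expression[OF N assms(4) that] by (auto simp: h_def)
  have Fs: "smooth U (\<lambda>y. F y $ j)" for j by (rule smooth_map_Euclid_imp_smooth[OF assms(3,6)])
  define good where "good s c A \<longleftrightarrow> (\<forall>x u. (\<forall>k\<in>{1..s}. x k \<in> chart_domain (c k)) \<longrightarrow>
    (\<forall>\<alpha>. (\<Sum>k\<in>{2..s}. \<alpha> k *\<^sub>R (h (c k) (x k) - h (c 1) (x 1))) = 0 \<longrightarrow> (\<forall>k\<in>{2..s}. \<alpha> k = 0)) \<longrightarrow>
    (\<forall>k\<in>{1..s}. F (h (c k) (x k)) + A *v h (c k) (x k) = F (h (c 1) (x 1)) + A *v h (c 1) (x 1)) \<longrightarrow>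
    (\<exists>a b. \<forall>k\<in>{1..s}. \<forall>j.
      u k $ j = grad (\<lambda>y. (F (h (c k) y) + A *v h (c k) y) $ j) (x k) \<bullet> a k + b $ j))"
    for s and c :: "nat \<Rightarrow> 'a set \<times> ('a \<Rightarrow> 'n \<Rightarrow> real)" and A :: "real^'m^'l"
  define Idx where "Idx = (SIGMA s:{2..Suc CARD('m)}. PiE {1..s} (\<lambda>_. \<A>))"
  have "\<exists>B. negligible B \<and> (\<forall>A. A \<notin> B \<longrightarrow> good s c A)" if "(s, c) \<in> Idx" for s c
  proof -
    have s: "1 \<le> s" "s \<le> Suc CARD('m)" and c: "\<And>k. k \<in> {1..s} \<Longrightarrow> c k \<in> atlas N"
      using that \<A>(2) by (auto simp: Idx_def)
    show ?thesis
      unfolding good_def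
      by (rule generic_perturbation_in_coordinates[of s "\<lambda>k. chart_domain (c k)" "\<lambda>k. h (c k)" U F,
          OF s open_chart_domain[OF N c] hU[OF c] hs[OF c] assms(3) Fs])
  qed
  then obtain B where B: "\<And>s c. (s, c) \<in> Idx \<Longrightarrow> negligible (B s c)"
    "\<And>s c A. (s, c) \<in> Idx \<Longrightarrow> A \<notin> B s c \<Longrightarrow> good s c A"
    by metis
  define E where "E = (\<Union>(s, c)\<in>Idx. B s c)"
  have "countable Idx"
    unfolding Idx_def using \<A>(1) by (intro countable_SIGMA countable_PiE) auto
  then have "negligible E"
    unfolding E_def by (intro negligible_countable_Union) (auto intro: B(1))
  define \<Sigma> where "\<Sigma> = {\<pi> :: real^'m \<Rightarrow> real^'l. linear \<pi> \<and> matrix \<pi> \<in> E}"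
  have "matrix ` \<Sigma> \<in> null_sets lebesgue"
    using negligible_subset[OF \<open>negligible E\<close>, of "matrix ` \<Sigma>"] by (auto simp: \<Sigma>_def negligible_iff_null_sets)
  moreover have trans: "transverse (distinct_power N s) (power_manifold Euclid s)
            (tuple_map s ((\<lambda>x. F x + \<pi> x) \<circ> f)) (diagonal Euclid s)"
    if \<pi>: "linear \<pi>" "\<pi> \<notin> \<Sigma>" and s: "2 \<le> s" "s \<le> sf" for \<pi> s
  proof (rule transverse_if_solvable[OF N])
    have \<pi>A: "\<pi> x = matrix \<pi> *v x" for x using \<pi>(1) by (simp add: matrix_works)
    show "1 \<le> s" using s by simp
    fix c j assume c: "c \<in> atlas N"
    show "smooth (chart_domain c) (\<lambda>x. ((\<lambda>x. F x + \<pi> x) \<circ> f) (chart_inv c x) $ j)"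
    proof -
      have o: "open (chart_domain c)" by (rule open_chart_domain[OF N c])
      have "smooth (chart_domain c) (\<lambda>x. F (h c x) $ j)"
        by (rule smooth_compose[of _ U "h c" "\<lambda>y. F y $ j"]) (use o assms(3) hU[OF c] Fs hs[OF c] in auto)
      then have "smooth (chart_domain c) (\<lambda>x. F (h c x) $ j + (\<Sum>i\<in>UNIV. matrix \<pi> $ j $ i * h c x $ i))"
        by (intro smooth_add smooth_sum smooth_mult smooth_const o hs[OF c])
      then show ?thesis by (simp add: \<pi>A h_def matrix_vector_mult_def)
    qed
  next
    fix q assume q: "q \<in> distinct_tuples ?S s"
      and eq: "\<forall>k\<in>{1..s}. ((\<lambda>x. F x + \<pi> x) \<circ> f) (q k) = ((\<lambda>x. F x + \<pi> x) \<circ> f) (q 1)"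
    have \<pi>A: "\<pi> x = matrix \<pi> *v x" for x using \<pi>(1) by (simp add: matrix_works)
    have qS: "q k \<in> ?S" if "k \<in> {1..s}" for k using q that by (auto simp: distinct_tuples_def)
    have "q 1 \<in> ?S" using qS s by simp
    then have "?S \<noteq> {}" by blast
    then have inf: "infinite ?S" by (rule infinite_nonempty_manifold[OF N])
    note ind = s_index_independent[OF inf q s(1) s(2)[unfolded sf_def]]
    define c where "c = (\<lambda>k\<in>{1..s}. SOME c. c \<in> \<A> \<and> q k \<in> fst c)"
    have cA: "c k \<in> \<A> \<and> q k \<in> fst (c k)" if k: "k \<in> {1..s}" for k
    proof -
      have "\<exists>c. c \<in> \<A> \<and> q k \<in> fst c" using \<A>(3)[OF qS[OF k]] by blast
      from someI_ex[OF this] show ?thesis using k by (simp add: c_def)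
    qed
    have "(s, c) \<in> Idx" using cA ind(1) s by (auto simp: Idx_def c_def)
    then have good: "good s c (matrix \<pi>)"
      using B(2) \<pi> unfolding \<Sigma>_def E_def by blast
    have hq: "h (c k) (chart_vec (c k) (q k)) = f (q k)" if "k \<in> {1..s}" for k
      using cA[OF that] \<A>(2) chart_inv_chart_vec[OF N, of "c k" "q k"] by (auto simp: h_def)
    have "\<forall>u. \<exists>a b. \<forall>k\<in>{1..s}. \<forall>j.
      u k $ j = grad (\<lambda>y. (F (h (c k) y) + matrix \<pi> *v h (c k) y) $ j) (chart_vec (c k) (q k)) \<bullet> a k + b $ j"
      (is "\<forall>u. ?solvable u")
    proof
      fix u :: "nat \<Rightarrow> real^'l"
      show "?solvable u"
      proof (rule good[unfolded good_def, rule_format])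
        show "chart_vec (c k) (q k) \<in> chart_domain (c k)" if "k \<in> {1..s}" for k
          using cA[OF that] by (simp add: chart_vec_in)
        have "1 \<in> {1..s}" using s by simp
        note h1 = hq[OF this]
        show "\<alpha> k = 0" if 0: "(\<Sum>k\<in>{2..s}. \<alpha> k *\<^sub>R (h (c k) (chart_vec (c k) (q k))
            - h (c 1) (chart_vec (c 1) (q 1)))) = 0" and k: "k \<in> {2..s}" for \<alpha> k
        proof (rule ind(2)[OF _ k])
          have "(\<Sum>k\<in>{2..s}. \<alpha> k *\<^sub>R (f (q k) - f (q 1))) = (\<Sum>k\<in>{2..s}. \<alpha> k *\<^sub>R
              (h (c k) (chart_vec (c k) (q k)) - h (c 1) (chart_vec (c 1) (q 1))))"
            by (intro sum.cong refl) (simp add: hq h1)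
          then show "(\<Sum>k\<in>{2..s}. \<alpha> k *\<^sub>R (f (q k) - f (q 1))) = 0" using 0 by simp
        qed
        show "F (h (c k) (chart_vec (c k) (q k))) + matrix \<pi> *v h (c k) (chart_vec (c k) (q k))
            = F (h (c 1) (chart_vec (c 1) (q 1))) + matrix \<pi> *v h (c 1) (chart_vec (c 1) (q 1))"
          if "k \<in> {1..s}" for k
          using eq[rule_format, OF that] hq[OF that] h1 by (simp add: \<pi>A)
      qed
    qed
    then show "\<exists>c. (\<forall>k\<in>{1..s}. c k \<in> atlas N \<and> q k \<in> fst (c k)) \<and>
        (\<forall>u. \<exists>a b. \<forall>k\<in>{1..s}. \<forall>j. u k $ j =
          grad (\<lambda>x. ((\<lambda>x. F x + \<pi> x) \<circ> f) (chart_inv (c k) x) $ j) (chart_vec (c k) (q k)) \<bullet> a k + b $ j)"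
      using cA \<A>(2) by (intro exI[of _ c] conjI) (auto simp: h_def \<pi>A)
  qed
  moreover have "normal_crossings N Euclid ((\<lambda>x. F x + \<pi> x) \<circ> f)"
    if \<pi>: "linear \<pi>" "\<pi> \<notin> \<Sigma>"
      and fib: "\<forall>y. finite {x \<in> U. F x + \<pi> x = y} \<and> card {x \<in> U. F x + \<pi> x = y} \<le> sf" for \<pi>
    unfolding normal_crossings_def
  proof (intro allI impI)
    fix s :: nat assume s: "2 \<le> s"
    show "transverse (distinct_power N s) (power_manifold Euclid s)
            (tuple_map s ((\<lambda>x. F x + \<pi> x) \<circ> f)) (diagonal Euclid s)"
    proof (cases "s \<le> sf")
      case True
      then show ?thesis using trans \<pi> s by blast
    next
      case False
      have "tuple_map s ((\<lambda>x. F x + \<pi> x) \<circ> f) q \<notin> diagonal Euclid s" if q: "q \<in> distinct_tuples ?S s" for q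
      proof
        assume "tuple_map s ((\<lambda>x. F x + \<pi> x) \<circ> f) q \<in> diagonal Euclid s"
        then obtain y where gq: "tuple_map s ((\<lambda>x. F x + \<pi> x) \<circ> f) q = (\<lambda>k\<in>{1..s}. y)"
          by (auto simp: diagonal_def)
        have y: "F (f (q k)) + \<pi> (f (q k)) = y" if "k \<in> {1..s}" for k
          using fun_cong[OF gq, of k] that by (simp add: tuple_map_def)
        have qS: "q ` {1..s} \<subseteq> ?S" and qi: "inj_on q {1..s}" using q by (auto simp: distinct_tuples_def)
        have fU: "f p \<in> U" if "p \<in> ?S" for p
          using assms(4) that
          by (auto simp: smooth_map_def atlas_open_submanifold_Euclid continuous_map_in_subtopology)
        have "inj_on (\<lambda>k. f (q k)) {1..s}"
          using comp_inj_on[OF qi inj_on_subset[OF assms(5) qS]] by (simp add: o_def)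
        then have "s = card ((\<lambda>k. f (q k)) ` {1..s})" by (simp add: card_image)
        also have "\<dots> \<le> card {x \<in> U. F x + \<pi> x = y}"
          using fib qS fU y by (intro card_mono) auto
        also have "\<dots> \<le> sf" using fib by blast
        finally show False using False by simp
      qed
      then show ?thesis by (simp add: transverse_def topspace_distinct_power)
    qed
  qed
  ultimately show ?thesis
    unfolding sf_def by (intro exI[of _ \<Sigma>] conjI ballI allI impI) (simp_all add: \<Sigma>_def subset_iff)
qed

end
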